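(* Let $d\ge1$, $L,\gamma>0$, let $U$ satisfy the standing assumptions in the context, and use the scales $\delta_\varepsilon,a_\varepsilon$, the saddle box $\mathcal K_\varepsilon$, the side layers $\mathcal A^\pm_{\varepsilon,\vartheta}$, the sets $J_\varepsilon^m,J_\varepsilon^s,J_\varepsilon^c$ and the saddle profile $\Phi_\sigma(\Lambda_\sigma/\sqrt\varepsilon)$ defined there. Let $\rho_\varepsilon=\delta_\varepsilon^3$. For all sufficiently small $\varepsilon$ there is $G_\varepsilon\in C_c^\infty(\mathbb R^{3d};[0,1])$ such that $$G_\varepsilon=1\ \text{ on }\{H\le U(\sigma)+a_\varepsilon/2\},\qquad G_\varepsilon=0\ \text{ on }\{H\ge U(\sigma)+5a_\varepsilon/6\},$$ and $|\partial^\alpha G_\varepsilon|\le C_\alpha\rho_\varepsilon^{-|\alpha|}$ for every multi-index $\alpha$, with $C_\alpha$ independent of $\varepsilon$. Writing $j_\varepsilon=\Phi_\sigma(\Lambda_\sigma/\sqrt\varepsilon)$, for every $\vartheta>0$ there is (for all sufficiently small $\varepsilon$) an admissible $f_{\varepsilon,\vartheta}\in C_c^2(\mathbb R^{3d};[0,1])$, i.e. $f_{\varepsilon,\vartheta}=1$ near $\overline{A_\varepsilon}$ and $f_{\varepsilon,\vartheta}=0$ near $\overline{S_\varepsilon}$, such that $$f_{\varepsilon,\vartheta}=\begin{cases}G_\varepsilon\{j_\varepsilon+\chi^-_{\varepsilon,\vartheta}(1-j_\varepsilon)\}&\text{on the $m$-side layer }\mathcal A^-_{\varepsilon,\vartheta},\\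 G_\varepsilon j_\varepsilon&\text{on }\mathcal K_\varepsilon,\\ G_\varepsilon(1-\chi^+_{\varepsilon,\vartheta})j_\varepsilon&\text{on the $s$-side layer }\mathcal A^+_{\varepsilon,\vartheta},\\ G_\varepsilon&\text{on }J_\varepsilon^m\text{ away from the layer},\\ 0&\text{on }J_\varepsilon^s\text{ away from the layer, or on }J_\varepsilon^c,\end{cases}$$ where $\chi^\pm_{\varepsilon,\vartheta}$ are $[0,1]$-valued cutoff functions of $q_1$ that are flat at both ends of the respective layer, equal to one at the outer end and zero at the inner end. Every derivative of $f_{\varepsilon,\vartheta}$ not contained in $\mathcal K_\varepsilon$ or in a side layer $\mathcal A^\pm_{\varepsilon,\vartheta}$ is supported in $\{H\ge U(\sigma)+a_\varepsilon/2\}$.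
   Context: Standing assumptions on the potential. $U\in C^\infty(\mathbb R^d)$ is a Morse function with exactly two local minima $m,s$. With $\Gamma(m,s)$ the set of continuous paths from $m$ to $s$ and $h_{m,s}=\inf_{\omega\in\Gamma(m,s)}\max_{t\in[0,1]}U(\omega(t))$, assume $h_{m,s}=U(\sigma)>\max\{U(m),U(s)\}$ and that the height is realized by a unique index-one saddle point $\sigma$. $\nabla^2U(m)$ is positive definite; $H_\sigma=\nabla^2U(\sigma)$ has exactly one negative eigenvalue $-\lambda_\sigma<0$ and $d-1$ positive eigenvalues $\lambda_i^\sigma$, $i=2,\dots,d$. With $\Omega_m,\Omega_s$ the components of $\{U<U(\sigma)\}$ containing $m,s$: $\operatorname{Crit}(U)\cap\Omega_i=\{i\}$, $\sigma\in\partial\Omega_m\cap\partial\Omega_s$, and the only critical point of $U$ in $\partial\Omega_i\cap\{U=U(\sigma)\}$ is $\sigma$ ($i\in\{m,s\}$). $U$ is bounded below and, after adding a constant, $U\ge0$, with compact sublevel sets; there are $c_0,R_0>0$ with $\theta\cdot\nabla U\ge c_0(|\theta|^2+U)$ for $|\theta|\ge R_0$; $\nabla U$ and all its derivatives grow at most polynomially; there is $\beta>0$ with $\liminf_{|\theta|\to\infty}(|\nabla U|-\beta\Delta U)>0$; and $\frac{|\nabla U|^2}{(1+U)(1+\theta\cdot\nabla U)}\to0$ as $|\theta|\to\infty$. Notation. $z=(\theta,p,r)\in\mathbb R^{3d}$, $H(z)=U(\theta)+\frac L2|p|^2+\frac L2|r|^2$, $x_m=(m,0,0)$, $x_s=(s,0,0)$,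 $z_\sigma=(\sigma,0,0)$, $A_\varepsilon=B(x_m,\varepsilon)$, $S_\varepsilon=B(x_s,\varepsilon)$; $W_m,W_s$ are the components of $\{H<U(\sigma)\}$ containing $x_m,x_s$. $e_\sigma$ is a unit eigenvector of $H_\sigma$ for $-\lambda_\sigma$; $(q,v,w)$ are the coordinates of $(\theta-\sigma,p,r)$ in an orthonormal eigenbasis of $H_\sigma$ with first vector $e_\sigma$, the sign of $e_\sigma$ being chosen so that near $z_\sigma$ the set $W_m$ lies in $\{q_1<0\}$ and $W_s$ in $\{q_1>0\}$. $\mu_\sigma$ is the unique positive root of $\mu^3+\gamma\mu^2+(\gamma^2-\lambda_\sigma/L)\mu-\gamma\lambda_\sigma/L=0$; $\alpha_\sigma=\frac{\lambda_\sigma}{L\mu_\sigma}$, $\zeta_\sigma=\frac\gamma{\mu_\sigma+\gamma}$, $c_\sigma=\frac\gamma L\zeta_\sigma^2$, $\Lambda_\sigma=\alpha_\sigma q_1+v_1+\zeta_\sigma w_1$, $\Phi_\sigma(x)=\int_x^\infty e^{-\mu_\sigma y^2/(2c_\sigma)}dy\big/\int_{\mathbb R}e^{-\mu_\sigma y^2/(2c_\sigma)}dy$. Scales, boxes, layers. $R_\varepsilon=K\sqrt{\log(1/\varepsilon)}$, $\delta_\varepsilon=\sqrt\varepsilon R_\varepsilon$, $a_\varepsilon=c_K\varepsilon R_\varepsilon^2$; first $c_K>0$ is fixed sufficiently small and then $K$ is fixed sufficiently large (independent of $\varepsilon,\vartheta$). $$\mathcal K_\varepsilon=\Big\{|q_1|\le\tfrac{\delta_\varepsilon}{\sqrt{\lambda_\sigma}},\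 |q_i|\le\tfrac{2\delta_\varepsilon}{\sqrt{\lambda_i^\sigma}}\ (i\ge2),\ |v_i|,|w_i|\le\tfrac{2\delta_\varepsilon}{\sqrt L}\Big\}.$$ The layer $\mathcal A^-_{\varepsilon,\vartheta}$ is given by the same bounds on $q_i$ ($i\ge2$), $v_i$, $w_i$ together with $-\frac{\delta_\varepsilon+\vartheta\sqrt\varepsilon}{\sqrt{\lambda_\sigma}}\le q_1\le-\frac{\delta_\varepsilon}{\sqrt{\lambda_\sigma}}$; $\mathcal A^+_{\varepsilon,\vartheta}$ is its mirror image under $q_1\mapsto-q_1$. The inner end of a layer is $|q_1|=\delta_\varepsilon/\sqrt{\lambda_\sigma}$ and the outer end is $|q_1|=(\delta_\varepsilon+\vartheta\sqrt\varepsilon)/\sqrt{\lambda_\sigma}$; "flat" means that the derivatives vanish there. $J_\varepsilon=\{H<U(\sigma)+a_\varepsilon\}$; $J_\varepsilon^m,J_\varepsilon^s$ are the components of $J_\varepsilon\setminus\mathcal K_\varepsilon$ containing $x_m,x_s$; $J_\varepsilon^c$ is the union of the remaining components. *)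

theory Defs
  imports "HOL-Analysis.Analysis"
begin

section \<open>Partial derivatives and differentiability classes\<close>

definition pdv :: "'a::euclidean_space \<Rightarrow> ('a \<Rightarrow> 'b::real_normed_vector) \<Rightarrow> 'a \<Rightarrow> 'b" where
  "pdv b f x = frechet_derivative f (at x) b"

text \<open>A multi-index of order \<open>k\<close> is written as a list of \<open>k\<close> vectors of the standard basis
  \<^const>\<open>Basis\<close>, every ordering being allowed. On functions that are \<open>k\<close> times continuously
  differentiable the order of the list is irrelevant.\<close>

primrec mpdv :: "'a::euclidean_space list \<Rightarrow> ('a \<Rightarrow> 'b::real_normed_vector) \<Rightarrow> 'a \<Rightarrow> 'b" where
  "mpdv [] f = f"
| "mpdv (b # bs) f = pdv b (mpdv bs f)"

primrec Ck :: "nat \<Rightarrow> ('a::euclidean_space \<Rightarrow> 'b::real_normed_vector) \<Rightarrow> bool" where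
  "Ck 0 f \<longleftrightarrow> continuous_on UNIV f"
| "Ck (Suc k) f \<longleftrightarrow> (\<forall>x. f differentiable (at x)) \<and> (\<forall>b\<in>Basis. Ck k (pdv b f))"

definition smooth :: "('a::euclidean_space \<Rightarrow> 'b::real_normed_vector) \<Rightarrow> bool" where
  "smooth f \<longleftrightarrow> (\<forall>k. Ck k f)"

definition supp :: "('a::topological_space \<Rightarrow> real) \<Rightarrow> 'a set" where
  "supp f = closure {x. f x \<noteq> 0}"

definition grad :: "(real^'d \<Rightarrow> real) \<Rightarrow> real^'d \<Rightarrow> real^'d" where
  "grad U \<theta> = (\<chi> i. pdv (axis i 1) U \<theta>)"

definition hessian :: "(real^'d \<Rightarrow> real) \<Rightarrow> real^'d \<Rightarrow> real^'d^'d" where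
  "hessian U \<theta> = (\<chi> i j. mpdv [axis i 1, axis j 1] U \<theta>)"

definition laplacian :: "(real^'d \<Rightarrow> real) \<Rightarrow> real^'d \<Rightarrow> real" where
  "laplacian U \<theta> = trace (hessian U \<theta>)"

section \<open>The potential\<close>

definition Crit :: "(real^'d \<Rightarrow> real) \<Rightarrow> (real^'d) set" where
  "Crit U = {\<theta>. grad U \<theta> = 0}"

definition morse :: "(real^'d \<Rightarrow> real) \<Rightarrow> bool" where
  "morse U \<longleftrightarrow> smooth U \<and> (\<forall>\<theta>\<in>Crit U. invertible (hessian U \<theta>))"

definition local_min :: "(real^'d \<Rightarrow> real) \<Rightarrow> real^'d \<Rightarrow> bool" where
  "local_min U \<theta> \<longleftrightarrow> (\<forall>\<^sub>F y in nhds \<theta>. U \<theta> \<le> U y)"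

text \<open>Number of negative eigenvalues, each counted with its geometric multiplicity (only used for
  symmetric matrices, where this is also the algebraic multiplicity).\<close>

definition neg_index :: "real^'d^'d \<Rightarrow> nat" where
  "neg_index A = (\<Sum>\<mu> | \<mu> < 0 \<and> (\<exists>x. x \<noteq> 0 \<and> A *v x = \<mu> *\<^sub>R x). dim {x. A *v x = \<mu> *\<^sub>R x})"

definition index_one_saddle :: "(real^'d \<Rightarrow> real) \<Rightarrow> real^'d \<Rightarrow> bool" where
  "index_one_saddle U \<tau> \<longleftrightarrow> \<tau> \<in> Crit U \<and> neg_index (hessian U \<tau>) = 1"

definition height :: "(real^'d \<Rightarrow> real) \<Rightarrow> real^'d \<Rightarrow> real^'d \<Rightarrow> real" where
  "height U m s =
     (INF \<omega>\<in>{\<omega>. path \<omega> \<and> pathstart \<omega> = m \<and> pathfinish \<omega> = s}. SUP t\<in>{0..1}. U (\<omega> t))"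

definition well :: "(real^'d \<Rightarrow> real) \<Rightarrow> real^'d \<Rightarrow> real^'d \<Rightarrow> (real^'d) set" where
  "well U \<sigma> i = connected_component_set {\<theta>. U \<theta> < U \<sigma>} i"

definition landscape :: "(real^'d \<Rightarrow> real) \<Rightarrow> real^'d \<Rightarrow> real^'d \<Rightarrow> real^'d \<Rightarrow> bool" where
  "landscape U m s \<sigma> \<longleftrightarrow>
     morse U \<and> m \<noteq> s \<and> {\<theta>. local_min U \<theta>} = {m, s} \<and>
     height U m s = U \<sigma> \<and> U \<sigma> > max (U m) (U s) \<and>
     index_one_saddle U \<sigma> \<and>
     (\<forall>\<tau>. index_one_saddle U \<tau> \<and> U \<tau> = height U m s \<longrightarrow> \<tau> = \<sigma>) \<and>
     (\<forall>x. x \<noteq> 0 \<longrightarrow> x \<bullet> (hessian U m *v x) > 0) \<and>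
     (\<forall>i\<in>{m, s}. Crit U \<inter> well U \<sigma> i = {i} \<and>
        \<sigma> \<in> frontier (well U \<sigma> i) \<and>
        Crit U \<inter> frontier (well U \<sigma> i) \<inter> {\<theta>. U \<theta> = U \<sigma>} = {\<sigma>})"

definition confining :: "(real^'d \<Rightarrow> real) \<Rightarrow> bool" where
  "confining U \<longleftrightarrow>
     (\<forall>\<theta>. U \<theta> \<ge> 0) \<and> (\<forall>c. compact {\<theta>. U \<theta> \<le> c}) \<and>
     (\<exists>c\<^sub>0>0. \<exists>R\<^sub>0>0. \<forall>\<theta>. norm \<theta> \<ge> R\<^sub>0 \<longrightarrow> \<theta> \<bullet> grad U \<theta> \<ge> c\<^sub>0 * ((norm \<theta>)\<^sup>2 + U \<theta>)) \<and>
     (\<forall>bs. bs \<noteq> [] \<and> set bs \<subseteq> Basis \<longrightarrow>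
        (\<exists>C N. \<forall>\<theta>. \<bar>mpdv bs U \<theta>\<bar> \<le> C * (1 + norm \<theta>) ^ N)) \<and>
     (\<exists>\<beta>>0. Liminf at_infinity (\<lambda>\<theta>. ereal (norm (grad U \<theta>) - \<beta> * laplacian U \<theta>)) > 0) \<and>
     ((\<lambda>\<theta>. (norm (grad U \<theta>))\<^sup>2 / ((1 + U \<theta>) * (1 + \<theta> \<bullet> grad U \<theta>))) \<longlongrightarrow> 0) at_infinity"

section \<open>Phase space and the saddle frame\<close>

text \<open>The product norm on this type is the Euclidean norm of \<open>\<real>\<^sup>3\<^sup>d\<close>, \<open>d = CARD('d)\<close>.\<close>

type_synonym 'd phase = "(real^'d) \<times> (real^'d) \<times> (real^'d)"

definition Ham :: "(real^'d \<Rightarrow> real) \<Rightarrow> real \<Rightarrow> 'd phase \<Rightarrow> real" where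
  "Ham U L = (\<lambda>(\<theta>, p, r). U \<theta> + L / 2 * (norm p)\<^sup>2 + L / 2 * (norm r)\<^sup>2)"

definition qc :: "real^'d \<Rightarrow> ('d \<Rightarrow> real^'d) \<Rightarrow> 'd \<Rightarrow> 'd phase \<Rightarrow> real" where
  "qc \<sigma> e i = (\<lambda>(\<theta>, p, r). (\<theta> - \<sigma>) \<bullet> e i)"

definition vc :: "('d \<Rightarrow> real^'d) \<Rightarrow> 'd \<Rightarrow> 'd phase \<Rightarrow> real" where
  "vc e i = (\<lambda>(\<theta>, p, r). p \<bullet> e i)"

definition wc :: "('d \<Rightarrow> real^'d) \<Rightarrow> 'd \<Rightarrow> 'd phase \<Rightarrow> real" where
  "wc e i = (\<lambda>(\<theta>, p, r). r \<bullet> e i)"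

definition phase_well :: "(real^'d \<Rightarrow> real) \<Rightarrow> real \<Rightarrow> real^'d \<Rightarrow> real^'d \<Rightarrow> 'd phase set" where
  "phase_well U L \<sigma> i = connected_component_set {z. Ham U L z < U \<sigma>} (i, 0, 0)"

text \<open>\<open>k\<close> is the index written \<open>1\<close> in \<open>q\<^sub>1, v\<^sub>1, w\<^sub>1\<close>, so \<open>e k\<close> is the unstable direction.
  \<open>lam k\<close> is the absolute value \<open>\<lambda>\<^sub>\<sigma>\<close> of the negative eigenvalue; \<open>lam i\<close>, \<open>i \<noteq> k\<close>, are the
  positive eigenvalues.\<close>

definition saddle_frame ::
  "(real^'d \<Rightarrow> real) \<Rightarrow> real \<Rightarrow> real^'d \<Rightarrow> real^'d \<Rightarrow> real^'d
     \<Rightarrow> ('d \<Rightarrow> real^'d) \<Rightarrow> ('d \<Rightarrow> real) \<Rightarrow> 'd \<Rightarrow> bool" where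
  "saddle_frame U L m s \<sigma> e lam k \<longleftrightarrow>
     (\<forall>i j. e i \<bullet> e j = (if i = j then 1 else 0)) \<and>
     (\<forall>i. lam i > 0) \<and>
     hessian U \<sigma> *v e k = - lam k *\<^sub>R e k \<and>
     (\<forall>i. i \<noteq> k \<longrightarrow> hessian U \<sigma> *v e i = lam i *\<^sub>R e i) \<and>
     (\<forall>\<^sub>F z in nhds (\<sigma>, 0, 0).
        (z \<in> phase_well U L \<sigma> m \<longrightarrow> qc \<sigma> e k z < 0) \<and>
        (z \<in> phase_well U L \<sigma> s \<longrightarrow> qc \<sigma> e k z > 0))"

section \<open>The saddle profile\<close>

text \<open>In this section \<open>l\<close> stands for \<open>\<lambda>\<^sub>\<sigma>\<close>.\<close>

definition mu_s :: "real \<Rightarrow> real \<Rightarrow> real \<Rightarrow> real" where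
  "mu_s L \<gamma> l =
     (THE \<mu>. \<mu> > 0 \<and> \<mu>^3 + \<gamma> * \<mu>\<^sup>2 + (\<gamma>\<^sup>2 - l / L) * \<mu> - \<gamma> * l / L = 0)"

definition alpha_s :: "real \<Rightarrow> real \<Rightarrow> real \<Rightarrow> real" where
  "alpha_s L \<gamma> l = l / (L * mu_s L \<gamma> l)"

definition zeta_s :: "real \<Rightarrow> real \<Rightarrow> real \<Rightarrow> real" where
  "zeta_s L \<gamma> l = \<gamma> / (mu_s L \<gamma> l + \<gamma>)"

definition c_s :: "real \<Rightarrow> real \<Rightarrow> real \<Rightarrow> real" where
  "c_s L \<gamma> l = \<gamma> / L * (zeta_s L \<gamma> l)\<^sup>2"

definition Phi_s :: "real \<Rightarrow> real \<Rightarrow> real \<Rightarrow> real \<Rightarrow> real" where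
  "Phi_s L \<gamma> l x =
     (LBINT y:{x..}. exp (- (mu_s L \<gamma> l * y\<^sup>2 / (2 * c_s L \<gamma> l)))) /
     (LBINT y. exp (- (mu_s L \<gamma> l * y\<^sup>2 / (2 * c_s L \<gamma> l))))"

definition Lambda_s ::
  "real \<Rightarrow> real \<Rightarrow> real^'d \<Rightarrow> ('d \<Rightarrow> real^'d) \<Rightarrow> ('d \<Rightarrow> real) \<Rightarrow> 'd \<Rightarrow> 'd phase \<Rightarrow> real" where
  "Lambda_s L \<gamma> \<sigma> e lam k z =
     alpha_s L \<gamma> (lam k) * qc \<sigma> e k z + vc e k z + zeta_s L \<gamma> (lam k) * wc e k z"

definition profile ::
  "real \<Rightarrow> real \<Rightarrow> real^'d \<Rightarrow> ('d \<Rightarrow> real^'d) \<Rightarrow> ('d \<Rightarrow> real) \<Rightarrow> 'd \<Rightarrow> real \<Rightarrow> 'd phase \<Rightarrow> real" where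
  "profile L \<gamma> \<sigma> e lam k \<epsilon> z = Phi_s L \<gamma> (lam k) (Lambda_s L \<gamma> \<sigma> e lam k z / sqrt \<epsilon>)"

section \<open>Scales, box, layers and level-set components\<close>

definition scale_R :: "real \<Rightarrow> real \<Rightarrow> real" where
  "scale_R K \<epsilon> = K * sqrt (ln (1 / \<epsilon>))"

definition scale_d :: "real \<Rightarrow> real \<Rightarrow> real" where
  "scale_d K \<epsilon> = sqrt \<epsilon> * scale_R K \<epsilon>"

definition scale_a :: "real \<Rightarrow> real \<Rightarrow> real \<Rightarrow> real" where
  "scale_a c\<^sub>K K \<epsilon> = c\<^sub>K * \<epsilon> * (scale_R K \<epsilon>)\<^sup>2"

definition scale_rho :: "real \<Rightarrow> real \<Rightarrow> real" where
  "scale_rho K \<epsilon> = (scale_d K \<epsilon>) ^ 3"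

definition tube ::
  "real \<Rightarrow> real^'d \<Rightarrow> ('d \<Rightarrow> real^'d) \<Rightarrow> ('d \<Rightarrow> real) \<Rightarrow> 'd \<Rightarrow> real \<Rightarrow> real \<Rightarrow> 'd phase set" where
  "tube L \<sigma> e lam k K \<epsilon> =
     {z. (\<forall>i. i \<noteq> k \<longrightarrow> \<bar>qc \<sigma> e i z\<bar> \<le> 2 * scale_d K \<epsilon> / sqrt (lam i)) \<and>
         (\<forall>i. \<bar>vc e i z\<bar> \<le> 2 * scale_d K \<epsilon> / sqrt L \<and> \<bar>wc e i z\<bar> \<le> 2 * scale_d K \<epsilon> / sqrt L)}"

definition inner_end :: "real \<Rightarrow> real \<Rightarrow> real \<Rightarrow> real" where
  "inner_end l K \<epsilon> = scale_d K \<epsilon> / sqrt l"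

definition outer_end :: "real \<Rightarrow> real \<Rightarrow> real \<Rightarrow> real \<Rightarrow> real" where
  "outer_end l K vth \<epsilon> = (scale_d K \<epsilon> + vth * sqrt \<epsilon>) / sqrt l"

definition saddle_box ::
  "real \<Rightarrow> real^'d \<Rightarrow> ('d \<Rightarrow> real^'d) \<Rightarrow> ('d \<Rightarrow> real) \<Rightarrow> 'd \<Rightarrow> real \<Rightarrow> real \<Rightarrow> 'd phase set" where
  "saddle_box L \<sigma> e lam k K \<epsilon> =
     {z \<in> tube L \<sigma> e lam k K \<epsilon>. \<bar>qc \<sigma> e k z\<bar> \<le> inner_end (lam k) K \<epsilon>}"

definition layer_minus ::
  "real \<Rightarrow> real^'d \<Rightarrow> ('d \<Rightarrow> real^'d) \<Rightarrow> ('d \<Rightarrow> real) \<Rightarrow> 'd \<Rightarrow> real \<Rightarrow> real \<Rightarrow> real \<Rightarrow> 'd phase set" where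
  "layer_minus L \<sigma> e lam k K vth \<epsilon> =
     {z \<in> tube L \<sigma> e lam k K \<epsilon>.
        - outer_end (lam k) K vth \<epsilon> \<le> qc \<sigma> e k z \<and> qc \<sigma> e k z \<le> - inner_end (lam k) K \<epsilon>}"

definition layer_plus ::
  "real \<Rightarrow> real^'d \<Rightarrow> ('d \<Rightarrow> real^'d) \<Rightarrow> ('d \<Rightarrow> real) \<Rightarrow> 'd \<Rightarrow> real \<Rightarrow> real \<Rightarrow> real \<Rightarrow> 'd phase set" where
  "layer_plus L \<sigma> e lam k K vth \<epsilon> =
     {z \<in> tube L \<sigma> e lam k K \<epsilon>.
        inner_end (lam k) K \<epsilon> \<le> qc \<sigma> e k z \<and> qc \<sigma> e k z \<le> outer_end (lam k) K vth \<epsilon>}"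

text \<open>\<open>x\<close> is the inner and \<open>y\<close> the outer end of the range of \<open>q\<^sub>1\<close>; either may be the larger.\<close>

definition flat_cutoff :: "(real \<Rightarrow> real) \<Rightarrow> real \<Rightarrow> real \<Rightarrow> bool" where
  "flat_cutoff X x y \<longleftrightarrow>
     smooth X \<and> range X \<subseteq> {0..1} \<and> X x = 0 \<and> X y = 1 \<and>
     (\<forall>n\<ge>1. (deriv ^^ n) X x = 0 \<and> (deriv ^^ n) X y = 0)"

definition J_set :: "(real^'d \<Rightarrow> real) \<Rightarrow> real \<Rightarrow> real^'d \<Rightarrow> real \<Rightarrow> real \<Rightarrow> real \<Rightarrow> 'd phase set" where
  "J_set U L \<sigma> c\<^sub>K K \<epsilon> = {z. Ham U L z < U \<sigma> + scale_a c\<^sub>K K \<epsilon>}"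

definition J_comp ::
  "(real^'d \<Rightarrow> real) \<Rightarrow> real \<Rightarrow> real^'d \<Rightarrow> ('d \<Rightarrow> real^'d) \<Rightarrow> ('d \<Rightarrow> real) \<Rightarrow> 'd
     \<Rightarrow> real \<Rightarrow> real \<Rightarrow> real \<Rightarrow> real^'d \<Rightarrow> 'd phase set" where
  "J_comp U L \<sigma> e lam k c\<^sub>K K \<epsilon> i =
     connected_component_set (J_set U L \<sigma> c\<^sub>K K \<epsilon> - saddle_box L \<sigma> e lam k K \<epsilon>) (i, 0, 0)"

definition J_rest ::
  "(real^'d \<Rightarrow> real) \<Rightarrow> real \<Rightarrow> real^'d \<Rightarrow> real^'d \<Rightarrow> real^'d \<Rightarrow> ('d \<Rightarrow> real^'d) \<Rightarrow> ('d \<Rightarrow> real) \<Rightarrow> 'd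
     \<Rightarrow> real \<Rightarrow> real \<Rightarrow> real \<Rightarrow> 'd phase set" where
  "J_rest U L m s \<sigma> e lam k c\<^sub>K K \<epsilon> =
     \<Union> (components (J_set U L \<sigma> c\<^sub>K K \<epsilon> - saddle_box L \<sigma> e lam k K \<epsilon>)
         - {J_comp U L \<sigma> e lam k c\<^sub>K K \<epsilon> m, J_comp U L \<sigma> e lam k c\<^sub>K K \<epsilon> s})"

definition const_near :: "('a::topological_space \<Rightarrow> real) \<Rightarrow> real \<Rightarrow> 'a set \<Rightarrow> bool" where
  "const_near f c S \<longleftrightarrow> (\<exists>V. open V \<and> S \<subseteq> V \<and> (\<forall>z\<in>V. f z = c))"

definition admissible :: "real^'d \<Rightarrow> real^'d \<Rightarrow> real \<Rightarrow> ('d phase \<Rightarrow> real) \<Rightarrow> bool" where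
  "admissible m s \<epsilon> f \<longleftrightarrow>
     const_near f 1 (closure (ball (m, 0, 0) \<epsilon>)) \<and> const_near f 0 (closure (ball (s, 0, 0) \<epsilon>))"

end

theory Submission
  imports Defs "HOL-Real_Asymp.Real_Asymp" "HOL-Computational_Algebra.Polynomial"
begin

text \<open>
  Write \<open>z\<^sub>0 = (\<sigma>, 0, 0)\<close> for the saddle in phase space, \<open>H\<close> for the Hamiltonian, and \<open>\<delta>\<close>, \<open>a\<close> for
  the scales, so that \<open>a = c\<^sub>K \<delta>\<^sup>2\<close>. The cutoff is \<open>G = \<psi> ((H - U \<sigma>) / a)\<close> with a fixed smooth
  step \<open>\<psi>\<close>. Every derivative of \<open>G\<close> costs at most one factor \<open>1 / a\<close>, since \<open>H\<close> is smooth and the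
  sublevel sets are compact (\<open>scaled_composition_bound\<close>), and \<open>a \<ge> \<delta>\<^sup>3\<close> for small \<open>\<delta>\<close>.

  The pieces of \<open>f\<close> are prescribed, so the question is only whether they fit. On the box and the
  two layers \<open>f\<close> is the product \<open>F = G (j + \<chi>\<^sup>- (1 - j)) (1 - \<chi>\<^sup>+)\<close>, which is \<open>C\<^sup>2\<close> on the whole
  space, equals \<open>G\<close> beyond the outer end on the \<open>m\<close>-side and \<open>0\<close> beyond the outer end on the
  \<open>s\<close>-side. Elsewhere \<open>f\<close> is \<open>G\<close> on \<open>J\<^sup>m\<close> and \<open>0\<close> on all other components. As \<open>G\<close> vanishes
  well below the level \<open>U \<sigma> + a\<close>, the pieces fit (\<open>glued_function\<close>) as soon as three geometric
  facts hold.

  \<^item> The lateral faces of the tube containing the box and the layers lie above the level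
    \<open>U \<sigma> + a\<close>: there the stable directions contribute at least about \<open>2 \<delta>\<^sup>2\<close> to \<open>H - U \<sigma>\<close>, while the
    unstable direction takes away at most about \<open>9/8 \<delta>\<^sup>2\<close> (\<open>tube_strict\<close>).

  \<^item> The part of the sublevel set that lies in the tube, just beyond the left end of the box, belongs
    to \<open>J\<^sup>m\<close>; likewise on the right with \<open>J\<^sup>s\<close> (\<open>side_component\<close>). Near the saddle \<open>H\<close> is convex in
    the stable directions and below \<open>U \<sigma>\<close> on the unstable axis, so this part can be contracted to
    the axis inside the sublevel set. Hence it is connected, and it meets the well \<open>W\<^sub>m\<close>. The well
    stays on one side of the saddle, so it can reach the box only through this part. If the part
    missed \<open>J\<^sup>m\<close>, then \<open>W\<^sub>m \<inter> J\<^sup>m\<close> would be open and closed in the connected set \<open>W\<^sub>m\<close>.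

  \<^item> \<open>J\<^sup>m\<close> and \<open>J\<^sup>s\<close> are different (\<open>basins_separated\<close>). At a boundary point of \<open>W\<^sub>m\<close> other than
    \<open>z\<^sub>0\<close> the gradient of \<open>H\<close> does not vanish, so \<open>{H \<le> U \<sigma>}\<close> is locally contained in the closure
    of \<open>W\<^sub>m\<close>. Therefore \<open>{H \<le> U \<sigma>}\<close> splits into two compact sets that touch only at \<open>z\<^sub>0\<close>. Away
    from \<open>z\<^sub>0\<close> this splitting survives a small increase of the level by compactness; near \<open>z\<^sub>0\<close>
    the hyperplane \<open>q\<^sub>1 = 0\<close> separates, because it meets the sublevel set only inside the box.

  The geometry is developed in the locale \<open>saddle_chart\<close> for a function on a Euclidean space with an
  orthonormal frame; this treats the \<open>3 d\<close> phase-space coordinates uniformly.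
\<close>

section \<open>Calculus of $C^k$ functions\<close>

lemma pdv_eq: "(f has_derivative f') (at x) \<Longrightarrow> pdv b f x = f' b"
  unfolding pdv_def by (metis frechet_derivative_at)

lemma differentiable_has_pdv:
  "f differentiable (at x) \<Longrightarrow> (f has_derivative (\<lambda>b. pdv b f x)) (at x)"
  unfolding pdv_def by (simp add: frechet_derivative_works)

lemma pdv_cong_open:
  assumes "open V" "x \<in> V" "\<And>y. y \<in> V \<Longrightarrow> f y = g y"
  shows "pdv b f x = pdv b g x"
proof -
  have "(f has_derivative D) (at x) \<longleftrightarrow> (g has_derivative D) (at x)" for D
    using assms has_derivative_transform_within_open[of f D x UNIV V g]
      has_derivative_transform_within_open[of g D x UNIV V f] by auto
  then show ?thesis unfolding pdv_def frechet_derivative_def by simp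
qed

lemma mpdv_cong_open:
  assumes "open V" "x \<in> V" "\<And>y. y \<in> V \<Longrightarrow> f y = g y"
  shows "mpdv bs f x = mpdv bs g x"
  using assms(2)
proof (induction bs arbitrary: x)
  case (Cons b bs)
  then show ?case using pdv_cong_open[OF assms(1), of x "mpdv bs f" "mpdv bs g" b] by simp
qed (use assms in simp)

lemma mpdv_const: "mpdv bs (\<lambda>_. c) = (\<lambda>_. if bs = [] then c else 0)"
proof (induction bs)
  case (Cons b bs)
  have "pdv b (\<lambda>_. c') = (\<lambda>_. 0)" for c' :: 'b by (auto simp: fun_eq_iff pdv_def)
  then show ?case using Cons by simp
qed auto

text \<open>Being \<open>C\<^sup>k\<close> is a local property; this is how a function defined by cases is recognised as
  \<open>C\<^sup>2\<close>.\<close>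
lemma Ck_local:
  assumes "\<And>x. \<exists>V g. open V \<and> x \<in> V \<and> Ck n g \<and> (\<forall>y\<in>V. f y = g y)"
  shows "Ck n f"
  using assms
proof (induction n arbitrary: f)
  case 0
  have "continuous (at x) f" for x
  proof -
    obtain V g where V: "open V" "x \<in> V" "Ck 0 g" "\<forall>y\<in>V. f y = g y" using 0 by blast
    then have "continuous (at x) g" by (simp add: continuous_on_eq_continuous_at)
    moreover have "\<forall>\<^sub>F y in nhds x. f y = g y" using V eventually_nhds by blast
    ultimately show ?thesis using isCont_cong by blast
  qed
  then show ?case by (simp add: continuous_at_imp_continuous_on)
next
  case (Suc n)
  have "f differentiable (at x)" for x
  proof -
    obtain V g where V: "open V" "x \<in> V" "Ck (Suc n) g" "\<forall>y\<in>V. f y = g y" using Suc.prems by blast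
    then have "(g has_derivative frechet_derivative g (at x)) (at x)"
      by (simp add: frechet_derivative_works[symmetric])
    then have "(f has_derivative frechet_derivative g (at x)) (at x)"
      using V by (intro has_derivative_transform_within_open[of g _ x UNIV V f]) auto
    then show ?thesis by (auto simp: differentiable_def)
  qed
  moreover have "Ck n (pdv b f)" if b: "b \<in> Basis" for b
  proof (rule Suc.IH)
    fix x
    obtain V g where V: "open V" "x \<in> V" "Ck (Suc n) g" "\<forall>y\<in>V. f y = g y" using Suc.prems by blast
    then have "\<forall>y\<in>V. pdv b f y = pdv b g y" using pdv_cong_open by blast
    then show "\<exists>V g. open V \<and> x \<in> V \<and> Ck n g \<and> (\<forall>y\<in>V. pdv b f y = g y)"
      using V b by (intro exI[of _ V] exI[of _ "pdv b g"]) simp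
  qed
  ultimately show ?case by simp
qed

lemma Ck_Suc_imp_Ck: "Ck (Suc n) f \<Longrightarrow> Ck n f"
proof (induction n arbitrary: f)
  case 0
  then show ?case
    by (auto intro!: continuous_at_imp_continuous_on differentiable_imp_continuous_within)
next
  case (Suc n)
  then have "Ck (Suc n) (pdv b f)" if "b \<in> Basis" for b using that by (subst (asm) Ck.simps(2)) blast
  then have "Ck n (pdv b f)" if "b \<in> Basis" for b using that Suc.IH by blast
  then show ?case using Suc.prems by simp
qed

lemma Ck_const [simp]: "Ck n (\<lambda>_. c)"
proof (induction n arbitrary: c)
  case (Suc n)
  have "pdv b (\<lambda>_. c) = (\<lambda>_. 0)" for b :: 'a by (auto simp: fun_eq_iff pdv_def)
  then show ?case using Suc by simp
qed simp

lemma Ck_add: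
  assumes "Ck n f" "Ck n g"
  shows "Ck n (\<lambda>x. f x + g x)"
  using assms
proof (induction n arbitrary: f g)
  case 0
  then show ?case by (simp add: continuous_on_add)
next
  case (Suc n)
  then have "pdv b (\<lambda>x. f x + g x) = (\<lambda>x. pdv b f x + pdv b g x)" for b
    by (intro ext pdv_eq has_derivative_add differentiable_has_pdv) auto
  then show ?case using Suc by auto
qed

lemma Ck_mult:
  fixes f g :: "'a::euclidean_space \<Rightarrow> real"
  assumes "Ck n f" "Ck n g"
  shows "Ck n (\<lambda>x. f x * g x)"
  using assms
proof (induction n arbitrary: f g)
  case 0
  then show ?case by (simp add: continuous_on_mult)
next
  case (Suc n)
  then have "pdv b (\<lambda>x. f x * g x) = (\<lambda>x. f x * pdv b g x + pdv b f x * g x)" for b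
    by (intro ext pdv_eq has_derivative_mult differentiable_has_pdv) auto
  then show ?case using Suc Ck_Suc_imp_Ck[OF Suc.prems(1)] Ck_Suc_imp_Ck[OF Suc.prems(2)]
    by (auto intro!: Ck_add)
qed

lemma Ck_diff:
  fixes f g :: "'a::euclidean_space \<Rightarrow> real"
  assumes "Ck n f" "Ck n g"
  shows "Ck n (\<lambda>x. f x - g x)"
proof -
  have "Ck n (\<lambda>x. f x + (- 1) * g x)" using assms by (intro Ck_add Ck_mult Ck_const)
  then show ?thesis by simp
qed

lemma Ck_uminus:
  fixes f :: "'a::euclidean_space \<Rightarrow> real"
  shows "Ck n f \<Longrightarrow> Ck n (\<lambda>x. - f x)"
  using Ck_diff[OF Ck_const[of n 0]] by simp

lemma Ck_sum:
  assumes "\<And>i. i \<in> I \<Longrightarrow> Ck n (f i)"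
  shows "Ck n (\<lambda>x. \<Sum>i\<in>I. f i x)"
  using assms by (induction I rule: infinite_finite_induct) (auto intro: Ck_add)

lemma pdv_compose:
  fixes h :: "real \<Rightarrow> real" and g :: "'a::euclidean_space \<Rightarrow> real"
  assumes "h differentiable (at (g x))" "g differentiable (at x)"
  shows "pdv b (\<lambda>x. h (g x)) x = pdv 1 h (g x) * pdv b g x"
proof -
  have "((\<lambda>x. h (g x)) has_derivative (\<lambda>b. pdv (pdv b g x) h (g x))) (at x)"
    using has_derivative_compose[OF differentiable_has_pdv differentiable_has_pdv] assms by blast
  moreover have "pdv y h (g x) = pdv 1 h (g x) * y" for y
  proof -
    have "pdv (y *\<^sub>R 1) h (g x) = y *\<^sub>R pdv 1 h (g x)"
      by (rule linear_scale[OF has_derivative_linear[OF differentiable_has_pdv[OF assms(1)]]])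
    then show ?thesis by simp
  qed
  ultimately show ?thesis using pdv_eq by metis
qed

lemma Ck_compose:
  fixes h :: "real \<Rightarrow> real" and g :: "'a::euclidean_space \<Rightarrow> real"
  assumes "Ck n h" "Ck n g"
  shows "Ck n (\<lambda>x. h (g x))"
  using assms
proof (induction n arbitrary: h)
  case 0
  then show ?case by (simp add: continuous_on_compose2)
next
  case (Suc n)
  have "pdv b (\<lambda>x. h (g x)) = (\<lambda>x. pdv 1 h (g x) * pdv b g x)" for b
    using Suc.prems by (intro ext pdv_compose) auto
  moreover have "(\<lambda>x. h (g x)) differentiable (at x)" for x
    using Suc.prems by (auto intro!: differentiable_compose[of h g])
  moreover have "Ck n (\<lambda>x. pdv 1 h (g x))"
    using Suc.IH[OF _ Ck_Suc_imp_Ck[OF Suc.prems(2)], of "pdv 1 h"] Suc.prems(1) by simp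
  ultimately show ?case using Suc.prems by (auto intro!: Ck_mult)
qed

lemma Ck_inverse:
  fixes g :: "'a::euclidean_space \<Rightarrow> real"
  assumes "Ck n g" "\<And>x. g x \<noteq> 0"
  shows "Ck n (\<lambda>x. inverse (g x))"
  using assms
proof (induction n)
  case 0
  then have "continuous_on UNIV (\<lambda>x. inverse (g x))"
    by (intro continuous_on_inverse) simp_all
  then show ?case by simp
next
  case (Suc n)
  have *: "((\<lambda>x. inverse (g x)) has_derivative
       (\<lambda>b. - (inverse (g x) * pdv b g x * inverse (g x)))) (at x)" for x
    using Suc.prems by (intro Deriv.has_derivative_inverse differentiable_has_pdv) auto
  then have "pdv b (\<lambda>x. inverse (g x)) = (\<lambda>x. 0 - inverse (g x) * pdv b g x * inverse (g x))" for b
    by (intro ext, subst pdv_eq[OF *]) simp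
  moreover have "(\<lambda>x. inverse (g x)) differentiable (at x)" for x
    unfolding differentiable_def using * by blast
  ultimately show ?case using Suc Ck_Suc_imp_Ck[OF Suc.prems(1)]
    by (auto intro!: Ck_mult Ck_uminus)
qed

lemma Ck_bounded_linear:
  assumes "bounded_linear f"
  shows "Ck n f"
proof (cases n)
  case 0
  then show ?thesis using assms by (simp add: linear_continuous_on)
next
  case (Suc m)
  have "pdv b f = (\<lambda>_. f b)" for b
    using assms by (intro ext pdv_eq bounded_linear_imp_has_derivative)
  then show ?thesis using Suc assms by (auto simp: bounded_linear_imp_differentiable)
qed

text \<open>A partial derivative of \<open>f \<circ> fst\<close> is either a partial derivative of \<open>f\<close> or zero, because the
  first component of a basis vector of the product is a basis vector or zero.\<close>
lemma Ck_compose_fst: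
  assumes "Ck n f"
  shows "Ck n (\<lambda>z::'a::euclidean_space \<times> 'b::euclidean_space. f (fst z))"
  using assms
proof (induction n arbitrary: f)
  case 0
  then show ?case by (auto intro!: continuous_intros continuous_on_compose2[of UNIV f])
next
  case (Suc n)
  have *: "((\<lambda>z::'a \<times> 'b. f (fst z)) has_derivative (\<lambda>b. pdv (fst b) f (fst z))) (at z)" for z
    using has_derivative_compose[OF has_derivative_fst[OF has_derivative_ident]
        differentiable_has_pdv] Suc.prems by fastforce
  have "Ck n (pdv b (\<lambda>z::'a \<times> 'b. f (fst z)))" if "b \<in> Basis" for b
  proof (cases "fst b = 0")
    case True
    have "pdv b (\<lambda>z::'a \<times> 'b. f (fst z)) = (\<lambda>z. 0)"
      using True by (intro ext, subst pdv_eq[OF *])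
        (simp add: linear_0[OF has_derivative_linear[OF differentiable_has_pdv]] Suc.prems[simplified])
    then show ?thesis by simp
  next
    case False
    then have "fst b \<in> Basis" using that by (auto simp: Basis_prod_def)
    moreover have "pdv b (\<lambda>z::'a \<times> 'b. f (fst z)) = (\<lambda>z. pdv (fst b) f (fst z))"
      by (intro ext, subst pdv_eq[OF *]) simp
    ultimately show ?thesis using Suc by auto
  qed
  moreover have "(\<lambda>z::'a \<times> 'b. f (fst z)) differentiable (at z)" for z
    unfolding differentiable_def using * by blast
  ultimately show ?case by simp
qed

lemma smooth_pdv:
  assumes "smooth f" "b \<in> Basis"
  shows "smooth (pdv b f)"
proof -
  have "Ck (Suc n) f" for n using assms(1) unfolding smooth_def by blast
  then show ?thesis using assms(2) by (simp add: smooth_def)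
qed

lemma smooth_differentiable:
  assumes "smooth f"
  shows "f differentiable (at x)"
proof -
  have "Ck (Suc 0) f" using assms unfolding smooth_def by blast
  then show ?thesis by simp
qed

lemma smooth_mpdv: "smooth f \<Longrightarrow> set bs \<subseteq> Basis \<Longrightarrow> smooth (mpdv bs f)"
  by (induction bs) (simp_all add: smooth_pdv)

lemma smooth_continuous:
  assumes "smooth f"
  shows "continuous_on S f"
proof -
  have "Ck 0 f" using assms unfolding smooth_def by blast
  then have "continuous_on UNIV f" by simp
  then show ?thesis by (rule continuous_on_subset) simp
qed

lemma supp_subsetI: "closed C \<Longrightarrow> (\<And>z. z \<notin> C \<Longrightarrow> f z = 0) \<Longrightarrow> supp f \<subseteq> C"
  unfolding supp_def by (rule closure_minimal) auto

section \<open>Smooth cutoff functions\<close>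

text \<open>The functions \<open>p (1 / x) exp (- 1 / x)\<close>, extended by zero, form a family closed under
  differentiation. Keeping the polynomial \<open>p\<close> as a parameter therefore turns smoothness of the
  classical flat function \<open>exp (- 1 / x)\<close> into a short induction.\<close>
definition flat_exp :: "real poly \<Rightarrow> real \<Rightarrow> real" where
  "flat_exp p x = (if x > 0 then poly p (1 / x) * exp (- 1 / x) else 0)"

lemma poly_exp_tendsto_0: "((\<lambda>y::real. poly p y * exp (- y)) \<longlongrightarrow> 0) at_top"
proof -
  have "((\<lambda>y::real. coeff p i * (y ^ i * exp (- y))) \<longlongrightarrow> coeff p i * 0) at_top" for i
    using tendsto_power_div_exp_0[of i] by (intro tendsto_intros) (simp add: exp_minus field_simps)
  then have "((\<lambda>y::real. \<Sum>i\<le>degree p. coeff p i * (y ^ i * exp (- y))) \<longlongrightarrow> (\<Sum>i\<le>degree p. 0)) at_top"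
    by (intro tendsto_sum) simp
  then show ?thesis
    by (simp add: poly_altdef sum_distrib_right mult.assoc)
qed

lemma flat_exp_has_derivative:
  "(flat_exp p has_field_derivative flat_exp (pCons 0 (pCons 0 (p - pderiv p))) x) (at x)"
proof -
  consider "x > 0" | "x < 0" | "x = 0" by linarith
  then show ?thesis
  proof cases
    case 1
    have "((\<lambda>x. poly p (1 / x) * exp (- 1 / x)) has_field_derivative
        flat_exp (pCons 0 (pCons 0 (p - pderiv p))) x) (at x)"
      using 1 by (auto intro!: derivative_eq_intros DERIV_chain2[OF poly_DERIV]
          simp: flat_exp_def field_simps power2_eq_square)
    then show ?thesis
      by (rule has_field_derivative_transform_within_open[where S = "{0<..}"])
        (use 1 in \<open>auto simp: flat_exp_def\<close>)
  next
    case 2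
    have "((\<lambda>_. 0) has_field_derivative flat_exp (pCons 0 (pCons 0 (p - pderiv p))) x) (at x)"
      using 2 by (simp add: flat_exp_def)
    then show ?thesis
      by (rule has_field_derivative_transform_within_open[where S = "{..<0}"])
        (use 2 in \<open>auto simp: flat_exp_def\<close>)
  next
    case 3
    \<comment> \<open>the difference quotient at \<open>0\<close> has the same form, with \<open>p\<close> multiplied by the variable\<close>
    have "((\<lambda>y. poly (pCons 0 p) (inverse y) * exp (- inverse y)) \<longlongrightarrow> 0) (at_right (0::real))"
      by (rule filterlim_compose[OF poly_exp_tendsto_0 filterlim_inverse_at_top_right])
    moreover have "\<forall>\<^sub>F y in at_right (0::real).
        poly (pCons 0 p) (inverse y) * exp (- inverse y) = flat_exp p y / y"
      by (auto simp: eventually_at_filter flat_exp_def field_simps)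
    ultimately have "((\<lambda>y. flat_exp p y / y) \<longlongrightarrow> 0) (at_right 0)"
      by (rule Lim_transform_eventually)
    moreover have "((\<lambda>y. flat_exp p y / y) \<longlongrightarrow> 0) (at_left 0)"
      by (rule Lim_transform_eventually[OF tendsto_const])
        (auto simp: eventually_at_filter flat_exp_def)
    ultimately have "((\<lambda>y. flat_exp p y / y) \<longlongrightarrow> 0) (at 0)"
      by (rule filterlim_split_at_real[rotated])
    then show ?thesis using 3 by (simp add: has_field_derivative_iff flat_exp_def)
  qed
qed

lemma Ck_flat_exp: "Ck n (flat_exp p)"
proof (induction n arbitrary: p)
  case 0
  show ?case using DERIV_isCont[OF flat_exp_has_derivative] 
    by (simp add: continuous_at_imp_continuous_on)
next
  case (Suc n)
  have "pdv 1 (flat_exp p) = flat_exp (pCons 0 (pCons 0 (p - pderiv p)))"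
    using pdv_eq[OF flat_exp_has_derivative[unfolded has_field_derivative_def]] by (auto simp: fun_eq_iff)
  moreover have "flat_exp p differentiable (at x)" for x
    using flat_exp_has_derivative unfolding differentiable_def has_field_derivative_def by blast
  ultimately show ?case using Suc by simp
qed

text \<open>The step is constant near \<open>0\<close> and near \<open>1\<close>, so that affine copies of it are flat at their ends.
  The thresholds \<open>1 / 6\<close> and \<open>1 / 2\<close> become the energy levels \<open>5 / 6\<close> and \<open>1 / 2\<close> under \<open>t \<mapsto> 1 - t\<close>.\<close>
definition smooth_step :: "real \<Rightarrow> real" where
  "smooth_step t = flat_exp 1 (t - 1 / 6) / (flat_exp 1 (t - 1 / 6) + flat_exp 1 (1 / 2 - t))"

lemma flat_exp_1: "flat_exp 1 x \<ge> 0" "flat_exp 1 x = 0 \<longleftrightarrow> x \<le> 0"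
  by (auto simp: flat_exp_def)

lemma smooth_step_low: "t \<le> 1 / 6 \<Longrightarrow> smooth_step t = 0"
  and smooth_step_high: "t \<ge> 1 / 2 \<Longrightarrow> smooth_step t = 1"
  and smooth_step_nonneg: "smooth_step t \<ge> 0"
  and smooth_step_le_1: "smooth_step t \<le> 1"
  using flat_exp_1[of "t - 1 / 6"] flat_exp_1[of "1 / 2 - t"]
  by (auto simp: smooth_step_def divide_le_eq_1)

lemma Ck_affine_real: "Ck n (\<lambda>x::real. a * x + b)"
  by (intro Ck_add Ck_const Ck_bounded_linear bounded_linear_mult_right)

lemma smooth_smooth_step: "smooth smooth_step"
  unfolding smooth_def
proof
  fix n
  have a: "Ck n (\<lambda>t. flat_exp 1 (t - 1 / 6))" "Ck n (\<lambda>t. flat_exp 1 (1 / 2 - t))"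
    using Ck_compose[OF Ck_flat_exp Ck_affine_real[of n 1 "- 1 / 6"], of 1]
      Ck_compose[OF Ck_flat_exp Ck_affine_real[of n "- 1" "1 / 2"], of 1] by simp_all
  have "flat_exp 1 (t - 1 / 6) + flat_exp 1 (1 / 2 - t) \<noteq> 0" for t
    using flat_exp_1[of "t - 1 / 6"] flat_exp_1[of "1 / 2 - t"] by linarith
  then show "Ck n smooth_step"
    using Ck_mult[OF a(1) Ck_inverse[OF Ck_add[OF a]]]
    unfolding smooth_step_def[abs_def] divide_inverse by blast
qed

lemma deriv_iterate_locally_const:
  fixes X :: "real \<Rightarrow> real"
  assumes "open S" "x \<in> S" "\<And>y. y \<in> S \<Longrightarrow> X y = c" "n \<ge> 1"
  shows "(deriv ^^ n) X x = 0"
proof -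
  obtain k where n: "n = Suc k" using assms(4) by (cases n) auto
  have "(deriv ^^ Suc k) X y = 0" if "y \<in> S" for y
    using that
  proof (induction k arbitrary: y)
    case 0
    have "(X has_field_derivative 0) (at y)"
      using has_field_derivative_transform_within_open[OF DERIV_const assms(1) 0] assms(3) by metis
    then show ?case by (simp add: DERIV_imp_deriv)
  next
    case (Suc k)
    have "((deriv ^^ Suc k) X has_field_derivative 0) (at y)"
      using has_field_derivative_transform_within_open[OF DERIV_const assms(1) Suc.prems] Suc.IH by metis
    then show ?case by (simp add: DERIV_imp_deriv)
  qed
  then show ?thesis using assms(2) n by blast
qed

definition ramp :: "real \<Rightarrow> real \<Rightarrow> real \<Rightarrow> real" where
  "ramp x y q = smooth_step ((q - x) / (y - x))"

lemma Ck_ramp: "Ck n (ramp x y)"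
proof -
  have "ramp x y = (\<lambda>q. smooth_step (inverse (y - x) * q + (- x * inverse (y - x))))"
    by (auto simp: fun_eq_iff ramp_def divide_inverse algebra_simps)
  then show ?thesis
    using Ck_compose[OF _ Ck_affine_real] smooth_smooth_step unfolding smooth_def by metis
qed

lemma ramp_range: "0 \<le> ramp x y q" "ramp x y q \<le> 1"
  by (auto simp: ramp_def smooth_step_nonneg smooth_step_le_1)

lemma flat_cutoff_ramp:
  assumes "x \<noteq> y"
  shows "flat_cutoff (ramp x y) x y"
proof -
  have o: "open {q. (q - x) / (y - x) < 1 / 6}" "open {q. (q - x) / (y - x) > 1 / 2}"
    using assms by (auto intro!: open_Collect_less continuous_intros)
  have "(deriv ^^ n) (ramp x y) x = 0" if "n \<ge> 1" for n
    by (rule deriv_iterate_locally_const[OF o(1) _ _ that, of _ _ 0])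
      (auto simp: ramp_def smooth_step_low)
  moreover have "(deriv ^^ n) (ramp x y) y = 0" if "n \<ge> 1" for n
  proof (rule deriv_iterate_locally_const[OF o(2) _ _ that, of _ _ 1])
    have "(y - x) / (y - x) = 1" using assms by simp
    then show "y \<in> {q. (q - x) / (y - x) > 1 / 2}" unfolding mem_Collect_eq by linarith
    show "ramp x y q = 1" if "q \<in> {q. (q - x) / (y - x) > 1 / 2}" for q
      using that unfolding ramp_def mem_Collect_eq by (intro smooth_step_high less_imp_le)
  qed
  ultimately show ?thesis
    using assms Ck_ramp ramp_range unfolding flat_cutoff_def smooth_def
    by (auto simp: ramp_def smooth_step_low smooth_step_high)
qed

section \<open>Derivatives of a rescaled composition\<close>

text \<open>A weak form of the formula of Faa di Bruno: a derivative of \<open>\<psi> (t (H - c))\<close> is a polynomial in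
  \<open>t\<close> of degree at most its order. The point is that the coefficient functions \<open>P j\<close> do not depend
  on \<open>t\<close>, which is what makes the bounds uniform in \<open>\<epsilon>\<close>.\<close>
lemma mpdv_scaled_composition:
  fixes \<psi> :: "real \<Rightarrow> real" and H :: "'a::euclidean_space \<Rightarrow> real"
  assumes \<psi>: "smooth \<psi>" and H: "smooth H" and bs: "set bs \<subseteq> Basis"
  shows "\<exists>P. (\<forall>j. smooth (P j)) \<and>
    (\<forall>t z. mpdv bs (\<lambda>z. \<psi> (t * (H z - c))) z =
       (\<Sum>j\<le>length bs. t ^ j * mpdv (replicate j 1) \<psi> (t * (H z - c)) * P j z))"
  using bs
proof (induction bs)
  case Nil
  show ?case by (rule exI[of _ "\<lambda>_ _. 1"]) (simp add: smooth_def)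
next
  case (Cons b bs)
  define n where "n = length bs"
  obtain P where P: "\<And>j. smooth (P j)" and eq: "\<And>t z. mpdv bs (\<lambda>z. \<psi> (t * (H z - c))) z =
       (\<Sum>j\<le>n. t ^ j * mpdv (replicate j 1) \<psi> (t * (H z - c)) * P j z)"
    using Cons n_def by auto
  have b: "b \<in> Basis" using Cons.prems by simp
  define Q where "Q j z = (if j \<le> n then pdv b (P j) z else 0)
      + (if j = 0 then 0 else P (j - 1) z * pdv b H z)" for j z
  have "smooth (Q j)" for j
  proof -
    have "Ck k (\<lambda>z. if j \<le> n then pdv b (P j) z else 0)" for k
      using smooth_pdv[OF P b] by (cases "j \<le> n") (auto simp: smooth_def)
    moreover have "Ck k (\<lambda>z. if j = 0 then 0 else P (j - 1) z * pdv b H z)" for k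
      using smooth_pdv[OF H b] P by (cases "j = 0") (auto intro!: Ck_mult simp: smooth_def)
    ultimately show ?thesis unfolding smooth_def Q_def[abs_def] by (auto intro!: Ck_add)
  qed
  moreover have "mpdv (b # bs) (\<lambda>z. \<psi> (t * (H z - c))) z =
       (\<Sum>j\<le>Suc n. t ^ j * mpdv (replicate j 1) \<psi> (t * (H z - c)) * Q j z)" for t z
  proof -
    define D where "D j z = mpdv (replicate j 1) \<psi> (t * (H z - c))" for j z
    have \<psi>j: "smooth (mpdv (replicate j 1) \<psi>)" for j
      by (intro smooth_mpdv \<psi>) auto
    have dH: "((\<lambda>z. t * (H z - c)) has_derivative (\<lambda>b. t * pdv b H z)) (at z)"
      using differentiable_has_pdv[OF smooth_differentiable[OF H]]
      by (auto intro!: derivative_eq_intros)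
    have dD: "(D j has_derivative (\<lambda>b. D (Suc j) z * (t * pdv b H z))) (at z)" for j
    proof -
      have d: "(\<lambda>z. t * (H z - c)) differentiable (at z)"
        unfolding differentiable_def using dH by blast
      have "D j differentiable (at z)"
        unfolding D_def[abs_def]
        by (rule differentiable_compose[OF smooth_differentiable[OF \<psi>j] d])
      moreover have "pdv b (D j) z = D (Suc j) z * (t * pdv b H z)" for b
        unfolding D_def[abs_def] pdv_compose[OF smooth_differentiable[OF \<psi>j] d]
        by (simp add: pdv_eq[OF dH])
      ultimately show ?thesis using differentiable_has_pdv by fastforce
    qed
    have "((\<lambda>z. \<Sum>j\<le>n. t ^ j * D j z * P j z) has_derivative
        (\<lambda>b. \<Sum>j\<le>n. t ^ j * D j z * pdv b (P j) z + t ^ j * (D (Suc j) z * (t * pdv b H z)) * P j z)) (at z)"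
      using differentiable_has_pdv[OF smooth_differentiable[OF P]]
      by (auto intro!: derivative_eq_intros dD)
    then have "pdv b (\<lambda>z. \<Sum>j\<le>n. t ^ j * D j z * P j z) z =
        (\<Sum>j\<le>n. t ^ j * D j z * pdv b (P j) z) + (\<Sum>j\<le>n. t ^ Suc j * D (Suc j) z * (P j z * pdv b H z))"
      by (subst pdv_eq) (auto simp: sum.distrib algebra_simps)
    also have "(\<Sum>j\<le>n. t ^ j * D j z * pdv b (P j) z) =
        (\<Sum>j\<le>Suc n. t ^ j * D j z * (if j \<le> n then pdv b (P j) z else 0))" by simp
    also have "(\<Sum>j\<le>n. t ^ Suc j * D (Suc j) z * (P j z * pdv b H z)) =
        (\<Sum>j\<le>Suc n. t ^ j * D j z * (if j = 0 then 0 else P (j - 1) z * pdv b H z))"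
      by (subst sum.atMost_Suc_shift) simp
    finally show ?thesis
      by (simp only: mpdv.simps eq[abs_def] D_def Q_def sum.distrib[symmetric] distrib_left)
  qed
  ultimately show ?case unfolding n_def by auto
qed

text \<open>The derivatives of \<open>\<psi>\<close> vanish beyond \<open>b\<close>, hence for \<open>t \<ge> 1\<close> only the compact set \<open>{H \<le> c + b}\<close>
  matters, and there the coefficients of the expansion are bounded.\<close>
lemma scaled_composition_bound:
  fixes \<psi> :: "real \<Rightarrow> real" and H :: "'a::euclidean_space \<Rightarrow> real"
  assumes \<psi>: "smooth \<psi>" and H: "smooth H" and bs: "set bs \<subseteq> Basis"
    and low: "\<And>x. x < a \<Longrightarrow> \<psi> x = u" and high: "\<And>x. x > b \<Longrightarrow> \<psi> x = 0" and b: "0 \<le> b" 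
    and comp: "compact {z. H z \<le> c + b}"
  shows "\<exists>C. \<forall>t\<ge>1. \<forall>z. \<bar>mpdv bs (\<lambda>z. \<psi> (t * (H z - c))) z\<bar> \<le> C * t ^ length bs"
proof -
  obtain P where P: "\<And>j. smooth (P j)" and eq: "\<And>t z. mpdv bs (\<lambda>z. \<psi> (t * (H z - c))) z =
       (\<Sum>j\<le>length bs. t ^ j * mpdv (replicate j 1) \<psi> (t * (H z - c)) * P j z)"
    using mpdv_scaled_composition[OF \<psi> H bs] by blast
  have "\<exists>B\<ge>0. \<forall>x. \<bar>mpdv (replicate j 1) \<psi> x\<bar> \<le> B" for j
  proof -
    have "compact (mpdv (replicate j 1) \<psi> ` {a..b})"
      by (intro compact_continuous_image smooth_continuous smooth_mpdv \<psi>) auto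
    then obtain B where B: "\<And>x. x \<in> {a..b} \<Longrightarrow> \<bar>mpdv (replicate j 1) \<psi> x\<bar> \<le> B"
      by (metis bounded_iff compact_imp_bounded image_eqI real_norm_def)
    have "\<bar>mpdv (replicate j 1) \<psi> x\<bar> \<le> \<bar>B\<bar> + \<bar>u\<bar>" for x
    proof -
      consider "x < a" | "x > b" | "x \<in> {a..b}" by force
      then show ?thesis
      proof cases
        case 1
        have "mpdv (replicate j 1) \<psi> x = mpdv (replicate j 1) (\<lambda>_. u) x"
          by (rule mpdv_cong_open[of "{..<a}"]) (use 1 low in auto)
        then show ?thesis by (simp add: mpdv_const)
      next
        case 2
        have "mpdv (replicate j 1) \<psi> x = mpdv (replicate j 1) (\<lambda>_. 0) x"
          by (rule mpdv_cong_open[of "{b<..}"]) (use 2 high in auto)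
        then show ?thesis by (simp add: mpdv_const)
      next
        case 3
        then show ?thesis using B by fastforce
      qed
    qed
    then show ?thesis by (intro exI[of _ "\<bar>B\<bar> + \<bar>u\<bar>"]) auto
  qed
  then obtain B where B: "\<And>j. B j \<ge> 0" "\<And>j x. \<bar>mpdv (replicate j 1) \<psi> x\<bar> \<le> B j" by metis
  have "\<exists>M. \<forall>z. H z \<le> c + b \<longrightarrow> \<bar>P j z\<bar> \<le> M" for j
  proof -
    have "compact (P j ` {z. H z \<le> c + b})"
      using comp P by (intro compact_continuous_image smooth_continuous)
    then show ?thesis
      by (metis (mono_tags, lifting) bounded_iff compact_imp_bounded image_eqI mem_Collect_eq real_norm_def)
  qed
  then obtain M where M: "\<And>j z. H z \<le> c + b \<Longrightarrow> \<bar>P j z\<bar> \<le> M j" by metis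
  define C where "C = (\<Sum>j\<le>length bs. B j * \<bar>M j\<bar>)"
  have "\<bar>mpdv bs (\<lambda>z. \<psi> (t * (H z - c))) z\<bar> \<le> C * t ^ length bs" if t: "t \<ge> 1" for t z
  proof (cases "H z \<le> c + b")
    case True
    have "\<bar>mpdv bs (\<lambda>z. \<psi> (t * (H z - c))) z\<bar> \<le>
        (\<Sum>j\<le>length bs. \<bar>t ^ j * mpdv (replicate j 1) \<psi> (t * (H z - c)) * P j z\<bar>)"
      unfolding eq by (rule sum_abs)
    also have "\<dots> \<le> (\<Sum>j\<le>length bs. t ^ length bs * (B j * \<bar>M j\<bar>))"
    proof (rule sum_mono)
      fix j assume "j \<in> {..length bs}"
      then have "\<bar>t ^ j\<bar> \<le> t ^ length bs" using t by (simp add: power_increasing)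
      moreover have "\<bar>mpdv (replicate j 1) \<psi> (t * (H z - c))\<bar> * \<bar>P j z\<bar> \<le> B j * \<bar>M j\<bar>"
        using B(1)[of j] B(2)[of j "t * (H z - c)"] M[OF True, of j] by (intro mult_mono) auto
      ultimately show "\<bar>t ^ j * mpdv (replicate j 1) \<psi> (t * (H z - c)) * P j z\<bar> \<le>
          t ^ length bs * (B j * \<bar>M j\<bar>)"
        using t unfolding abs_mult mult.assoc by (intro mult_mono[of "\<bar>t ^ j\<bar>"]) (auto simp: abs_mult)
    qed
    also have "\<dots> = C * t ^ length bs" by (simp add: C_def sum_distrib_left sum_distrib_right mult.commute)
    finally show ?thesis .
  next
    case False
    have "t * (H z - c) > b"
    proof -
      have "b < H z - c" using False by simp
      also have "\<dots> \<le> t * (H z - c)" using t False b by simp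
      finally show ?thesis .
    qed
    have "mpdv (replicate j 1) \<psi> (t * (H z - c)) = mpdv (replicate j 1) (\<lambda>_. 0) (t * (H z - c))" for j
      by (rule mpdv_cong_open[of "{b<..}"]) (use \<open>t * (H z - c) > b\<close> high in auto)
    then have "mpdv bs (\<lambda>z. \<psi> (t * (H z - c))) z = 0"
      unfolding eq by (simp add: mpdv_const)
    moreover have "C \<ge> 0" unfolding C_def using B by (intro sum_nonneg) simp
    ultimately show ?thesis using t by simp
  qed
  then show ?thesis by blast
qed

section \<open>The saddle profile\<close>

lemma set_integral_tail_has_derivative:
  fixes f :: "real \<Rightarrow> real"
  assumes f: "integrable lborel f" and cont: "continuous_on UNIV f"
  shows "((\<lambda>x. LBINT y:{x..}. f y) has_real_derivative - f x) (at x)"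
proof -
  have int: "set_integrable lborel S f" if "S \<in> sets borel" for S
    unfolding set_integrable_def by (rule integrable_mult_indicator) (use f that in auto)
  have split: "(LBINT y:{x - 1..}. f y) - integral {x - 1..u} f = (LBINT y:{u..}. f y)" if "u \<in> {x - 1<..<x + 1}" for u
  proof -
    have "(LBINT y:{x - 1..<u} \<union> {u..}. f y) = (LBINT y:{x - 1..<u}. f y) + (LBINT y:{u..}. f y)"
      by (intro set_integral_Un int) auto
    moreover have "{x - 1..<u} \<union> {u..} = {x - 1..}" using that by auto
    moreover have "(LBINT y:{x - 1..<u}. f y) = integral {x - 1..<u} f"
      by (intro set_borel_integral_eq_integral int) auto
    moreover have "integral {x - 1..<u} f = integral {x - 1..u} f"
      by (rule integral_spike_set; rule negligible_subset[of "{u}"]) auto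
    ultimately show ?thesis by simp
  qed
  have "((\<lambda>u. integral {x - 1..u} f) has_real_derivative f x) (at x within {x - 1..x + 1})"
    by (intro integral_has_real_derivative continuous_on_subset[OF cont]) auto
  then have "((\<lambda>u. integral {x - 1..u} f) has_real_derivative f x) (at x)"
    using at_within_interior[of x "{x - 1..x + 1}"] by simp
  then have "((\<lambda>u. (LBINT y:{x - 1..}. f y) - integral {x - 1..u} f) has_real_derivative - f x) (at x)"
    by (auto intro!: derivative_eq_intros)
  then show ?thesis
    by (rule has_field_derivative_transform_within_open[of _ _ _ "{x - 1<..<x + 1}"]) (use split in auto)
qed

lemma Ck_exp: "Ck n (exp :: real \<Rightarrow> real)"
proof (induction n)
  case (Suc n)
  have "pdv 1 exp = (exp :: real \<Rightarrow> real)"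
  proof
    fix x :: real
    show "pdv 1 exp x = exp x"
      using pdv_eq[OF DERIV_exp[of x, unfolded has_field_derivative_def], of 1] by simp
  qed
  moreover have "exp differentiable (at x)" for x :: real
    using DERIV_exp unfolding differentiable_def has_field_derivative_def by blast
  ultimately show ?case using Suc by simp
qed (simp add: continuous_on_exp)

text \<open>If the exponential is integrable, its tail integral is an antiderivative of a smooth function.
  If it is not, the normalising integral is \<open>0\<close> by convention, and the quotient is the zero
  function since division by zero yields zero.\<close>
lemma Ck_Phi_s: "Ck n (Phi_s L \<gamma> l)"
  and Phi_s_range: "0 \<le> Phi_s L \<gamma> l x" "Phi_s L \<gamma> l x \<le> 1"
proof -
  define f where "f y = exp (- (mu_s L \<gamma> l * y\<^sup>2 / (2 * c_s L \<gamma> l)))" for y :: real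
  define T where "T = (LBINT y. f y)"
  have Phi: "Phi_s L \<gamma> l x = (LBINT y:{x..}. f y) / T" for x
    by (simp add: Phi_s_def f_def T_def)
  have f: "Ck n f" for n
  proof -
    have "Ck n (\<lambda>y::real. (- mu_s L \<gamma> l / (2 * c_s L \<gamma> l)) * (y * y))"
      by (intro Ck_mult Ck_const Ck_bounded_linear bounded_linear_ident)
    then show ?thesis
      using Ck_compose[OF Ck_exp] by (fastforce simp: f_def[abs_def] power2_eq_square)
  qed
  have "Ck n (Phi_s L \<gamma> l) \<and> 0 \<le> Phi_s L \<gamma> l x \<and> Phi_s L \<gamma> l x \<le> 1"
  proof (cases "integrable lborel f")
    case False
    then have "T = 0" by (simp add: T_def not_integrable_integral_eq)
    then have "Phi_s L \<gamma> l = (\<lambda>_. 0)" by (auto simp: Phi fun_eq_iff)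
    then show ?thesis by simp
  next
    case True
    have f0: "f y \<ge> 0" for y by (simp add: f_def)
    have "integrable lborel (\<lambda>y. indicator {x..} y *\<^sub>R f y)"
      by (rule integrable_mult_indicator) (use True in auto)
    then have le: "(LBINT y:{x..}. f y) \<le> T" "0 \<le> (LBINT y:{x..}. f y)"
      using True f0 unfolding T_def set_lebesgue_integral_def
      by (auto intro!: integral_mono integral_nonneg simp: indicator_def)
    have d: "((\<lambda>x. (LBINT y:{x..}. f y)) has_real_derivative - f x) (at x)" for x
      using set_integral_tail_has_derivative[OF True] f[of 0] by simp
    have "Ck n (\<lambda>x. LBINT y:{x..}. f y)"
    proof (cases n)
      case 0
      then show ?thesis using DERIV_isCont[OF d] by (simp add: continuous_at_imp_continuous_on)
    next
      case (Suc k)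
      have "pdv 1 (\<lambda>x. LBINT y:{x..}. f y) = (\<lambda>x. - f x)"
        using pdv_eq[OF d[unfolded has_field_derivative_def]] by (auto simp: fun_eq_iff)
      moreover have "(\<lambda>x. LBINT y:{x..}. f y) differentiable (at x)" for x
        using d unfolding differentiable_def has_field_derivative_def by blast
      ultimately show ?thesis using Suc Ck_uminus[OF f] by simp
    qed
    then have "Ck n (\<lambda>x. inverse T * (LBINT y:{x..}. f y))" by (intro Ck_mult Ck_const)
    moreover have "Phi_s L \<gamma> l = (\<lambda>x. inverse T * (LBINT y:{x..}. f y))"
      by (auto simp: Phi fun_eq_iff divide_inverse)
    moreover have "0 \<le> Phi_s L \<gamma> l x \<and> Phi_s L \<gamma> l x \<le> 1"
      using le unfolding Phi by (cases "T = 0") (auto simp: divide_le_eq_1)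
    ultimately show ?thesis by simp
  qed
  then show "Ck n (Phi_s L \<gamma> l)" "0 \<le> Phi_s L \<gamma> l x" "Phi_s L \<gamma> l x \<le> 1" by auto
qed

section \<open>Components of sublevel sets at regular boundary points\<close>

lemma connected_component_set_absorb:
  assumes "y \<in> connected_component_set S x" "connected T" "T \<subseteq> S" "y \<in> T"
  shows "T \<subseteq> connected_component_set S x"
  using assms connected_component_maximal[OF assms(4,2,3)] connected_component_eq by metis

lemma open_Diff_component:
  fixes S :: "'a::real_normed_vector set"
  assumes "open S"
  shows "open (S - connected_component_set S x)"
proof (subst open_subopen, intro ballI)
  fix y assume y: "y \<in> S - connected_component_set S x"
  then have "connected_component_set S y \<inter> connected_component_set S x = {}"
    by (metis DiffD1 DiffD2 connected_component_disjoint connected_component_eq connected_component_refl_eq mem_Collect_eq)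
  then show "\<exists>T. open T \<and> y \<in> T \<and> T \<subseteq> S - connected_component_set S x"
    using y assms connected_component_subset[of S y]
    by (intro exI[of _ "connected_component_set S y"]) (auto simp: open_connected_component)
qed

text \<open>One direction along which \<open>H\<close> decreases strictly from all nearby starting points. For a \<open>C\<^sup>1\<close>
  function this holds wherever the gradient does not vanish; it is the only form in which
  regularity of a point is used.\<close>
definition descent :: "('a::euclidean_space \<Rightarrow> real) \<Rightarrow> 'a \<Rightarrow> bool" where
  "descent H z \<longleftrightarrow> (\<exists>v. \<exists>t\<^sub>0>0. \<exists>\<rho>>0. \<forall>w\<in>ball z \<rho>. \<forall>t\<in>{0<..t\<^sub>0}. H (w + t *\<^sub>R v) < H w)"

text \<open>Near a point of descent on the level \<open>c\<close>, every point of \<open>{H \<le> c}\<close> slides along the descent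
  direction into one fixed small ball inside \<open>{H < c}\<close>. All these points therefore lie in the closure of
  a single component.\<close>
lemma closure_sublevel_component_open:
  fixes H :: "'a::euclidean_space \<Rightarrow> real"
  assumes cont: "continuous_on UNIV H"
    and W: "W = connected_component_set {z. H z < c} i"
    and z: "z \<in> closure W" and descent: "H z = c \<Longrightarrow> descent H z"
  shows "\<exists>V. open V \<and> z \<in> V \<and> V \<inter> {z. H z \<le> c} \<subseteq> closure W"
proof -
  have op: "open {z. H z < c}" by (intro open_Collect_less cont) simp
  have opW: "open W" unfolding W by (rule open_connected_component[OF op])
  have "closure W \<subseteq> {z. H z \<le> c}"
    using connected_component_subset[of "{z. H z < c}" i] unfolding W
    by (intro closure_minimal closed_Collect_le cont) auto
  then consider "H z < c" | "H z = c" using z by fastforce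
  then show ?thesis
  proof cases
    case 1
    then obtain \<rho> where \<rho>: "\<rho> > 0" "ball z \<rho> \<subseteq> {z. H z < c}"
      using op by (metis mem_Collect_eq open_contains_ball)
    obtain y where y: "y \<in> W" "y \<in> ball z \<rho>"
      using z \<rho>(1) by (metis closure_approachable dist_commute mem_ball)
    have "ball z \<rho> \<subseteq> W"
      using connected_component_set_absorb[of y _ i "ball z \<rho>"] y \<rho>(2) unfolding W by simp
    then show ?thesis using \<rho>(1) closure_subset by (intro exI[of _ "ball z \<rho>"]) auto
  next
    case 2
    then obtain v t\<^sub>0 \<rho> where d: "t\<^sub>0 > 0" "\<rho> > 0"
      "\<And>w t. w \<in> ball z \<rho> \<Longrightarrow> t \<in> {0<..t\<^sub>0} \<Longrightarrow> H (w + t *\<^sub>R v) < H w"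
      using descent unfolding descent_def by blast
    have "H (z + t\<^sub>0 *\<^sub>R v) < c" using d(1,2) d(3)[of z t\<^sub>0] 2 by simp
    then obtain \<eta> where \<eta>: "\<eta> > 0" "ball (z + t\<^sub>0 *\<^sub>R v) \<eta> \<subseteq> {z. H z < c}"
      using op by (metis mem_Collect_eq open_contains_ball)
    define \<rho>' where "\<rho>' = min \<rho> \<eta>"
    \<comment> \<open>sliding a point of the sublevel set along the descent direction stays in the open set\<close>
    have slide: "{w + t *\<^sub>R v | t. t \<in> {0<..t\<^sub>0}} \<subseteq> {z. H z < c}"
      if "w \<in> ball z \<rho>'" "H w \<le> c" for w
      using that d(3) by (fastforce simp: \<rho>'_def)
    have conn: "connected {w + t *\<^sub>R v | t. t \<in> T}" if "connected T" for w T
    proof -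
      have "connected ((\<lambda>t. w + t *\<^sub>R v) ` T)"
        by (intro connected_continuous_image continuous_intros that)
      then show ?thesis by (simp add: image_def Setcompr_eq_image)
    qed
    obtain y where y: "y \<in> W" "y \<in> ball z \<rho>'"
      using z d(2) \<eta>(1) unfolding \<rho>'_def by (metis closure_approachable dist_commute mem_ball min_less_iff_conj)
    have "H y < c" using y(1) connected_component_subset unfolding W by fastforce
    have "{y + t *\<^sub>R v | t. t \<in> {0..t\<^sub>0}} \<subseteq> W"
      unfolding W
    proof (rule connected_component_set_absorb[of y])
      show "{y + t *\<^sub>R v |t. t \<in> {0..t\<^sub>0}} \<subseteq> {z. H z < c}"
      proof clarify
        fix t assume "t \<in> {0..t\<^sub>0}"
        then consider "t = 0" | "t \<in> {0<..t\<^sub>0}" by force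
        then show "H (y + t *\<^sub>R v) < c"
          using slide[OF y(2)] \<open>H y < c\<close> by cases auto
      qed
      show "y \<in> {y + t *\<^sub>R v |t. t \<in> {0..t\<^sub>0}}" using d(1) by (auto intro!: exI[of _ 0])
    qed (use y W conn[of "{0..t\<^sub>0}"] in auto)
    moreover have "y + t\<^sub>0 *\<^sub>R v \<in> {y + t *\<^sub>R v | t. t \<in> {0..t\<^sub>0}}" using d(1) by fastforce
    ultimately have "y + t\<^sub>0 *\<^sub>R v \<in> W" by blast
    moreover have "y + t\<^sub>0 *\<^sub>R v \<in> ball (z + t\<^sub>0 *\<^sub>R v) \<eta>" using y(2) by (simp add: \<rho>'_def)
    ultimately have bW: "ball (z + t\<^sub>0 *\<^sub>R v) \<eta> \<subseteq> W"
      using connected_component_set_absorb[of _ "{z. H z < c}" i "ball (z + t\<^sub>0 *\<^sub>R v) \<eta>"] \<eta>(2) unfolding W by blast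
    have "w \<in> closure W" if w: "w \<in> ball z \<rho>'" "H w \<le> c" for w
    proof -
      have "w + t\<^sub>0 *\<^sub>R v \<in> W" using w(1) bW by (auto simp: \<rho>'_def)
      then have sub: "{w + t *\<^sub>R v | t. t \<in> {0<..t\<^sub>0}} \<subseteq> W"
        using connected_component_set_absorb[OF _ conn slide[OF w], of "w + t\<^sub>0 *\<^sub>R v" i] d(1)
        unfolding W by fastforce
      have "((\<lambda>t. w + t *\<^sub>R v) \<longlongrightarrow> w + 0 *\<^sub>R v) (at_right 0)" by (intro tendsto_intros)
      moreover have "\<forall>\<^sub>F t in at_right 0. w + t *\<^sub>R v \<in> closure W"
      proof (rule eventually_at_rightI[OF _ d(1)])
        fix t assume "t \<in> {0<..<t\<^sub>0}"
        then have "w + t *\<^sub>R v \<in> {w + t *\<^sub>R v | t. t \<in> {0<..t\<^sub>0}}" by fastforce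
        then show "w + t *\<^sub>R v \<in> closure W" using sub closure_subset by blast
      qed
      ultimately show ?thesis
        using Lim_in_closed_set[OF closed_closure _ trivial_limit_at_right_real] by fastforce
    qed
    then show ?thesis using d(2) \<eta>(1) by (intro exI[of _ "ball z \<rho>'"]) (auto simp: \<rho>'_def)
  qed
qed

section \<open>Geometry of the level sets near a saddle\<close>

text \<open>What is needed about a nondegenerate saddle of index one: a lower bound by the diagonal quadratic
  form with ten percent of slack in each eigenvalue, negativity on the unstable axis, and convexity on
  the segment from a point to its orthogonal projection on that axis. The number \<open>- \<kappa> k\<close> is the
  negative eigenvalue; the other \<open>\<kappa> j\<close> are the positive ones.\<close>
locale saddle_chart =
  fixes H :: "'a::euclidean_space \<Rightarrow> real" and z\<^sub>0 :: 'a and E :: "'j::finite \<Rightarrow> 'a"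
    and \<kappa> :: "'j \<Rightarrow> real" and k :: 'j and r :: real
  assumes cont: "continuous_on UNIV H"
    and orth: "E i \<bullet> E j = (if i = j then 1 else 0)"
    and norm_sq: "(norm y)\<^sup>2 = (\<Sum>j\<in>UNIV. (y \<bullet> E j)\<^sup>2)"
    and \<kappa>_pos: "\<kappa> j > 0" and r_pos: "r > 0"
    and lower: "z \<in> ball z\<^sub>0 r \<Longrightarrow>
      H z - H z\<^sub>0 \<ge> - (11 / 20) * \<kappa> k * ((z - z\<^sub>0) \<bullet> E k)\<^sup>2
        + (9 / 20) * (\<Sum>j\<in>- {k}. \<kappa> j * ((z - z\<^sub>0) \<bullet> E j)\<^sup>2)"
    and axis: "\<bar>x\<bar> < r \<Longrightarrow> x \<noteq> 0 \<Longrightarrow> H (z\<^sub>0 + x *\<^sub>R E k) < H z\<^sub>0"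
    and segment: "z \<in> ball z\<^sub>0 r \<Longrightarrow> t \<in> {0..1} \<Longrightarrow> w = z\<^sub>0 + ((z - z\<^sub>0) \<bullet> E k) *\<^sub>R E k \<Longrightarrow>
      H (w + t *\<^sub>R (z - w)) \<le> (1 - t) * H w + t * H z"
begin

definition q :: "'j \<Rightarrow> 'a \<Rightarrow> real" where
  "q j z = (z - z\<^sub>0) \<bullet> E j"

definition foot :: "'a \<Rightarrow> 'a" where
  "foot z = z\<^sub>0 + q k z *\<^sub>R E k"

definition seg :: "'a \<Rightarrow> real \<Rightarrow> 'a" where
  "seg z t = foot z + t *\<^sub>R (z - foot z)"

definition box :: "real \<Rightarrow> 'a set" where
  "box \<delta> = {z. \<bar>q k z\<bar> \<le> \<delta> / sqrt (\<kappa> k) \<and> (\<forall>j. j \<noteq> k \<longrightarrow> \<bar>q j z\<bar> \<le> 2 * \<delta> / sqrt (\<kappa> j))}"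

definition basin :: "'a \<Rightarrow> 'a set" where
  "basin i = connected_component_set {z. H z < H z\<^sub>0} i"

lemma q_axis [simp]: "q j (z\<^sub>0 + x *\<^sub>R E k) = (if j = k then x else 0)"
  by (simp add: q_def orth)

lemma q_seg: "q j (seg z t) = (if j = k then q k z else t * q j z)"
  by (simp add: q_def seg_def foot_def orth inner_simps algebra_simps)

lemma seg_0 [simp]: "seg z 0 = foot z" and seg_1 [simp]: "seg z 1 = z"
  by (simp_all add: seg_def)

lemma continuous_q [continuous_intros]: "continuous_on S (q j)"
  unfolding q_def by (intro continuous_intros)

lemma continuous_H: "continuous_on S H"
  using cont continuous_on_subset by blast

lemma norm_sq_q: "(norm (z - z\<^sub>0))\<^sup>2 = (\<Sum>j\<in>UNIV. (q j z)\<^sup>2)"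
  by (simp add: norm_sq q_def)

lemma mem_ball_q: "0 < s \<Longrightarrow> z \<in> ball z\<^sub>0 s \<longleftrightarrow> (\<Sum>j\<in>UNIV. (q j z)\<^sup>2) < s\<^sup>2"
  unfolding norm_sq_q[symmetric] mem_ball dist_norm norm_minus_commute[of z\<^sub>0]
  by (metis less_eq_real_def norm_ge_zero power2_less_imp_less power_strict_mono zero_less_numeral)

lemma seg_in_ball:
  assumes "z \<in> ball z\<^sub>0 r" "t \<in> {0..1}"
  shows "seg z t \<in> ball z\<^sub>0 r"
proof -
  have "(\<Sum>j\<in>UNIV. (q j (seg z t))\<^sup>2) \<le> (\<Sum>j\<in>UNIV. (q j z)\<^sup>2)"
    using assms(2) by (intro sum_mono) (auto simp: q_seg power_mult_distrib mult_left_le_one_le power_le_one)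
  then show ?thesis using assms(1) mem_ball_q[OF r_pos] by simp
qed

lemma abs_q_less: "z \<in> ball z\<^sub>0 r \<Longrightarrow> \<bar>q k z\<bar> < r"
proof -
  assume z: "z \<in> ball z\<^sub>0 r"
  have "(q k z)\<^sup>2 \<le> (\<Sum>j\<in>UNIV. (q j z)\<^sup>2)" by (rule member_le_sum) auto
  then have "\<bar>q k z\<bar>\<^sup>2 < r\<^sup>2" using z mem_ball_q[OF r_pos] by simp
  then show ?thesis using r_pos by (meson less_imp_le power2_less_imp_less)
qed

lemma H_foot: "z \<in> ball z\<^sub>0 r \<Longrightarrow> q k z \<noteq> 0 \<Longrightarrow> H (foot z) < H z\<^sub>0"
  unfolding foot_def using axis abs_q_less by blast

lemma H_seg: "z \<in> ball z\<^sub>0 r \<Longrightarrow> t \<in> {0..1} \<Longrightarrow> H (seg z t) \<le> (1 - t) * H (foot z) + t * H z"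
  unfolding seg_def by (rule segment) (simp_all add: foot_def q_def)

text \<open>By convexity and because the axis lies below the saddle, contracting to the axis does not leave
  a sublevel set.\<close>
lemma H_seg_less:
  assumes z: "z \<in> ball z\<^sub>0 r" "t \<in> {0..1}" and c: "q k z \<noteq> 0" "H z\<^sub>0 \<le> c" "H z < c"
  shows "H (seg z t) < c"
proof (cases "t = 0")
  case True
  then show ?thesis using H_foot[OF z(1) c(1)] c(2) by simp
next
  case False
  have "(1 - t) * H (foot z) \<le> (1 - t) * c" "t * H z < t * c"
    using H_foot[OF z(1) c(1)] c z(2) False by (auto intro!: mult_left_mono)
  then show ?thesis using H_seg[OF z] by (simp add: algebra_simps)
qed

lemma H_transversal:
  assumes "z \<in> ball z\<^sub>0 r" "q k z = 0" "z \<noteq> z\<^sub>0"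
  shows "H z > H z\<^sub>0"
proof -
  have "(\<Sum>j\<in>UNIV. (q j z)\<^sup>2) > 0" using assms(3) by (simp flip: norm_sq_q)
  then obtain j where j: "(q j z)\<^sup>2 \<noteq> 0" by (metis less_irrefl sum.neutral)
  then have "j \<noteq> k" using assms(2) by auto
  then have "(\<Sum>j\<in>- {k}. \<kappa> j * (q j z)\<^sup>2) > 0"
    using j \<kappa>_pos by (intro sum_pos2[of _ j]) (auto simp: less_imp_le)
  then show ?thesis using lower[OF assms(1)] assms(2) by (simp add: q_def)
qed

text \<open>Below the level \<open>H z\<^sub>0 + a\<close> the stable coordinates are controlled by the unstable one. The
  constants fit because \<open>11/20 * (3/2)\<^sup>2 + 1/2 < 9/20 * 2\<^sup>2\<close>.\<close>
lemma tube_strict: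
  assumes z: "z \<in> ball z\<^sub>0 r" and H: "H z < H z\<^sub>0 + a" and \<delta>: "\<delta> > 0" "a \<le> \<delta>\<^sup>2 / 2"
    and qk: "\<bar>q k z\<bar> \<le> 3 / 2 * \<delta> / sqrt (\<kappa> k)" and j: "j \<noteq> k"
  shows "\<bar>q j z\<bar> < 2 * \<delta> / sqrt (\<kappa> j)"
proof -
  have "(sqrt (\<kappa> k) * \<bar>q k z\<bar>)\<^sup>2 \<le> (3 / 2 * \<delta>)\<^sup>2"
    using qk \<kappa>_pos[of k] by (intro power_mono) (auto simp: field_simps)
  then have k: "\<kappa> k * (q k z)\<^sup>2 \<le> 9 / 4 * \<delta>\<^sup>2"
    using less_imp_le[OF \<kappa>_pos[of k]] by (simp add: power_mult_distrib power_divide)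
  have "\<kappa> j * (q j z)\<^sup>2 \<le> (\<Sum>j\<in>- {k}. \<kappa> j * (q j z)\<^sup>2)"
    using j \<kappa>_pos by (intro member_le_sum) (auto simp: less_imp_le)
  then have "9 / 20 * (\<kappa> j * (q j z)\<^sup>2) \<le> 11 / 20 * (\<kappa> k * (q k z)\<^sup>2) + (H z - H z\<^sub>0)"
    using lower[OF z] by (simp add: q_def)
  moreover have "\<delta>\<^sup>2 > 0" using \<delta> by simp
  ultimately have "\<kappa> j * (q j z)\<^sup>2 < 4 * \<delta>\<^sup>2" using k H \<delta>(2) by linarith
  then have "(sqrt (\<kappa> j) * \<bar>q j z\<bar>)\<^sup>2 < (2 * \<delta>)\<^sup>2"
    using less_imp_le[OF \<kappa>_pos[of j]] by (simp add: power_mult_distrib)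
  then have "sqrt (\<kappa> j) * \<bar>q j z\<bar> < 2 * \<delta>" using power2_less_imp_less[of "sqrt (\<kappa> j) * \<bar>q j z\<bar>" "2 * \<delta>"] \<delta>(1) by linarith
  then show ?thesis using \<kappa>_pos[of j] by (simp add: pos_less_divide_eq mult.commute)
qed

lemma box_subset_ball:
  assumes "s > 0" "0 \<le> \<delta>" "4 * \<delta>\<^sup>2 * (\<Sum>j\<in>UNIV. 1 / \<kappa> j) < s\<^sup>2" "\<And>j. \<bar>q j z\<bar> \<le> 2 * \<delta> / sqrt (\<kappa> j)"
  shows "z \<in> ball z\<^sub>0 s"
proof -
  have "(q j z)\<^sup>2 \<le> 4 * \<delta>\<^sup>2 * (1 / \<kappa> j)" for j
  proof -
    have "\<bar>q j z\<bar>\<^sup>2 \<le> (2 * \<delta> / sqrt (\<kappa> j))\<^sup>2" using assms(4) by (intro power_mono) auto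
    then show ?thesis using less_imp_le[OF \<kappa>_pos[of j]] by (simp add: power_divide power_mult_distrib)
  qed
  then have "(\<Sum>j\<in>UNIV. (q j z)\<^sup>2) \<le> (\<Sum>j\<in>UNIV. 4 * \<delta>\<^sup>2 * (1 / \<kappa> j))" by (intro sum_mono)
  also have "\<dots> < s\<^sup>2" using assms(3) by (simp add: sum_distrib_left)
  finally show ?thesis using mem_ball_q assms(1) by blast
qed

lemma connected_axis: "connected {z\<^sub>0 + x *\<^sub>R E k | x. x \<in> I}" if "connected I"
proof -
  have "connected ((\<lambda>x. z\<^sub>0 + x *\<^sub>R E k) ` I)"
    by (intro connected_continuous_image continuous_intros that)
  then show ?thesis by (simp add: image_def Setcompr_eq_image)
qed

lemma connected_seg: "connected (seg z ` {0..1})"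
  unfolding seg_def by (intro connected_continuous_image continuous_intros) auto

lemma open_sublevel: "open {z. H z < c}"
  by (intro open_Collect_less continuous_intros cont)

text \<open>Half of the axis is connected and lies below the saddle, so one point of the basin near the saddle
  brings the whole half axis into the basin. Contraction to the axis then connects every point on that
  side to it. The sign \<open>s\<close> selects the side, so that both wells are treated at once.\<close>
lemma side_in_basin:
  assumes s: "s = 1 \<or> s = - 1"
    and i: "z\<^sub>0 \<in> closure (basin i)" and orient: "\<And>z. z \<in> ball z\<^sub>0 r \<Longrightarrow> z \<in> basin i \<Longrightarrow> s * q k z < 0"
    and z: "z \<in> ball z\<^sub>0 r" "s * q k z < 0"
  shows "H z < H z\<^sub>0 \<Longrightarrow> z \<in> basin i" and "H z \<le> H z\<^sub>0 \<Longrightarrow> z \<in> closure (basin i)"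
proof -
  have seg_sub: "seg w ` {0..1} \<subseteq> {z. H z < H z\<^sub>0}" if "w \<in> ball z\<^sub>0 r" "s * q k w < 0" "H w < H z\<^sub>0" for w
  proof -
    have "q k w \<noteq> 0" using that(2) by auto
    then show ?thesis using that H_seg_less[of w _ "H z\<^sub>0"] by auto
  qed
  obtain w where w: "w \<in> basin i" "w \<in> ball z\<^sub>0 r"
    using i r_pos by (metis closure_approachable dist_commute mem_ball)
  have wH: "H w < H z\<^sub>0" using w(1) connected_component_subset unfolding basin_def by fastforce
  have "seg w ` {0..1} \<subseteq> basin i"
    using w connected_seg seg_sub[OF w(2) orient[OF w(2,1)] wH] unfolding basin_def
    by (intro connected_component_set_absorb[of w]) (auto intro!: image_eqI[of _ _ 1])
  then have fw: "foot w \<in> basin i" by (force intro!: image_eqI[of _ _ 0])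
  define I where "I = {x. \<bar>x\<bar> < r \<and> s * x < 0}"
  have "I = {-r<..<0} \<or> I = {0<..<r}" using s by (auto simp: I_def)
  then have "connected I" by auto
  then have "{z\<^sub>0 + x *\<^sub>R E k | x. x \<in> I} \<subseteq> basin i"
    using fw unfolding basin_def
  proof (intro connected_component_set_absorb[of "foot w"] connected_axis)
    have "x \<noteq> 0" if "x \<in> I" for x using that by (auto simp: I_def)
    then show "{z\<^sub>0 + x *\<^sub>R E k |x. x \<in> I} \<subseteq> {z. H z < H z\<^sub>0}" using axis by (auto simp: I_def)
    show "foot w \<in> {z\<^sub>0 + x *\<^sub>R E k |x. x \<in> I}"
      using orient[OF w(2,1)] abs_q_less[OF w(2)] by (auto simp: foot_def I_def)
  qed
  then have foot: "foot z \<in> basin i" if "z \<in> ball z\<^sub>0 r" "s * q k z < 0" for z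
    using that abs_q_less[of z] unfolding I_def foot_def by blast
  have *: "z \<in> basin i" if "H z < H z\<^sub>0" "z \<in> ball z\<^sub>0 r" "s * q k z < 0" for z
  proof -
    have "seg z ` {0..1} \<subseteq> basin i"
      using foot that connected_seg seg_sub[of z] unfolding basin_def
      by (intro connected_component_set_absorb[of "foot z"]) (auto intro!: image_eqI[of _ _ 0])
    then show ?thesis by (force intro!: image_eqI[of _ _ 1])
  qed
  then show "H z < H z\<^sub>0 \<Longrightarrow> z \<in> basin i" using z by blast
  show "z \<in> closure (basin i)" if "H z \<le> H z\<^sub>0"
  proof -
    have qk: "q k z \<noteq> 0" using z(2) by auto
    have "seg z t \<in> basin i" if t: "t \<in> {0<..<1}" for t
    proof (rule *)
      have "(1 - t) * H (foot z) < (1 - t) * H z\<^sub>0" "t * H z \<le> t * H z\<^sub>0"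
        using t z \<open>H z \<le> H z\<^sub>0\<close> H_foot[OF z(1)] qk by (auto intro!: mult_left_mono)
      moreover have "(1 - t) * H z\<^sub>0 + t * H z\<^sub>0 = H z\<^sub>0" by (simp add: left_diff_distrib)
      moreover have "H (seg z t) \<le> (1 - t) * H (foot z) + t * H z" using H_seg[OF z(1), of t] t by simp
      ultimately show "H (seg z t) < H z\<^sub>0" by linarith
    qed (use t z seg_in_ball in \<open>auto simp: q_seg\<close>)
    then have "\<forall>\<^sub>F t in at_left 1. seg z t \<in> closure (basin i)"
      using closure_subset[of "basin i"] by (intro eventually_at_leftI[of 0]) auto
    moreover have "(seg z \<longlongrightarrow> seg z 1) (at_left 1)"
      unfolding seg_def by (intro tendsto_intros)
    ultimately show ?thesis
      using Lim_in_closed_set[of "closure (basin i)"] by fastforce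
  qed
qed

section \<open>The two ends of the saddle box\<close>

lemma closed_box: "closed (box \<delta>)"
  unfolding box_def
  by (intro closed_Collect_conj closed_Collect_all closed_Collect_imp closed_Collect_le continuous_intros) auto

lemma open_region: "open ({z. H z < c} - box \<delta>)"
  by (intro open_Diff open_sublevel closed_box)

text \<open>The set \<open>R\<close> of points just beyond one end of the box contracts to the axis, hence is connected,
  and it meets \<open>basin i\<close>. If \<open>R\<close> missed the component \<open>C\<close> of \<open>i\<close>, then \<open>C\<close> would cut the connected
  set \<open>basin i\<close> into two open pieces.\<close>
lemma side_component:
  assumes s: "s = 1 \<or> s = - 1"
    and i: "z\<^sub>0 \<in> closure (basin i)" and orient: "\<And>z. z \<in> ball z\<^sub>0 r \<Longrightarrow> z \<in> basin i \<Longrightarrow> s * q k z < 0"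
    and Hi: "H i < H z\<^sub>0" "i \<notin> box \<delta>"
    and \<delta>: "\<delta> > 0" "0 < a" "a \<le> \<delta>\<^sup>2 / 2"
    and small: "\<And>w. (\<And>j. \<bar>q j w\<bar> \<le> 2 * \<delta> / sqrt (\<kappa> j)) \<Longrightarrow> w \<in> ball z\<^sub>0 r"
    and w: "H w < H z\<^sub>0 + a" "\<And>j. j \<noteq> k \<Longrightarrow> \<bar>q j w\<bar> \<le> 2 * \<delta> / sqrt (\<kappa> j)"
      "s * q k w < - (\<delta> / sqrt (\<kappa> k))" "- (3 / 2 * \<delta> / sqrt (\<kappa> k)) \<le> s * q k w"
  shows "w \<in> connected_component_set ({z. H z < H z\<^sub>0 + a} - box \<delta>) i"
proof -
  define x where "x = \<delta> / sqrt (\<kappa> k)"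
  have x: "x > 0" using \<delta>(1) \<kappa>_pos by (simp add: x_def)
  have x32: "3 / 2 * \<delta> / sqrt (\<kappa> k) = 3 / 2 * x" "2 * \<delta> / sqrt (\<kappa> k) = 2 * x" by (simp_all add: x_def)
  define S where "S = {z. H z < H z\<^sub>0 + a} - box \<delta>"
  define C where "C = connected_component_set S i"
  define R where "R = {z. H z < H z\<^sub>0 + a \<and> (\<forall>j. j \<noteq> k \<longrightarrow> \<bar>q j z\<bar> \<le> 2 * \<delta> / sqrt (\<kappa> j))
    \<and> s * q k z < - x \<and> - (3 / 2 * x) \<le> s * q k z}"
  have abs_q: "\<bar>q k z\<bar> = - (s * q k z)" if "s * q k z < 0" for z
    using s that by auto
  have Rball: "z \<in> ball z\<^sub>0 r" if "z \<in> R" for z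
  proof (rule small)
    fix j
    have "\<bar>q k z\<bar> \<le> 2 * x" using that x by (subst abs_q) (auto simp: R_def)
    then show "\<bar>q j z\<bar> \<le> 2 * \<delta> / sqrt (\<kappa> j)"
      using that x32 by (cases "j = k") (auto simp: R_def)
  qed
  have RS: "R \<subseteq> S"
  proof
    fix z assume z: "z \<in> R"
    then have "\<bar>q k z\<bar> > x" using x by (subst abs_q) (auto simp: R_def)
    then have "z \<notin> box \<delta>" by (auto simp: box_def x_def)
    then show "z \<in> S" using z by (simp add: R_def S_def)
  qed
  have axisR: "z\<^sub>0 + y *\<^sub>R E k \<in> R" if "s * y < - x" "- (3 / 2 * x) \<le> s * y" for y
  proof -
    have "z\<^sub>0 + y *\<^sub>R E k \<in> ball z\<^sub>0 r"
    proof (rule small)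
      fix j
      have "\<bar>y\<bar> \<le> 2 * x" using that x s by auto
      moreover have "0 \<le> 2 * \<delta> / sqrt (\<kappa> j)" using \<delta>(1) \<kappa>_pos[of j] by simp
      ultimately show "\<bar>q j (z\<^sub>0 + y *\<^sub>R E k)\<bar> \<le> 2 * \<delta> / sqrt (\<kappa> j)"
        using x32 by (cases "j = k") auto
    qed
    then have "H (z\<^sub>0 + y *\<^sub>R E k) < H z\<^sub>0"
      using abs_q_less[of "z\<^sub>0 + y *\<^sub>R E k"] that x by (intro axis) auto
    then show ?thesis using that \<delta> \<kappa>_pos by (auto simp: R_def less_imp_le)
  qed
  define A where "A = {z\<^sub>0 + y *\<^sub>R E k | y. s * y < - x \<and> - (3 / 2 * x) \<le> s * y}"
  have "connected A"
  proof -
    have "{y. s * y < - x \<and> - (3 / 2 * x) \<le> s * y} = {- (3 / 2 * x)..<- x} \<or>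
        {y. s * y < - x \<and> - (3 / 2 * x) \<le> s * y} = {x<..3 / 2 * x}"
      using s by auto
    then have "connected {y. s * y < - x \<and> - (3 / 2 * x) \<le> s * y}" by auto
    from connected_axis[OF this] show ?thesis by (simp add: A_def)
  qed
  have AR: "A \<subseteq> R" using axisR by (auto simp: A_def)
  \<comment> \<open>a base point: \<open>5/4\<close> is any number strictly between \<open>1\<close> and \<open>3/2\<close>\<close>
  define p where "p = z\<^sub>0 + (- s * (5 / 4 * x)) *\<^sub>R E k"
  have pA: "p \<in> A"
    unfolding A_def p_def by (rule CollectI, rule exI[of _ "- s * (5 / 4 * x)"]) (use s x in auto)
  have pH: "H p < H z\<^sub>0"
    using abs_q_less[OF Rball[OF subsetD[OF AR pA]]] s x unfolding p_def q_axis by (intro axis) auto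
  have R_component: "z \<in> connected_component_set S p" if z: "z \<in> R" for z
  proof -
    have neg: "s * q k z < 0" using z x by (auto simp: R_def)
    have "seg z ` {0..1} \<subseteq> R"
    proof safe
      fix t :: real assume t: "t \<in> {0..1}"
      have "q k z \<noteq> 0" using neg by auto
      then have "H (seg z t) < H z\<^sub>0 + a"
        using H_seg_less[OF Rball[OF z] t, of "H z\<^sub>0 + a"] neg z \<delta> by (auto simp: R_def)
      moreover have "\<bar>q j (seg z t)\<bar> \<le> 2 * \<delta> / sqrt (\<kappa> j)" if "j \<noteq> k" for j
      proof -
        have "\<bar>q j (seg z t)\<bar> \<le> \<bar>q j z\<bar>" using that t by (simp add: q_seg abs_mult mult_left_le_one_le)
        then show ?thesis using z that by (fastforce simp: R_def)
      qed
      ultimately show "seg z t \<in> R" using z by (simp add: R_def q_seg)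
    qed
    then have segS: "seg z ` {0..1} \<subseteq> S" using RS by blast
    have "foot z \<in> A" using z by (auto simp: R_def A_def foot_def)
    then have "foot z \<in> connected_component_set S p"
      using connected_component_maximal[OF pA \<open>connected A\<close>] AR RS by blast
    then have "seg z ` {0..1} \<subseteq> connected_component_set S p"
      by (rule connected_component_set_absorb[OF _ connected_seg segS]) (rule image_eqI[of _ _ 0], auto)
    then show ?thesis by (force intro!: image_eqI[of _ _ 1])
  qed
  have pS: "p \<in> S" using pA AR RS by blast
  have pC: "p \<in> C"
  proof (rule ccontr)
    assume "p \<notin> C"
    then have disj: "R \<inter> C = {}"
      using R_component unfolding C_def
      by (smt (verit) connected_component_sym connected_component_trans disjoint_iff mem_Collect_eq)
    define W where "W = basin i"
    have openC: "open C" "open (S - C)"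
      unfolding C_def S_def by (intro open_connected_component open_Diff_component open_region)+
    have openW: "open W" unfolding W_def basin_def by (intro open_connected_component open_sublevel)
    have WH: "H z < H z\<^sub>0" if "z \<in> W" for z
      using that connected_component_subset unfolding W_def basin_def by fastforce
    \<comment> \<open>the only critical case is a point of the box: nearby points of the basin outside the box lie in \<open>R\<close>,
      because the basin stays on its side of the saddle\<close>
    have "open (W - C)"
    proof (subst open_subopen, intro ballI)
      fix z assume z: "z \<in> W - C"
      show "\<exists>T. open T \<and> z \<in> T \<and> T \<subseteq> W - C"
      proof (cases "z \<in> box \<delta>")
        case False
        then have "z \<in> S - C" using z WH[of z] \<delta> by (simp add: S_def)
        then show ?thesis using openW openC z
          by (intro exI[of _ "W \<inter> (S - C)"]) auto
      next
        case True
        define V where "V = (\<Inter>j. {z. \<bar>q j z\<bar> < (if j = k then 3 / 2 else 2) * \<delta> / sqrt (\<kappa> j)})"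
        have "open V"
          unfolding V_def by (intro open_INT) (auto intro!: open_Collect_less continuous_intros)
        have qz: "\<bar>q k z\<bar> \<le> x" using True by (auto simp: box_def x_def)
        have "z \<in> ball z\<^sub>0 r"
        proof (rule small)
          fix j show "\<bar>q j z\<bar> \<le> 2 * \<delta> / sqrt (\<kappa> j)"
            using True x qz x32 by (cases "j = k") (auto simp: box_def)
        qed
        then have "\<bar>q j z\<bar> < 2 * \<delta> / sqrt (\<kappa> j)" if "j \<noteq> k" for j
          using tube_strict[of z a \<delta> j] WH[of z] z \<delta> that qz x x32 by auto
        then have "z \<in> V" using qz x x32 by (auto simp: V_def)
        moreover have "W \<inter> V \<subseteq> W - C"
        proof safe
          fix y assume y: "y \<in> W" "y \<in> V" "y \<in> C"
          have "y \<notin> box \<delta>" using y(3) connected_component_subset unfolding C_def S_def by blast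
          have qV: "\<bar>q j y\<bar> < (if j = k then 3 / 2 else 2) * \<delta> / sqrt (\<kappa> j)" for j
            using y(2) by (simp add: V_def)
          have q2: "\<bar>q j y\<bar> \<le> 2 * \<delta> / sqrt (\<kappa> j)" if "j \<noteq> k" for j
            using qV[of j] that by simp
          have qk: "\<bar>q k y\<bar> < 3 / 2 * x" using qV[of k] x32 by simp
          have "y \<in> ball z\<^sub>0 r"
          proof (rule small)
            fix j show "\<bar>q j y\<bar> \<le> 2 * \<delta> / sqrt (\<kappa> j)"
              using q2 qk x x32 by (cases "j = k") auto
          qed
          then have neg: "s * q k y < 0" using orient y(1) by (simp add: W_def)
          have "\<bar>q k y\<bar> > x"
          proof (rule ccontr)
            assume "\<not> \<bar>q k y\<bar> > x"
            then have "y \<in> box \<delta>" using q2 by (auto simp: box_def x_def)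
            then show False using \<open>y \<notin> box \<delta>\<close> by simp
          qed
          then have "y \<in> R"
            using q2 qk abs_q[OF neg] WH[OF y(1)] \<delta> by (auto simp: R_def)
          then show False using disj y(3) by blast
        qed
        ultimately show ?thesis using z openW \<open>open V\<close> by (intro exI[of _ "W \<inter> V"]) auto
      qed
    qed
    moreover have "connected W" by (simp add: W_def basin_def)
    moreover have "i \<in> W" using Hi by (simp add: W_def basin_def)
    moreover have "i \<in> C" using Hi \<delta> by (simp add: C_def S_def)
    moreover have "p \<in> W"
    proof -
      have "s * q k p < 0" using s x unfolding p_def q_axis by auto
      then show ?thesis
        unfolding W_def using side_in_basin(1)[OF s i orient Rball] pH AR pA by blast
    qed
    ultimately show False
      using openC(1) openW \<open>p \<notin> C\<close> connectedD[of W "W \<inter> C" "W - C"] by blast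
  qed
  have "w \<in> R" using w x32 by (auto simp: R_def x_def)
  then have "w \<in> connected_component_set S p" by (rule R_component)
  then have "w \<in> C" using pC connected_component_eq unfolding C_def by metis
  then show ?thesis by (simp add: C_def S_def)
qed

text \<open>The set \<open>{H \<le> H z\<^sub>0}\<close> is the union of the closed sets \<open>Y1\<close>, the closure of the basin of \<open>i\<close>,
  and \<open>Y2\<close>, the rest together with \<open>z\<^sub>0\<close>, which meet only in \<open>z\<^sub>0\<close>. At a slightly higher level a point
  away from \<open>z\<^sub>0\<close> is assigned to the nearer of the two sets, a point near \<open>z\<^sub>0\<close> according to the sign
  of its unstable coordinate. The closed set \<open>X\<close> collects the points where these rules are undecided or
  contradict each other. It avoids \<open>{H \<le> H z\<^sub>0}\<close>, hence by compactness also all levels up to some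
  \<open>H z\<^sub>0 + a\<^sub>0\<close>.\<close>
lemma basins_separated:
  assumes s: "s = 1 \<or> s = - 1"
    and i: "z\<^sub>0 \<in> closure (basin i)" and orient: "\<And>z. z \<in> ball z\<^sub>0 r \<Longrightarrow> z \<in> basin i \<Longrightarrow> s * q k z < 0"
    and H: "H i < H z\<^sub>0" "H i' < H z\<^sub>0" "i' \<notin> basin i"
    and desc: "\<And>z. z \<in> closure (basin i) \<Longrightarrow> H z = H z\<^sub>0 \<Longrightarrow> z \<noteq> z\<^sub>0 \<Longrightarrow> descent H z"
    and comp: "compact {z. H z \<le> H z\<^sub>0 + 1}"
  shows "\<exists>a\<^sub>0>0. \<forall>a \<delta>. a \<le> a\<^sub>0 \<longrightarrow> 0 < \<delta> \<longrightarrow> a \<le> \<delta>\<^sup>2 / 2 \<longrightarrow>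
    i' \<notin> connected_component_set ({z. H z < H z\<^sub>0 + a} - box \<delta>) i"
proof -
  define W where "W = basin i"
  define Y1 where "Y1 = closure W"
  define Y2 where "Y2 = {z. H z \<le> H z\<^sub>0} - (closure W - {z\<^sub>0})"
  have WH: "W \<subseteq> {z. H z < H z\<^sub>0}"
    using connected_component_subset unfolding W_def basin_def by blast
  have Y1H: "Y1 \<subseteq> {z. H z \<le> H z\<^sub>0}"
    unfolding Y1_def using WH by (intro closure_minimal closed_Collect_le cont continuous_intros) auto
  have iW: "i \<in> W" using H by (simp add: W_def basin_def)
  have "closed Y1" by (simp add: Y1_def)
  have "closed Y2"
  proof -
    have "\<exists>V. open V \<and> z \<in> V \<and> V \<inter> {z. H z \<le> H z\<^sub>0} \<subseteq> closure W"
      if "z \<in> closure W - {z\<^sub>0}" for z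
      using that desc by (intro closure_sublevel_component_open[OF cont])
        (auto simp: W_def basin_def)
    then obtain V where V: "\<And>z. z \<in> closure W - {z\<^sub>0} \<Longrightarrow>
        open (V z) \<and> z \<in> V z \<and> V z \<inter> {z. H z \<le> H z\<^sub>0} \<subseteq> closure W" by metis
    have "Y2 = {z. H z \<le> H z\<^sub>0} - (\<Union>z\<in>closure W - {z\<^sub>0}. V z - {z\<^sub>0})"
      using V unfolding Y2_def by blast
    moreover have "closed {z. H z \<le> H z\<^sub>0}" by (intro closed_Collect_le cont continuous_intros)
    ultimately show ?thesis using V by (auto intro!: closed_Diff open_UN)
  qed
  define d1 where "d1 z = infdist z Y1" for z
  define d2 where "d2 z = infdist z Y2" for z
  have z0Y2: "z\<^sub>0 \<in> Y2" by (simp add: Y2_def)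
  have iY1: "i \<in> Y1" using iW closure_subset by (auto simp: Y1_def)
  have d0: "d1 z = 0 \<longleftrightarrow> z \<in> Y1" "d2 z = 0 \<longleftrightarrow> z \<in> Y2" "d1 z \<ge> 0" "d2 z \<ge> 0" for z
    using in_closed_iff_infdist_zero[OF \<open>closed Y1\<close>] in_closed_iff_infdist_zero[OF \<open>closed Y2\<close>] z0Y2 iY1
    by (auto simp: d1_def d2_def infdist_nonneg)
  have cont_d [continuous_intros]: "continuous_on S d1" "continuous_on S d2" for S
    unfolding d1_def d2_def by (intro continuous_intros)+
  define X where "X = ({z. d1 z = d2 z} - ball z\<^sub>0 (r / 4)) \<union>
    (cball z\<^sub>0 (r / 2) - ball z\<^sub>0 (r / 4)) \<inter>
      ({z. s * q k z \<le> 0 \<and> d2 z \<le> d1 z} \<union> {z. 0 \<le> s * q k z \<and> d1 z \<le> d2 z})"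
  have "closed X"
    unfolding X_def
    by (intro closed_Un closed_Int closed_Diff closed_Collect_eq closed_Collect_le closed_Collect_conj
        continuous_intros) auto
  have X_above: "H z > H z\<^sub>0" if z: "z \<in> X" for z
  proof (rule ccontr)
    assume "\<not> H z > H z\<^sub>0"
    then have Hz: "H z \<le> H z\<^sub>0" by simp
    have "z \<noteq> z\<^sub>0" using z r_pos by (auto simp: X_def)
    have cover: "z \<in> Y1 \<or> z \<in> Y2" using Hz by (auto simp: Y1_def Y2_def)
    have disjoint: "\<not> (z \<in> Y1 \<and> z \<in> Y2)" using \<open>z \<noteq> z\<^sub>0\<close> by (auto simp: Y1_def Y2_def)
    have ne: "d1 z \<noteq> d2 z" using cover disjoint d0[of z] by metis
    then have zball: "z \<in> ball z\<^sub>0 r" using z r_pos by (auto simp: X_def)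
    have q0: "q k z \<noteq> 0" using H_transversal[OF zball _ \<open>z \<noteq> z\<^sub>0\<close>] Hz by force
    then have "s * q k z < 0 \<or> s * q k z > 0" using s by auto
    then show False
    proof
      assume neg: "s * q k z < 0"
      then have "z \<in> Y1" using side_in_basin(2)[OF s i orient zball neg Hz] by (simp add: Y1_def W_def)
      then have "d1 z = 0" "d2 z > 0" using d0[of z] disjoint by (auto simp: less_le)
      then show False using z neg ne by (auto simp: X_def)
    next
      assume pos: "s * q k z > 0"
      have "z \<notin> Y1"
      proof
        assume "z \<in> Y1"
        moreover have "open (ball z\<^sub>0 r \<inter> {z. s * q k z > 0})"
          by (intro open_Int open_Collect_less continuous_intros) auto
        ultimately obtain w where "w \<in> W" "w \<in> ball z\<^sub>0 r" "s * q k w > 0"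
          using zball pos closure_iff_nhds_not_empty[of z W] unfolding Y1_def by blast
        then show False using orient[of w] by (simp add: W_def)
      qed
      then have "d2 z = 0" "d1 z > 0" using d0[of z] cover by (auto simp: less_le)
      then show False using z pos ne by (auto simp: X_def)
    qed
  qed
  obtain a\<^sub>0 where a0: "a\<^sub>0 > 0" "a\<^sub>0 \<le> 1" and X_gap: "\<And>z. z \<in> X \<Longrightarrow> H z \<ge> H z\<^sub>0 + a\<^sub>0"
  proof (cases "X \<inter> {z. H z \<le> H z\<^sub>0 + 1} = {}")
    case True
    then show ?thesis using that[of 1] by fastforce
  next
    case False
    have "compact (X \<inter> {z. H z \<le> H z\<^sub>0 + 1})" using comp \<open>closed X\<close> by (simp add: closed_Int_compact)
    then obtain y where y: "y \<in> X" "\<And>z. z \<in> X \<Longrightarrow> H z \<le> H z\<^sub>0 + 1 \<Longrightarrow> H y \<le> H z"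
      using continuous_attains_inf[OF _ False continuous_H] by auto
    show ?thesis
    proof (rule that[of "min 1 (H y - H z\<^sub>0)"])
      fix z assume "z \<in> X"
      then show "H z\<^sub>0 + min 1 (H y - H z\<^sub>0) \<le> H z" using y(2)[of z] by linarith
    qed (use X_above[OF y(1)] in auto)
  qed
  \<comment> \<open>both rules apply in the annulus of radii \<open>r / 4\<close> and \<open>r / 2\<close>; off \<open>X\<close> they agree there\<close>
  define T1 where "T1 = (ball z\<^sub>0 (r / 2) \<inter> {z. s * q k z < 0}) \<union> ({z. d1 z < d2 z} - cball z\<^sub>0 (r / 4))"
  define T2 where "T2 = (ball z\<^sub>0 (r / 2) \<inter> {z. s * q k z > 0}) \<union> ({z. d2 z < d1 z} - cball z\<^sub>0 (r / 4))"
  have openT: "open T1" "open T2"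
    unfolding T1_def T2_def
    by (auto intro!: open_Un open_Int open_Diff open_Collect_less continuous_intros)
  have iT: "i \<in> T1"
  proof (cases "i \<in> ball z\<^sub>0 (r / 2)")
    case True
    then show ?thesis using orient[of i] iW r_pos by (auto simp: T1_def W_def)
  next
    case False
    have "i \<noteq> z\<^sub>0" using H by auto
    then have "d1 i < d2 i" using d0[of i] iY1 by (auto simp: Y1_def Y2_def less_le)
    then show ?thesis using False r_pos by (auto simp: T1_def)
  qed
  have i'Y1: "i' \<notin> Y1"
  proof
    assume "i' \<in> Y1"
    moreover have "open (basin i')" "i' \<in> basin i'"
      unfolding basin_def using H(2) by (simp_all add: open_connected_component open_sublevel)
    ultimately have "W \<inter> basin i' \<noteq> {}"
      using closure_iff_nhds_not_empty[of i' W] unfolding Y1_def by blast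
    then have "basin i' = W"
      unfolding W_def basin_def using connected_component_nonoverlap by blast
    then have "i' \<in> W" using \<open>i' \<in> basin i'\<close> by simp
    then show False using H(3) by (simp add: W_def)
  qed
  have i'T: "i' \<in> T2"
  proof (cases "i' \<in> ball z\<^sub>0 (r / 2)")
    case True
    then have b: "i' \<in> ball z\<^sub>0 r" using r_pos by simp
    have "q k i' \<noteq> 0" using H_transversal[OF b] H(2) by (metis less_asym less_irrefl)
    moreover have "\<not> s * q k i' < 0" using side_in_basin(1)[OF s i orient b] H(2,3) by blast
    ultimately have "s * q k i' > 0" using s by auto
    then show ?thesis using True by (simp add: T2_def)
  next
    case False
    have "i' \<in> Y2" using H(2) i'Y1 by (auto simp: Y1_def Y2_def)
    then have "d2 i' < d1 i'" using d0[of i'] i'Y1 by (auto simp: less_le)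
    then show ?thesis using False r_pos by (auto simp: T2_def)
  qed
  have "i' \<notin> connected_component_set ({z. H z < H z\<^sub>0 + a} - box \<delta>) i"
    if a: "a \<le> a\<^sub>0" "0 < \<delta>" "a \<le> \<delta>\<^sup>2 / 2" for a \<delta>
  proof
    define C where "C = connected_component_set ({z. H z < H z\<^sub>0 + a} - box \<delta>) i"
    assume "i' \<in> connected_component_set ({z. H z < H z\<^sub>0 + a} - box \<delta>) i"
    then have i'C: "i' \<in> C" by (simp add: C_def)
    then have iC: "i \<in> C" unfolding C_def by (metis connected_component_in connected_component_refl mem_Collect_eq)
    have CS: "C \<subseteq> {z. H z < H z\<^sub>0 + a} - box \<delta>" unfolding C_def by (rule connected_component_subset)
    then have CX: "z \<notin> X" if "z \<in> C" for z using that X_gap[of z] a(1) by fastforce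
    have "C \<subseteq> T1 \<union> T2"
    proof
      fix z assume z: "z \<in> C"
      show "z \<in> T1 \<union> T2"
      proof (cases "z \<in> ball z\<^sub>0 (r / 2)")
        case True
        then have b: "z \<in> ball z\<^sub>0 r" using r_pos by simp
        have "q k z \<noteq> 0"
        proof
          assume q0: "q k z = 0"
          have "\<bar>q j z\<bar> \<le> 2 * \<delta> / sqrt (\<kappa> j)" if "j \<noteq> k" for j
            using tube_strict[OF b _ a(2,3) _ that] q0 CS z a(2) \<kappa>_pos[of k] by (fastforce simp: less_imp_le)
          then have "z \<in> box \<delta>" using q0 a(2) \<kappa>_pos by (auto simp: box_def less_imp_le)
          then show False using CS z by blast
        qed
        then have "s * q k z < 0 \<or> s * q k z > 0" using s by auto
        then show ?thesis using True by (auto simp: T1_def T2_def)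
      next
        case False
        then have "d1 z \<noteq> d2 z" using CX[OF z] r_pos by (auto simp: X_def)
        then show ?thesis using False r_pos by (auto simp: T1_def T2_def)
      qed
    qed
    moreover have "T1 \<inter> T2 \<inter> C = {}"
      using CX unfolding T1_def T2_def X_def by fastforce
    moreover have "connected C" by (simp add: C_def)
    ultimately show False using connectedD[OF _ openT] iC i'C iT i'T by blast
  qed
  then show ?thesis using a0 by blast
qed

section \<open>Gluing along the ends of the saddle box\<close>

definition slab :: "real \<Rightarrow> 'a set" where
  "slab \<delta> = {z. \<forall>j. j \<noteq> k \<longrightarrow> \<bar>q j z\<bar> \<le> 2 * \<delta> / sqrt (\<kappa> j)}"

lemma closed_slab: "closed (slab \<delta> \<inter> {z. \<bar>q k z\<bar> \<le> y})"
  unfolding slab_def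
  by (intro closed_Int closed_Collect_all closed_Collect_imp closed_Collect_le continuous_intros) auto

lemma box_slab: "box \<delta> = slab \<delta> \<inter> {z. \<bar>q k z\<bar> \<le> \<delta> / sqrt (\<kappa> k)}"
  by (auto simp: box_def slab_def)

text \<open>On the set \<open>T\<close> formed by the box and the layers the function is the product \<open>F\<close>; off \<open>T\<close>
  it is \<open>G\<close> on \<open>Jm\<close> and zero elsewhere. The case distinction is invisible locally: where \<open>G\<close> does not
  vanish, a point of \<open>T\<close> is in the interior of the slab, and \<open>F\<close> already has the right values a
  little beyond the outer ends.\<close>
lemma glued_function:
  fixes G j :: "'a \<Rightarrow> real" and \<chi>m \<chi>p :: "real \<Rightarrow> real"
  assumes x: "x = \<delta> / sqrt (\<kappa> k)" "x < y" "y < 3 / 2 * x"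
    and \<delta>: "\<delta> > 0" "0 < a" "a \<le> \<delta>\<^sup>2 / 2" "a \<le> 1"
    and small: "\<And>w. (\<And>j. \<bar>q j w\<bar> \<le> 2 * \<delta> / sqrt (\<kappa> j)) \<Longrightarrow> w \<in> ball z\<^sub>0 r"
    and comp: "compact {z. H z \<le> H z\<^sub>0 + 1}"
    and J: "S = {z. H z < H z\<^sub>0 + a} - box \<delta>"
      "Jm = connected_component_set S m'" "Js = connected_component_set S s'" "Jm \<inter> Js = {}"
    and side_m: "\<And>w. H w < H z\<^sub>0 + a \<Longrightarrow> w \<in> slab \<delta> \<Longrightarrow> q k w < - x \<Longrightarrow> - (3 / 2 * x) \<le> q k w \<Longrightarrow> w \<in> Jm"
    and side_s: "\<And>w. H w < H z\<^sub>0 + a \<Longrightarrow> w \<in> slab \<delta> \<Longrightarrow> x < q k w \<Longrightarrow> q k w \<le> 3 / 2 * x \<Longrightarrow> w \<in> Js"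
    and G: "Ck 2 G" "\<And>z. 0 \<le> G z" "\<And>z. G z \<le> 1"
      "\<And>z. H z \<le> H z\<^sub>0 + a / 2 \<Longrightarrow> G z = 1" "\<And>z. H z \<ge> H z\<^sub>0 + 5 * a / 6 \<Longrightarrow> G z = 0"
    and j: "Ck 2 j" "\<And>z. 0 \<le> j z" "\<And>z. j z \<le> 1"
    and \<chi>m: "Ck 2 \<chi>m" "\<And>t. 0 \<le> \<chi>m t" "\<And>t. \<chi>m t \<le> 1" "\<And>t. - x \<le> t \<Longrightarrow> \<chi>m t = 0" "\<And>t. t \<le> - y \<Longrightarrow> \<chi>m t = 1"
    and \<chi>p: "Ck 2 \<chi>p" "\<And>t. 0 \<le> \<chi>p t" "\<And>t. \<chi>p t \<le> 1" "\<And>t. t \<le> x \<Longrightarrow> \<chi>p t = 0" "\<And>t. y \<le> t \<Longrightarrow> \<chi>p t = 1"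
    and layers: "Am = slab \<delta> \<inter> {z. - y \<le> q k z \<and> q k z \<le> - x}" "Ap = slab \<delta> \<inter> {z. x \<le> q k z \<and> q k z \<le> y}"
  obtains f where "Ck 2 f" "compact (supp f)" "range f \<subseteq> {0..1}"
    "\<forall>z\<in>Am. f z = G z * (j z + \<chi>m (q k z) * (1 - j z))"
    "\<forall>z\<in>box \<delta>. f z = G z * j z"
    "\<forall>z\<in>Ap. f z = G z * (1 - \<chi>p (q k z)) * j z"
    "\<forall>z\<in>Jm - Am. f z = G z"
    "\<forall>z\<in>Js - Ap. f z = 0"
    "\<forall>z\<in>\<Union> (components S - {Jm, Js}). f z = 0"
    "\<And>bs. bs \<noteq> [] \<Longrightarrow> supp (mpdv bs f) \<subseteq> box \<delta> \<union> Am \<union> Ap \<union> {z. H z \<ge> H z\<^sub>0 + a / 2}"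
    "\<And>z. z \<notin> ball z\<^sub>0 r \<Longrightarrow> f z = (if z \<in> Jm then G z else 0)"
proof -
  define T where "T = slab \<delta> \<inter> {z. \<bar>q k z\<bar> \<le> y}"
  define F where "F z = G z * (j z + \<chi>m (q k z) * (1 - j z)) * (1 - \<chi>p (q k z))" for z
  define f where "f z = (if z \<in> T then F z else if z \<in> Jm then G z else 0)" for z
  have x0: "0 < x" using \<delta>(1) \<kappa>_pos by (simp add: x)
  have closedT: "closed T" unfolding T_def by (rule closed_slab)
  have Tun: "T = box \<delta> \<union> Am \<union> Ap"
    using x x0 by (auto simp: T_def box_slab layers)
  have Tball: "z \<in> ball z\<^sub>0 r" if "z \<in> slab \<delta>" "\<bar>q k z\<bar> \<le> 3 / 2 * x" for z
  proof (rule small)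
    fix j
    have "\<bar>q k z\<bar> \<le> 2 * \<delta> / sqrt (\<kappa> k)" using that(2) x0 by (simp add: x(1))
    then show "\<bar>q j z\<bar> \<le> 2 * \<delta> / sqrt (\<kappa> j)"
      using that(1) by (cases "j = k") (auto simp: slab_def)
  qed
  have openS: "open S" unfolding J by (rule open_region)
  have openJ: "open Jm" "open (S - Jm)"
    unfolding J(2) by (rule open_connected_component[OF openS], rule open_Diff_component[OF openS])
  have JS: "Jm \<subseteq> S" "Js \<subseteq> S" unfolding J(2,3) by (rule connected_component_subset)+
  have through: "z \<in> Jm" if "H z < H z\<^sub>0 + a" "z \<in> slab \<delta>" "q k z < - x" "\<bar>q k z\<bar> \<le> 3 / 2 * x" for z
    using side_m that by (simp add: abs_le_iff)
  have through': "z \<in> Js" if "H z < H z\<^sub>0 + a" "z \<in> slab \<delta>" "x < q k z" "\<bar>q k z\<bar> \<le> 3 / 2 * x" for z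
    using side_s that by (simp add: abs_le_iff)
  have ends: "z \<in> Jm \<or> z \<in> Js" if "z \<in> S" "z \<in> T" for z
  proof -
    have "z \<in> slab \<delta>" "\<bar>q k z\<bar> \<le> 3 / 2 * x" "H z < H z\<^sub>0 + a" "\<not> \<bar>q k z\<bar> \<le> x"
      using that x by (auto simp: T_def J(1) box_slab)
    then show ?thesis using through[of z] through'[of z] by linarith
  qed
  have Am_Jm: "z \<in> Jm" if "z \<in> S" "z \<in> Am" for z
    using that x x0 by (intro through) (auto simp: layers J(1) box_slab)
  have Ap_Js: "z \<in> Js" if "z \<in> S" "z \<in> Ap" for z
    using that x x0 by (intro through') (auto simp: layers J(1) box_slab)
  have F_eq: "F z = f z" if "H z < H z\<^sub>0 + a" "z \<in> slab \<delta>" "\<bar>q k z\<bar> \<le> 3 / 2 * x" for z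
  proof (cases "z \<in> T")
    case False
    then have "q k z < - y \<or> y < q k z" using that by (auto simp: T_def)
    then show ?thesis
    proof
      assume "q k z < - y"
      then have "z \<in> Jm" "\<chi>m (q k z) = 1" "\<chi>p (q k z) = 0"
        using through[OF that(1,2) _ that(3)] x x0 \<chi>m(5) \<chi>p(4) by auto
      then show ?thesis using False by (simp add: f_def F_def)
    next
      assume "y < q k z"
      then have "z \<in> Js" "\<chi>p (q k z) = 1"
        using through'[OF that(1,2) _ that(3)] x x0 \<chi>p(5) by auto
      then show ?thesis using False J(4) by (auto simp: f_def F_def)
    qed
  qed (simp add: f_def)
  have Ck_q: "Ck 2 (\<lambda>z. X (q k z))" if "Ck 2 X" for X :: "real \<Rightarrow> real"
  proof (rule Ck_compose[OF that])
    have "Ck 2 (\<lambda>z. z \<bullet> E k - z\<^sub>0 \<bullet> E k)"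
      by (intro Ck_diff Ck_const Ck_bounded_linear bounded_linear_inner_left)
    then show "Ck 2 (q k)" by (simp add: q_def[abs_def] inner_diff_left)
  qed
  have CkF: "Ck 2 F"
    unfolding F_def[abs_def] by (intro Ck_mult Ck_add Ck_diff Ck_const G(1) j(1) Ck_q \<chi>m(1) \<chi>p(1))
  have f_zero: "f z = 0" if "H z \<ge> H z\<^sub>0 + 5 * a / 6" for z
    using G(5)[OF that] by (simp add: f_def F_def)
  have "Ck 2 f"
  proof (rule Ck_local)
    fix z
    show "\<exists>V g. open V \<and> z \<in> V \<and> Ck 2 g \<and> (\<forall>y\<in>V. f y = g y)"
    proof (cases "H z > H z\<^sub>0 + 5 * a / 6")
      case True
      have "open {w. H w > H z\<^sub>0 + 5 * a / 6}" by (intro open_Collect_less continuous_intros continuous_H)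
      then show ?thesis using True f_zero
        by (intro exI[of _ "{w. H w > H z\<^sub>0 + 5 * a / 6}"] exI[of _ "\<lambda>_. 0"]) auto
    next
      case False
      then have Hz: "H z < H z\<^sub>0 + a" using \<delta>(2) by simp
      show ?thesis
      proof (cases "z \<in> T")
        case True
        define V where "V = {w. H w < H z\<^sub>0 + a} \<inter> {w. \<bar>q k w\<bar> < 3 / 2 * x} \<inter>
          (\<Inter>j\<in>- {k}. {w. \<bar>q j w\<bar> < 2 * \<delta> / sqrt (\<kappa> j)})"
        have "open V"
          unfolding V_def
          by (intro open_Int open_INT open_sublevel) (auto intro!: open_Collect_less continuous_intros)
        have qz: "\<bar>q k z\<bar> < 3 / 2 * x" using True x by (auto simp: T_def)
        have "z \<in> ball z\<^sub>0 r" using Tball True qz by (auto simp: T_def)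
        then have "\<bar>q j z\<bar> < 2 * \<delta> / sqrt (\<kappa> j)" if "j \<noteq> k" for j
          using tube_strict[OF _ Hz \<delta>(1,3) _ that] qz by (simp add: x(1))
        then have "z \<in> V" using Hz qz by (simp add: V_def)
        moreover have "f w = F w" if "w \<in> V" for w
          using that F_eq[of w] by (auto simp: V_def slab_def less_imp_le)
        ultimately show ?thesis using \<open>open V\<close> CkF by (intro exI[of _ V] exI[of _ F]) blast
      next
        case zT: False
        then have zS: "z \<in> S" using Hz by (auto simp: J(1) Tun)
        show ?thesis
        proof (cases "z \<in> Jm")
          case True
          then show ?thesis using zT closedT openJ G(1)
            by (intro exI[of _ "Jm - T"] exI[of _ G]) (auto simp: f_def)
        next
          case False
          then show ?thesis using zT zS closedT openJ
            by (intro exI[of _ "(S - Jm) - T"] exI[of _ "\<lambda>_. 0"]) (auto simp: f_def)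
        qed
      qed
    qed
  qed
  moreover have "compact (supp f)"
  proof -
    have "supp f \<subseteq> {z. H z \<le> H z\<^sub>0 + 1}"
    proof (rule supp_subsetI)
      show "closed {z. H z \<le> H z\<^sub>0 + 1}" using comp by (rule compact_imp_closed)
      show "f z = 0" if "z \<notin> {z. H z \<le> H z\<^sub>0 + 1}" for z
        using that \<delta> by (intro f_zero) auto
    qed
    moreover have "closed (supp f)" by (simp add: supp_def)
    ultimately show ?thesis using comp compact_Int_closed[OF comp] by (metis inf.absorb_iff2)
  qed
  moreover have "range f \<subseteq> {0..1}"
  proof -
    have "0 \<le> F z \<and> F z \<le> 1" for z
    proof -
      have "j z + \<chi>m (q k z) * (1 - j z) \<le> j z + 1 * (1 - j z)"
        using j \<chi>m by (intro add_left_mono mult_right_mono) auto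
      then have "j z + \<chi>m (q k z) * (1 - j z) \<le> 1" by simp
      moreover have "0 \<le> j z + \<chi>m (q k z) * (1 - j z)" using j \<chi>m by simp
      moreover have "0 \<le> 1 - \<chi>p (q k z)" "1 - \<chi>p (q k z) \<le> 1" using \<chi>p by auto
      ultimately show ?thesis unfolding F_def using G by (auto intro!: mult_le_one)
    qed
    then show ?thesis using G by (auto simp: f_def)
  qed
  moreover have "\<forall>z\<in>Am. f z = G z * (j z + \<chi>m (q k z) * (1 - j z))"
    using Tun \<chi>p(4) x0 by (auto simp: f_def F_def layers)
  moreover have "\<forall>z\<in>box \<delta>. f z = G z * j z"
    using Tun \<chi>p(4) \<chi>m(4) by (auto simp: f_def F_def box_slab abs_le_iff x(1))
  moreover have "\<forall>z\<in>Ap. f z = G z * (1 - \<chi>p (q k z)) * j z"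
    using Tun \<chi>m(4) x0 by (auto simp: f_def F_def layers)
  moreover have "\<forall>z\<in>Jm - Am. f z = G z"
    using JS J(4) Tun Ap_Js by (auto simp: f_def J(1))
  moreover have "\<forall>z\<in>Js - Ap. f z = 0"
    using JS J(4) Tun Am_Jm by (auto simp: f_def J(1))
  moreover have "\<forall>z\<in>\<Union> (components S - {Jm, Js}). f z = 0"
  proof
    fix z assume "z \<in> \<Union> (components S - {Jm, Js})"
    then obtain C where C: "C \<in> components S" "z \<in> C" "C \<noteq> Jm" "C \<noteq> Js" by blast
    then have "z \<in> S" "C = connected_component_set S z"
      using in_components_subset by (blast, metis components_iff connected_component_eq)
    then have "z \<notin> Jm" "z \<notin> Js" using C connected_component_eq unfolding J(2,3) by metis+
    then show "f z = 0" using ends \<open>z \<in> S\<close> by (auto simp: f_def)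
  qed
  moreover have "supp (mpdv bs f) \<subseteq> box \<delta> \<union> Am \<union> Ap \<union> {z. H z \<ge> H z\<^sub>0 + a / 2}" if "bs \<noteq> []" for bs
    unfolding Tun[symmetric]
  proof (rule supp_subsetI)
    show "closed (T \<union> {z. H z \<ge> H z\<^sub>0 + a / 2})"
      by (intro closed_Un closedT closed_Collect_le continuous_intros continuous_H)
    fix z assume "z \<notin> T \<union> {z. H z \<ge> H z\<^sub>0 + a / 2}"
    then have z: "z \<notin> T" "H z < H z\<^sub>0 + a / 2" by auto
    define B where "B = {z. H z < H z\<^sub>0 + a / 2} - T"
    have B: "open B" "z \<in> B" unfolding B_def using z by (auto intro!: open_Diff closedT open_sublevel)
    have BS: "B \<subseteq> S" using Tun \<delta> by (auto simp: B_def J(1))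
    show "mpdv bs f z = 0"
    proof (cases "z \<in> Jm")
      case True
      have "mpdv bs f z = mpdv bs (\<lambda>_. 1) z"
        by (rule mpdv_cong_open[of "B \<inter> Jm"]) (use True B openJ G(4) in \<open>auto simp: f_def B_def\<close>)
      then show ?thesis using that by (simp add: mpdv_const)
    next
      case False
      have "mpdv bs f z = mpdv bs (\<lambda>_. 0) z"
        by (rule mpdv_cong_open[of "B \<inter> (S - Jm)"])
          (use False B BS openJ in \<open>auto simp: f_def B_def\<close>)
      then show ?thesis using that by (simp add: mpdv_const)
    qed
  qed
  moreover have "f z = (if z \<in> Jm then G z else 0)" if "z \<notin> ball z\<^sub>0 r" for z
  proof -
    have "z \<notin> T" using Tball[of z] that x by (auto simp: T_def)
    then show ?thesis by (simp add: f_def)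
  qed
  ultimately show thesis by (rule that)
qed

end

section \<open>Second-order behaviour of the potential at the saddle\<close>

lemma pdv_grad:
  fixes U :: "real^'d \<Rightarrow> real"
  assumes "U differentiable (at x)"
  shows "pdv h U x = grad U x \<bullet> h"
proof -
  have lin: "linear (\<lambda>b. pdv b U x)"
    by (rule has_derivative_linear[OF differentiable_has_pdv[OF assms]])
  have "h = (\<Sum>i\<in>UNIV. h $ i *\<^sub>R axis i 1)"
    using basis_expansion[of h] by (simp add: scalar_mult_eq_scaleR)
  then have "pdv h U x = pdv (\<Sum>i\<in>UNIV. h $ i *\<^sub>R axis i 1) U x" by simp
  also have "\<dots> = (\<Sum>i\<in>UNIV. h $ i * pdv (axis i 1) U x)"
    by (simp add: linear_sum[OF lin] linear_scale[OF lin])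
  finally show ?thesis by (simp add: grad_def inner_vec_def mult.commute)
qed

lemma has_derivative_along_line:
  fixes f :: "'a::euclidean_space \<Rightarrow> real"
  assumes "f differentiable (at (x + t *\<^sub>R h))"
  shows "((\<lambda>t. f (x + t *\<^sub>R h)) has_real_derivative pdv h f (x + t *\<^sub>R h)) (at t)"
proof -
  have lin: "linear (\<lambda>b. pdv b f (x + t *\<^sub>R h))"
    by (rule has_derivative_linear[OF differentiable_has_pdv[OF assms]])
  have "((\<lambda>t. x + t *\<^sub>R h) has_derivative (\<lambda>s. s *\<^sub>R h)) (at t)"
    by (auto intro!: derivative_eq_intros)
  from has_derivative_compose[OF this differentiable_has_pdv[OF assms]]
  show ?thesis
    by (simp add: has_field_derivative_def linear_scale[OF lin] mult_commute_abs)
qed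

lemma grad_along_line:
  fixes U :: "real^'d \<Rightarrow> real"
  assumes "smooth U"
  shows "((\<lambda>t. U (x + t *\<^sub>R h)) has_real_derivative grad U (x + t *\<^sub>R h) \<bullet> h) (at t)"
    and "((\<lambda>t. grad U (x + t *\<^sub>R h) \<bullet> h) has_real_derivative
           h \<bullet> (hessian U (x + t *\<^sub>R h) *v h)) (at t)"
proof -
  show "((\<lambda>t. U (x + t *\<^sub>R h)) has_real_derivative grad U (x + t *\<^sub>R h) \<bullet> h) (at t)"
    using has_derivative_along_line[OF smooth_differentiable[OF assms]]
    by (simp add: pdv_grad smooth_differentiable[OF assms])
  have sm: "smooth (pdv (axis j 1) U)" for j by (intro smooth_pdv assms) simp
  have "((\<lambda>t. \<Sum>j\<in>UNIV. h $ j * pdv (axis j 1) U (x + t *\<^sub>R h)) has_real_derivative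
      (\<Sum>j\<in>UNIV. h $ j * pdv h (pdv (axis j 1) U) (x + t *\<^sub>R h))) (at t)"
    by (intro DERIV_sum DERIV_cmult has_derivative_along_line smooth_differentiable sm)
  moreover have "(\<Sum>j\<in>UNIV. h $ j * pdv h (pdv (axis j 1) U) y) = h \<bullet> (hessian U y *v h)" for y
  proof -
    have "pdv h (pdv (axis j 1) U) y = (\<Sum>i\<in>UNIV. pdv (axis i 1) (pdv (axis j 1) U) y * h $ i)" for j
      using pdv_grad[OF smooth_differentiable[OF sm], of h] by (simp add: grad_def inner_vec_def)
    then have "(\<Sum>j\<in>UNIV. h $ j * pdv h (pdv (axis j 1) U) y) =
        (\<Sum>j\<in>UNIV. \<Sum>i\<in>UNIV. h $ j * (pdv (axis i 1) (pdv (axis j 1) U) y * h $ i))"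
      by (simp only: sum_distrib_left)
    also have "\<dots> = (\<Sum>i\<in>UNIV. \<Sum>j\<in>UNIV. h $ j * (pdv (axis i 1) (pdv (axis j 1) U) y * h $ i))"
      by (rule sum.swap)
    also have "\<dots> = h \<bullet> (hessian U y *v h)"
      by (auto simp: inner_vec_def matrix_vector_mult_def hessian_def sum_distrib_left
          intro!: sum.cong)
    finally show ?thesis .
  qed
  ultimately show "((\<lambda>t. grad U (x + t *\<^sub>R h) \<bullet> h) has_real_derivative
           h \<bullet> (hessian U (x + t *\<^sub>R h) *v h)) (at t)"
    by (simp add: grad_def inner_vec_def mult.commute)
qed

lemma hessian_nearby:
  fixes U :: "real^'d \<Rightarrow> real"
  assumes "smooth U" "\<eta> > 0"
  shows "\<exists>r>0. \<forall>\<theta>\<in>ball \<sigma> r. \<forall>h.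
    \<bar>h \<bullet> (hessian U \<theta> *v h) - h \<bullet> (hessian U \<sigma> *v h)\<bar> \<le> \<eta> * (norm h)\<^sup>2"
proof -
  define D where "D \<theta> = (\<Sum>i\<in>UNIV. \<Sum>j\<in>UNIV. \<bar>hessian U \<theta> $ i $ j - hessian U \<sigma> $ i $ j\<bar>)" for \<theta>
  have sm: "smooth (mpdv [axis i 1, axis j 1] U)" for i j by (intro smooth_mpdv assms) auto
  then have "continuous_on UNIV (\<lambda>\<theta>. hessian U \<theta> $ i $ j)" for i j
    using smooth_continuous[OF sm] by (simp add: hessian_def)
  then have "continuous_on UNIV D"
    unfolding D_def
    by (intro continuous_on_sum continuous_on_rabs continuous_on_diff continuous_on_const)
  then have "open {\<theta>. D \<theta> < \<eta>}" by (intro open_Collect_less continuous_intros)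
  moreover have "D \<sigma> < \<eta>" using assms by (simp add: D_def)
  ultimately obtain r where r: "r > 0" "\<And>\<theta>. \<theta> \<in> ball \<sigma> r \<Longrightarrow> D \<theta> < \<eta>"
    using open_contains_ball[of "{\<theta>. D \<theta> < \<eta>}"] by blast
  have "\<bar>h \<bullet> (hessian U \<theta> *v h) - h \<bullet> (hessian U \<sigma> *v h)\<bar> \<le> \<eta> * (norm h)\<^sup>2" if "\<theta> \<in> ball \<sigma> r" for \<theta> h
  proof -
    have "h \<bullet> (hessian U \<theta> *v h) - h \<bullet> (hessian U \<sigma> *v h) =
        (\<Sum>i\<in>UNIV. \<Sum>j\<in>UNIV. h $ i * ((hessian U \<theta> $ i $ j - hessian U \<sigma> $ i $ j) * h $ j))"
      by (simp add: inner_vec_def matrix_vector_mult_def sum_distrib_left sum_subtractf algebra_simps)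
    also have "\<bar>\<dots>\<bar> \<le> (\<Sum>i\<in>UNIV. \<Sum>j\<in>UNIV. \<bar>h $ i * ((hessian U \<theta> $ i $ j - hessian U \<sigma> $ i $ j) * h $ j)\<bar>)"
      by (intro order_trans[OF sum_abs] sum_mono sum_abs)
    also have "\<dots> \<le> (\<Sum>i\<in>UNIV. \<Sum>j\<in>UNIV. \<bar>hessian U \<theta> $ i $ j - hessian U \<sigma> $ i $ j\<bar> * (norm h)\<^sup>2)"
    proof (intro sum_mono)
      fix i j
      have "\<bar>h $ i\<bar> * \<bar>h $ j\<bar> \<le> norm h * norm h"
        by (intro mult_mono component_le_norm_cart) auto
      then have "\<bar>hessian U \<theta> $ i $ j - hessian U \<sigma> $ i $ j\<bar> * (\<bar>h $ i\<bar> * \<bar>h $ j\<bar>) \<le>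
          \<bar>hessian U \<theta> $ i $ j - hessian U \<sigma> $ i $ j\<bar> * (norm h * norm h)"
        by (intro mult_left_mono) auto
      then show "\<bar>h $ i * ((hessian U \<theta> $ i $ j - hessian U \<sigma> $ i $ j) * h $ j)\<bar> \<le>
          \<bar>hessian U \<theta> $ i $ j - hessian U \<sigma> $ i $ j\<bar> * (norm h)\<^sup>2"
        by (simp add: abs_mult power2_eq_square mult_ac)
    qed
    also have "\<dots> = D \<theta> * (norm h)\<^sup>2" by (simp add: D_def sum_distrib_right)
    also have "\<dots> \<le> \<eta> * (norm h)\<^sup>2" using r(2)[OF that] by (intro mult_right_mono) auto
    finally show ?thesis .
  qed
  then show ?thesis using r(1) by blast
qed

lemma orthonormal_family_expansion:
  fixes e :: "'d::finite \<Rightarrow> real^'d"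
  assumes e: "\<And>i j. e i \<bullet> e j = (if i = j then 1 else 0)"
  shows "(\<Sum>i\<in>UNIV. (h \<bullet> e i) *\<^sub>R e i) = h" and "(norm h)\<^sup>2 = (\<Sum>i\<in>UNIV. (h \<bullet> e i)\<^sup>2)"
proof -
  have inj: "inj e"
  proof
    fix i j assume "e i = e j"
    then show "i = j" using e[of i j] e[of i i] by (auto split: if_splits)
  qed
  have po: "pairwise orthogonal (range e)"
    using e by (auto simp: pairwise_def orthogonal_def)
  have "0 \<notin> range e" using e by (metis imageE inner_zero_left zero_neq_one)
  then have "independent (range e)" using po pairwise_orthogonal_independent by blast
  moreover have "card (range e) = DIM(real^'d)" using inj by (simp add: card_image)
  ultimately have "span (range e) = UNIV"
    using card_ge_dim_independent[of "range e" UNIV] by auto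
  moreover have "norm i = 1" if "i \<in> range e" for i using that e by (auto simp: norm_eq_1)
  ultimately have "(\<Sum>i\<in>range e. (h \<bullet> i) *\<^sub>R i) = h"
    by (intro orthonormal_basis_expand[OF po]) auto
  then show *: "(\<Sum>i\<in>UNIV. (h \<bullet> e i) *\<^sub>R e i) = h"
    using sum.reindex[OF inj, of "\<lambda>i. (h \<bullet> i) *\<^sub>R i"] by simp
  have "(norm h)\<^sup>2 = h \<bullet> (\<Sum>i\<in>UNIV. (h \<bullet> e i) *\<^sub>R e i)" unfolding * by (simp add: dot_square_norm)
  then show "(norm h)\<^sup>2 = (\<Sum>i\<in>UNIV. (h \<bullet> e i)\<^sup>2)" by (simp add: inner_sum_right power2_eq_square)
qed

lemma eigenframe_quadratic_form:
  fixes e :: "'d::finite \<Rightarrow> real^'d" and A :: "real^'d^'d"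
  assumes e: "\<And>i j. e i \<bullet> e j = (if i = j then 1 else 0)" and A: "\<And>i. A *v e i = c i *\<^sub>R e i"
  shows "h \<bullet> (A *v h) = (\<Sum>i\<in>UNIV. c i * (h \<bullet> e i)\<^sup>2)"
proof -
  have "A *v h = A *v (\<Sum>i\<in>UNIV. (h \<bullet> e i) *\<^sub>R e i)"
    by (simp add: orthonormal_family_expansion(1)[OF e])
  also have "\<dots> = (\<Sum>i\<in>UNIV. (h \<bullet> e i) *\<^sub>R c i *\<^sub>R e i)"
    by (simp only: linear_sum[OF matrix_vector_mul_linear] matrix_vector_mult_scaleR A)
  finally show ?thesis by (simp add: inner_sum_right power2_eq_square mult_ac)
qed

text \<open>In a ball where the Hessian differs from its value at the saddle by at most a tenth of the smallest
  \<open>lam i\<close>, its quadratic form lies between the diagonal forms with eigenvalues changed by ten percent.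
  The second-order Taylor formula gives the first two claims, with \<open>11/20\<close> and \<open>9/20\<close> equal to half
  of \<open>11/10\<close> and \<open>9/10\<close>; the third is positivity of the form orthogonally to \<open>e k\<close>.\<close>
lemma potential_near_saddle:
  fixes U :: "real^'d \<Rightarrow> real" and e :: "'d \<Rightarrow> real^'d"
  assumes U: "smooth U" "grad U \<sigma> = 0"
    and e: "\<And>i j. e i \<bullet> e j = (if i = j then 1 else 0)" and lam: "\<And>i. lam i > 0"
    and ek: "hessian U \<sigma> *v e k = - lam k *\<^sub>R e k"
    and ei: "\<And>i. i \<noteq> k \<Longrightarrow> hessian U \<sigma> *v e i = lam i *\<^sub>R e i"
  shows "\<exists>r>0.
    (\<forall>\<theta>\<in>ball \<sigma> r. U \<theta> - U \<sigma> \<ge> - (11 / 20) * lam k * ((\<theta> - \<sigma>) \<bullet> e k)\<^sup>2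
        + (9 / 20) * (\<Sum>i\<in>- {k}. lam i * ((\<theta> - \<sigma>) \<bullet> e i)\<^sup>2)) \<and>
    (\<forall>x. \<bar>x\<bar> < r \<longrightarrow> x \<noteq> 0 \<longrightarrow> U (\<sigma> + x *\<^sub>R e k) < U \<sigma>) \<and>
    (\<forall>\<theta>\<in>ball \<sigma> r. \<forall>t\<in>{0..1}. \<forall>w. w = \<sigma> + ((\<theta> - \<sigma>) \<bullet> e k) *\<^sub>R e k \<longrightarrow>
       U (w + t *\<^sub>R (\<theta> - w)) \<le> (1 - t) * U w + t * U \<theta>)"
proof -
  define \<eta> where "\<eta> = Min (range lam) / 10"
  have "Min (range lam) > 0" using lam by (subst Min_gr_iff) auto
  then have \<eta>: "\<eta> > 0" "\<And>i. \<eta> \<le> lam i / 10" by (auto simp: \<eta>_def)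
  obtain r where r: "r > 0" "\<And>\<theta> h. \<theta> \<in> ball \<sigma> r \<Longrightarrow>
      \<bar>h \<bullet> (hessian U \<theta> *v h) - h \<bullet> (hessian U \<sigma> *v h)\<bar> \<le> \<eta> * (norm h)\<^sup>2"
    using hessian_nearby[OF U(1) \<eta>(1)] by blast
  have quad: "h \<bullet> (hessian U \<sigma> *v h) = - lam k * (h \<bullet> e k)\<^sup>2 + (\<Sum>i\<in>- {k}. lam i * (h \<bullet> e i)\<^sup>2)" for h
  proof -
    have "h \<bullet> (hessian U \<sigma> *v h) = (\<Sum>i\<in>UNIV. (if i = k then - lam k else lam i) * (h \<bullet> e i)\<^sup>2)"
      by (rule eigenframe_quadratic_form[OF e]) (use ek ei in auto)
    also have "\<dots> = - lam k * (h \<bullet> e k)\<^sup>2 + (\<Sum>i\<in>UNIV - {k}. (if i = k then - lam k else lam i) * (h \<bullet> e i)\<^sup>2)"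
      by (subst sum.remove[of _ k]) auto
    finally show ?thesis by (simp add: Compl_eq_Diff_UNIV)
  qed
  have nrm: "\<eta> * (norm h)\<^sup>2 \<le> lam k / 10 * (h \<bullet> e k)\<^sup>2 + (\<Sum>i\<in>- {k}. lam i * (h \<bullet> e i)\<^sup>2) / 10" for h
  proof -
    have "\<eta> * (norm h)\<^sup>2 = (\<Sum>i\<in>UNIV. \<eta> * (h \<bullet> e i)\<^sup>2)"
      by (simp add: orthonormal_family_expansion(2)[OF e] sum_distrib_left)
    also have "\<dots> \<le> (\<Sum>i\<in>UNIV. lam i / 10 * (h \<bullet> e i)\<^sup>2)"
      by (intro sum_mono mult_right_mono \<eta>) auto
    also have "\<dots> = lam k / 10 * (h \<bullet> e k)\<^sup>2 + (\<Sum>i\<in>UNIV - {k}. lam i / 10 * (h \<bullet> e i)\<^sup>2)"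
      by (subst sum.remove[of _ k]) auto
    finally show ?thesis by (simp add: Compl_eq_Diff_UNIV sum_divide_distrib)
  qed
  have taylor: "\<exists>\<tau>. 0 < \<tau> \<and> \<tau> < 1 \<and> U (\<sigma> + h) = U \<sigma> + h \<bullet> (hessian U (\<sigma> + \<tau> *\<^sub>R h) *v h) / 2" for h
  proof -
    define D where "D = (\<lambda>n::nat. \<lambda>t. if n = 0 then U (\<sigma> + t *\<^sub>R h)
      else if n = 1 then grad U (\<sigma> + t *\<^sub>R h) \<bullet> h else h \<bullet> (hessian U (\<sigma> + t *\<^sub>R h) *v h))"
    have "\<forall>m t. m < 2 \<and> 0 \<le> t \<and> t \<le> 1 \<longrightarrow> (D m has_real_derivative D (Suc m) t) (at t)"
      using grad_along_line[OF U(1), of \<sigma> h] by (auto simp: D_def less_2_cases_iff)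
    then obtain \<tau> where "0 < \<tau>" "\<tau> < 1"
      "D 0 1 = (\<Sum>m<2. D m 0 / fact m * 1 ^ m) + D 2 \<tau> / fact 2 * 1 ^ 2"
      using Maclaurin[of 1 2 D "D 0"] by auto
    then show ?thesis using U(2) by (auto simp: D_def numeral_2_eq_2 intro!: exI[of _ \<tau>])
  qed
  have near: "\<sigma> + \<tau> *\<^sub>R h \<in> ball \<sigma> r" if "norm h < r" "0 \<le> \<tau>" "\<tau> \<le> 1" for \<tau> h
  proof -
    have "\<tau> * norm h \<le> norm h" using that by (simp add: mult_left_le_one_le)
    then show ?thesis using that by (simp add: dist_norm)
  qed
  have "U \<theta> - U \<sigma> \<ge> - (11 / 20) * lam k * ((\<theta> - \<sigma>) \<bullet> e k)\<^sup>2
        + (9 / 20) * (\<Sum>i\<in>- {k}. lam i * ((\<theta> - \<sigma>) \<bullet> e i)\<^sup>2)" if "\<theta> \<in> ball \<sigma> r" for \<theta>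
  proof -
    define h where "h = \<theta> - \<sigma>"
    have h: "norm h < r" using that by (simp add: h_def dist_norm norm_minus_commute)
    obtain \<tau> where \<tau>: "0 < \<tau>" "\<tau> < 1"
      "U (\<sigma> + h) = U \<sigma> + h \<bullet> (hessian U (\<sigma> + \<tau> *\<^sub>R h) *v h) / 2" using taylor by blast
    have "U \<theta> = U \<sigma> + h \<bullet> (hessian U (\<sigma> + \<tau> *\<^sub>R h) *v h) / 2" using \<tau>(3) by (simp add: h_def)
    then show ?thesis
      using r(2)[OF near[OF h, of \<tau>], of h] \<tau>(1,2) quad[of h] nrm[of h] unfolding h_def[symmetric]
      by (simp add: abs_le_iff)
  qed
  moreover have "U (\<sigma> + x *\<^sub>R e k) < U \<sigma>" if x: "\<bar>x\<bar> < r" "x \<noteq> 0" for x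
  proof -
    define h where "h = x *\<^sub>R e k"
    have "norm (e k) = 1" using e by (simp add: norm_eq_1)
    then have h: "norm h < r" using x by (simp add: h_def)
    have he: "h \<bullet> e i = (if i = k then x else 0)" for i using e by (simp add: h_def)
    obtain \<tau> where \<tau>: "0 < \<tau>" "\<tau> < 1"
      "U (\<sigma> + h) = U \<sigma> + h \<bullet> (hessian U (\<sigma> + \<tau> *\<^sub>R h) *v h) / 2" using taylor by blast
    have "h \<bullet> (hessian U (\<sigma> + \<tau> *\<^sub>R h) *v h) \<le> - (9 / 10) * (lam k * x\<^sup>2)"
      using r(2)[OF near[OF h, of \<tau>], of h] \<tau>(1,2) quad[of h] nrm[of h] by (simp add: he abs_le_iff)
    moreover have "lam k * x\<^sup>2 > 0" using lam x by simp
    ultimately show ?thesis using \<tau>(3) by (simp add: h_def)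
  qed
  moreover have "U (w + t *\<^sub>R (\<theta> - w)) \<le> (1 - t) * U w + t * U \<theta>"
    if \<theta>: "\<theta> \<in> ball \<sigma> r" and t: "t \<in> {0..1}" and w: "w = \<sigma> + ((\<theta> - \<sigma>) \<bullet> e k) *\<^sub>R e k" for \<theta> t w
  proof -
    define y where "y = \<theta> - w"
    have yk: "y \<bullet> e k = 0" using e by (simp add: y_def w inner_simps)
    have "norm (e k) = 1" using e by (simp add: norm_eq_1)
    then have "dist \<sigma> w \<le> dist \<sigma> \<theta>"
      using Cauchy_Schwarz_ineq2[of "\<theta> - \<sigma>" "e k"] by (simp add: w dist_norm norm_minus_commute)
    then have wb: "w \<in> ball \<sigma> r" using \<theta> by simp
    have line: "w + s *\<^sub>R y \<in> ball \<sigma> r" if "s \<in> {0..1}" for s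
    proof -
      have "w + s *\<^sub>R y = (1 - s) *\<^sub>R w + s *\<^sub>R \<theta>" by (simp add: y_def algebra_simps)
      moreover have "(1 - s) *\<^sub>R w + s *\<^sub>R \<theta> \<in> ball \<sigma> r"
        using convexD[OF convex_ball wb \<theta>, of "1 - s" s] that by simp
      ultimately show ?thesis by simp
    qed
    have "convex_on {0..1} (\<lambda>s. U (w + s *\<^sub>R y))"
    proof (rule f''_ge0_imp_convex)
      show "((\<lambda>s. U (w + s *\<^sub>R y)) has_real_derivative grad U (w + s *\<^sub>R y) \<bullet> y) (at s)" for s
        by (rule grad_along_line[OF U(1)])
      show "((\<lambda>s. grad U (w + s *\<^sub>R y) \<bullet> y) has_real_derivative
          y \<bullet> (hessian U (w + s *\<^sub>R y) *v y)) (at s)" for s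
        by (rule grad_along_line[OF U(1)])
      show "y \<bullet> (hessian U (w + s *\<^sub>R y) *v y) \<ge> 0" if "s \<in> {0..1}" for s
      proof -
        have "(\<Sum>i\<in>- {k}. lam i * (y \<bullet> e i)\<^sup>2) \<ge> 0" using lam by (intro sum_nonneg) (simp add: less_imp_le)
        then show ?thesis using r(2)[OF line[OF that], of y] quad[of y] nrm[of y] by (simp add: yk abs_le_iff)
      qed
    qed auto
    from convex_onD[OF this, of t 0 1] show ?thesis using t by (simp add: y_def)
  qed
  ultimately show ?thesis using r(1) by blast
qed

section \<open>The Hamiltonian as a saddle chart on phase space\<close>

lemma Ham_saddle [simp]: "Ham U L (\<theta>, 0, 0) = U \<theta>"
  by (simp add: Ham_def)

lemma smooth_Ham:
  assumes "smooth U"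
  shows "smooth (Ham U L)"
proof -
  have "Ck n (Ham U L)" for n
  proof -
    have sq: "Ck n (\<lambda>z. (norm (f z))\<^sup>2)" if "bounded_linear f" for f :: "'a phase \<Rightarrow> real^'a"
    proof -
      have "Ck n (\<lambda>z. \<Sum>b\<in>Basis. (f z \<bullet> b) * (f z \<bullet> b))"
        by (intro Ck_sum Ck_mult Ck_bounded_linear bounded_linear_compose[OF bounded_linear_inner_left that])
      moreover have "(norm y)\<^sup>2 = (\<Sum>b\<in>Basis. (y \<bullet> b) * (y \<bullet> b))" for y :: "real^'a"
        by (simp add: power2_norm_eq_inner euclidean_inner[of y y])
      ultimately show ?thesis by simp
    qed
    have "Ck n (\<lambda>z::'a phase. U (fst z) + L / 2 * (norm (fst (snd z)))\<^sup>2 + L / 2 * (norm (snd (snd z)))\<^sup>2)"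
      using assms unfolding smooth_def
      by (intro Ck_add Ck_mult Ck_const sq Ck_compose_fst bounded_linear_fst_comp bounded_linear_snd_comp
          bounded_linear_fst bounded_linear_snd) auto
    moreover have "Ham U L = (\<lambda>z. U (fst z) + L / 2 * (norm (fst (snd z)))\<^sup>2 + L / 2 * (norm (snd (snd z)))\<^sup>2)"
      by (auto simp: Ham_def fun_eq_iff)
    ultimately show ?thesis by simp
  qed
  then show ?thesis by (simp add: smooth_def)
qed

lemma compact_Ham_sublevel:
  fixes U :: "real^'d \<Rightarrow> real"
  assumes "L > 0" "smooth U" "\<And>\<theta>. U \<theta> \<ge> 0" "\<And>c. compact {\<theta>. U \<theta> \<le> c}"
  shows "compact {z. Ham U L z \<le> c}"
proof -
  obtain B where B: "\<And>\<theta>. U \<theta> \<le> c \<Longrightarrow> norm \<theta> \<le> B"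
    using compact_imp_bounded[OF assms(4)[of c]] unfolding bounded_iff by blast
  have "closed {z. Ham U L z \<le> c}"
    by (intro closed_Collect_le smooth_continuous smooth_Ham assms continuous_intros)
  moreover have "{z. Ham U L z \<le> c} \<subseteq> cball 0 B \<times> cball 0 (sqrt (2 * c / L)) \<times> cball 0 (sqrt (2 * c / L))"
  proof
    fix z assume "z \<in> {z. Ham U L z \<le> c}"
    moreover obtain \<theta> p r where z: "z = (\<theta>, p, r)" by (metis prod_cases3)
    ultimately have le: "U \<theta> + L / 2 * (norm p)\<^sup>2 + L / 2 * (norm r)\<^sup>2 \<le> c" by (simp add: Ham_def)
    have nn: "0 \<le> L / 2 * (norm p)\<^sup>2" "0 \<le> L / 2 * (norm r)\<^sup>2" using assms(1) by auto
    have "U \<theta> \<le> c" "L / 2 * (norm p)\<^sup>2 \<le> c" "L / 2 * (norm r)\<^sup>2 \<le> c"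
      using le nn assms(3)[of \<theta>] by linarith+
    then have "norm \<theta> \<le> B" "(norm p)\<^sup>2 \<le> 2 * c / L" "(norm r)\<^sup>2 \<le> 2 * c / L"
      using B assms(1) by (auto simp: field_simps)
    then show "z \<in> cball 0 B \<times> cball 0 (sqrt (2 * c / L)) \<times> cball 0 (sqrt (2 * c / L))"
      by (simp add: z real_le_rsqrt)
  qed
  moreover have "compact (cball 0 B \<times> cball 0 (sqrt (2 * c / L)) \<times> cball 0 (sqrt (2 * c / L)) :: 'd phase set)"
    by (intro compact_Times compact_cball)
  ultimately show ?thesis by (metis compact_Int_closed inf.absorb_iff2)
qed

text \<open>The index type \<open>'d + 'd + 'd\<close> lists the position, momentum and auxiliary coordinates; the momentum
  and auxiliary directions have eigenvalue \<open>L\<close>.\<close>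
definition phase_frame :: "('d \<Rightarrow> real^'d) \<Rightarrow> 'd + 'd + 'd \<Rightarrow> 'd phase" where
  "phase_frame e = case_sum (\<lambda>i. (e i, 0, 0)) (case_sum (\<lambda>i. (0, e i, 0)) (\<lambda>i. (0, 0, e i)))"

definition stiffness :: "('d \<Rightarrow> real) \<Rightarrow> real \<Rightarrow> 'd + 'd + 'd \<Rightarrow> real" where
  "stiffness lam L = case_sum lam (\<lambda>_. L)"

lemma frame_simps [simp]:
  "phase_frame e (Inl i) = (e i, 0, 0)" "phase_frame e (Inr (Inl i)) = (0, e i, 0)"
  "phase_frame e (Inr (Inr i)) = (0, 0, e i)"
  "stiffness lam L (Inl i) = lam i" "stiffness lam L (Inr j) = L"
  by (simp_all add: phase_frame_def stiffness_def)

lemma all_triple: "(\<forall>j::'d + 'd + 'd. P j) \<longleftrightarrow>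
    (\<forall>i. P (Inl i)) \<and> (\<forall>i. P (Inr (Inl i))) \<and> (\<forall>i. P (Inr (Inr i)))"
  by (metis obj_sumE)

lemma sum_triple:
  fixes f :: "'d::finite + 'd + 'd \<Rightarrow> real"
  shows "(\<Sum>j\<in>UNIV. f j) = (\<Sum>i\<in>UNIV. f (Inl i)) + ((\<Sum>i\<in>UNIV. f (Inr (Inl i))) + (\<Sum>i\<in>UNIV. f (Inr (Inr i))))"
  by (simp add: UNIV_Plus_UNIV[symmetric] sum.Plus del: UNIV_Plus_UNIV)

lemma sum_triple_Compl:
  fixes f :: "'d::finite + 'd + 'd \<Rightarrow> real"
  shows "(\<Sum>j\<in>- {Inl k}. f j) =
    (\<Sum>i\<in>- {k}. f (Inl i)) + ((\<Sum>i\<in>UNIV. f (Inr (Inl i))) + (\<Sum>i\<in>UNIV. f (Inr (Inr i))))"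
  using sum_triple[of f] sum.remove[of UNIV "Inl k" f] sum.remove[of UNIV k "\<lambda>i. f (Inl i)"]
  by (simp add: Compl_eq_Diff_UNIV)

lemma phase_saddle_chart:
  fixes U :: "real^'d \<Rightarrow> real" and e :: "'d \<Rightarrow> real^'d"
  assumes "L > 0" and U: "smooth U"
    and e: "\<And>i j. e i \<bullet> e j = (if i = j then 1 else 0)" and lam: "\<And>i. lam i > 0" and r: "r > 0"
    and lower: "\<And>\<theta>. \<theta> \<in> ball \<sigma> r \<Longrightarrow> U \<theta> - U \<sigma> \<ge> - (11 / 20) * lam k * ((\<theta> - \<sigma>) \<bullet> e k)\<^sup>2
        + (9 / 20) * (\<Sum>i\<in>- {k}. lam i * ((\<theta> - \<sigma>) \<bullet> e i)\<^sup>2)"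
    and axis: "\<And>x. \<bar>x\<bar> < r \<Longrightarrow> x \<noteq> 0 \<Longrightarrow> U (\<sigma> + x *\<^sub>R e k) < U \<sigma>"
    and segment: "\<And>\<theta> t w. \<theta> \<in> ball \<sigma> r \<Longrightarrow> t \<in> {0..1} \<Longrightarrow> w = \<sigma> + ((\<theta> - \<sigma>) \<bullet> e k) *\<^sub>R e k \<Longrightarrow>
       U (w + t *\<^sub>R (\<theta> - w)) \<le> (1 - t) * U w + t * U \<theta>"
  shows "saddle_chart (Ham U L) (\<sigma>, 0, 0) (phase_frame e) (stiffness lam L) (Inl k) r"
proof
  show "continuous_on UNIV (Ham U L)" by (intro smooth_continuous smooth_Ham U)
  show "phase_frame e i \<bullet> phase_frame e j = (if i = j then 1 else 0)" for i j
    by (cases i; cases j; auto split: sum.splits simp: phase_frame_def e)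
  show "(norm y)\<^sup>2 = (\<Sum>j\<in>UNIV. (y \<bullet> phase_frame e j)\<^sup>2)" for y :: "'d phase"
    by (cases y) (simp add: sum_triple norm_Pair orthonormal_family_expansion(2)[OF e, symmetric])
  show "stiffness lam L j > 0" for j using assms(1) lam by (cases j) auto
  show "r > 0" by (rule r)
  show "Ham U L ((\<sigma>, 0, 0) + x *\<^sub>R phase_frame e (Inl k)) < Ham U L (\<sigma>, 0, 0)" if "\<bar>x\<bar> < r" "x \<noteq> 0" for x
    using axis[OF that] by simp
  fix z :: "'d phase" assume z: "z \<in> ball (\<sigma>, 0, 0) r"
  obtain \<theta> p s where zeq: "z = (\<theta>, p, s)" by (metis prod_cases3)
  have \<theta>: "\<theta> \<in> ball \<sigma> r" using z dist_fst_le[of "(\<sigma>, 0, 0)" z] by (simp add: zeq)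
  have H: "Ham U L z = U \<theta> + L / 2 * (norm p)\<^sup>2 + L / 2 * (norm s)\<^sup>2" by (simp add: Ham_def zeq)
  have arith: "A + 9 / 20 * (S + (P + Q)) \<le> V + 1 / 2 * P + 1 / 2 * Q - u"
    if "A + 9 / 20 * S \<le> V - u" "0 \<le> P" "0 \<le> Q" for A S P Q V u :: real
    using that by (simp add: field_simps)
  have nn: "0 \<le> L * (norm p)\<^sup>2" "0 \<le> L * (norm s)\<^sup>2" using assms(1) by auto
  have "(\<Sum>i\<in>UNIV. L * (y \<bullet> e i)\<^sup>2) = L * (norm y)\<^sup>2" for y
    by (simp add: orthonormal_family_expansion(2)[OF e] sum_distrib_left)
  then have "(\<Sum>j\<in>- {Inl k}. stiffness lam L j * ((z - (\<sigma>, 0, 0)) \<bullet> phase_frame e j)\<^sup>2) =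
      (\<Sum>i\<in>- {k}. lam i * ((\<theta> - \<sigma>) \<bullet> e i)\<^sup>2) + (L * (norm p)\<^sup>2 + L * (norm s)\<^sup>2)"
    unfolding sum_triple_Compl by (simp add: zeq)
  moreover have "(z - (\<sigma>, 0, 0)) \<bullet> phase_frame e (Inl k) = (\<theta> - \<sigma>) \<bullet> e k" by (simp add: zeq)
  moreover have "L / 2 * (norm p)\<^sup>2 = 1 / 2 * (L * (norm p)\<^sup>2)" "L / 2 * (norm s)\<^sup>2 = 1 / 2 * (L * (norm s)\<^sup>2)"
    by simp_all
  ultimately show "- (11 / 20) * stiffness lam L (Inl k) * ((z - (\<sigma>, 0, 0)) \<bullet> phase_frame e (Inl k))\<^sup>2
        + (9 / 20) * (\<Sum>j\<in>- {Inl k}. stiffness lam L j * ((z - (\<sigma>, 0, 0)) \<bullet> phase_frame e j)\<^sup>2)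
      \<le> Ham U L z - Ham U L (\<sigma>, 0, 0)"
    using lower[OF \<theta>] nn unfolding H by (simp only: Ham_saddle frame_simps) (rule arith)
  fix t :: real and w assume t: "t \<in> {0..1}"
    and w: "w = (\<sigma>, 0, 0) + ((z - (\<sigma>, 0, 0)) \<bullet> phase_frame e (Inl k)) *\<^sub>R phase_frame e (Inl k)"
  define w' where "w' = \<sigma> + ((\<theta> - \<sigma>) \<bullet> e k) *\<^sub>R e k"
  have w: "w = (w', 0, 0)" by (simp add: w zeq w'_def)
  have "t\<^sup>2 \<le> t" using t by (simp add: power2_eq_square mult_left_le_one_le)
  then have "L / 2 * (t\<^sup>2 * (norm y)\<^sup>2) \<le> L / 2 * (t * (norm y)\<^sup>2)" for y :: "real^'d"
    using assms(1) by (intro mult_left_mono mult_right_mono) auto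
  note this[of p] this[of s]
  moreover have "U (w' + t *\<^sub>R (\<theta> - w')) \<le> (1 - t) * U w' + t * U \<theta>"
    by (rule segment[OF \<theta> t w'_def])
  moreover have "Ham U L (w + t *\<^sub>R (z - w)) =
      U (w' + t *\<^sub>R (\<theta> - w')) + L / 2 * (t\<^sup>2 * (norm p)\<^sup>2) + L / 2 * (t\<^sup>2 * (norm s)\<^sup>2)"
    by (simp add: w zeq Ham_def power_mult_distrib)
  ultimately show "Ham U L (w + t *\<^sub>R (z - w)) \<le> (1 - t) * Ham U L w + t * Ham U L z"
    unfolding H w by (simp add: algebra_simps)
qed

section \<open>Phase-space wells\<close>

text \<open>Moving against \<open>p\<close> shortens every vector close to \<open>p\<close>: this provides descent for the kinetic
  terms at points with nonzero momentum.\<close>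
lemma quadratic_descent:
  fixes p :: "'a::real_inner"
  assumes "p \<noteq> 0" "L > 0" "w \<in> ball p (norm p / 2)" "t \<in> {0<..1/2}"
  shows "L / 2 * (norm (w - t *\<^sub>R p))\<^sup>2 < L / 2 * (norm w)\<^sup>2"
proof -
  have "(norm (p - w))\<^sup>2 < (norm p / 2)\<^sup>2"
    using assms(3) by (intro power_strict_mono) (auto simp: dist_norm)
  then have "w \<bullet> p > (3 / 8) * (norm p)\<^sup>2 + (norm w)\<^sup>2 / 2"
    by (simp add: power2_norm_eq_inner inner_simps inner_commute power_divide)
  moreover have "(norm p)\<^sup>2 > 0" "(norm w)\<^sup>2 \<ge> 0" using assms(1) by auto
  ultimately have "w \<bullet> p > (1 / 4) * (norm p)\<^sup>2" by linarith
  moreover have "t * (norm p)\<^sup>2 \<le> (1 / 2) * (norm p)\<^sup>2" using assms(4) by (intro mult_right_mono) auto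
  ultimately have "t * (t * (norm p)\<^sup>2 - 2 * (w \<bullet> p)) < 0"
    using assms(4) by (intro mult_pos_neg) auto
  then have "(norm (w - t *\<^sub>R p))\<^sup>2 < (norm w)\<^sup>2"
    by (simp add: power2_norm_eq_inner inner_simps inner_commute algebra_simps)
  then show ?thesis using assms(2) by simp
qed

lemma gradient_descent:
  fixes U :: "real^'d \<Rightarrow> real"
  assumes "smooth U" "grad U \<theta> \<noteq> 0"
  shows "\<exists>\<rho>>0. \<forall>w\<in>ball \<theta> \<rho>. \<forall>t. 0 < t \<and> t * norm (grad U \<theta>) < \<rho> \<longrightarrow> U (w - t *\<^sub>R grad U \<theta>) < U w"
proof -
  define g where "g = grad U \<theta>"
  have "continuous_on UNIV (pdv g U)"
  proof -
    have "smooth (pdv (axis i 1) U)" for i by (intro smooth_pdv assms) simp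
    then have "continuous_on UNIV (\<lambda>x. \<Sum>i\<in>UNIV. pdv (axis i 1) U x * g $ i)"
      by (intro continuous_intros smooth_continuous)
    then show ?thesis by (simp add: pdv_grad[OF smooth_differentiable[OF assms(1)], of g] grad_def inner_vec_def)
  qed
  then have "open {x. pdv g U x > 0}" by (intro open_Collect_less continuous_intros)
  moreover have "\<theta> \<in> {x. pdv g U x > 0}"
    using assms(2) by (simp add: pdv_grad[OF smooth_differentiable[OF assms(1)]] g_def)
  ultimately obtain \<rho> where \<rho>: "\<rho> > 0" "ball \<theta> \<rho> \<subseteq> {x. pdv g U x > 0}"
    using open_contains_ball[of "{x. pdv g U x > 0}"] by blast
  have "U (w - t *\<^sub>R g) < U w" if w: "w \<in> ball \<theta> (\<rho> / 2)" and t: "0 < t" "t * norm g < \<rho> / 2" for w t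
  proof -
    have "U (w + t *\<^sub>R (- g)) < U (w + 0 *\<^sub>R (- g))"
    proof (rule DERIV_neg_imp_decreasing[OF t(1)])
      fix x assume x: "0 \<le> x" "x \<le> t"
      have "x * norm g \<le> t * norm g" using x by (intro mult_right_mono) auto
      then have "dist w (w + x *\<^sub>R (- g)) < \<rho> / 2" using t x by (simp add: dist_norm)
      then have "dist \<theta> (w + x *\<^sub>R (- g)) < \<rho>" using w dist_triangle_half_l[of \<theta> w] 
        by (smt (verit) dist_triangle field_sum_of_halves mem_ball)
      then have "pdv g U (w + x *\<^sub>R (- g)) > 0" using \<rho>(2) by auto
      then have "grad U (w + x *\<^sub>R (- g)) \<bullet> (- g) < 0"
        by (simp add: pdv_grad[OF smooth_differentiable[OF assms(1)]])
      then show "\<exists>y. ((\<lambda>t. U (w + t *\<^sub>R (- g))) has_real_derivative y) (at x) \<and> y < 0"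
        using grad_along_line(1)[OF assms(1)] by blast
    qed
    then show ?thesis by simp
  qed
  then show ?thesis using \<rho>(1) by (intro exI[of _ "\<rho> / 2"]) (auto simp: g_def)
qed

lemma Ham_descent:
  fixes U :: "real^'d \<Rightarrow> real"
  assumes "L > 0" "smooth U" and nz: "grad U \<theta> \<noteq> 0 \<or> p \<noteq> 0 \<or> s \<noteq> 0"
  shows "descent (Ham U L) (\<theta>, p, s)"
proof -
  have proj: "fst w \<in> ball \<theta> \<rho>" "fst (snd w) \<in> ball p \<rho>" "snd (snd w) \<in> ball s \<rho>"
    if "w \<in> ball (\<theta>, p, s) \<rho>" for w \<rho>
    using that dist_fst_le[of "(\<theta>, p, s)" w] dist_snd_le[of "(\<theta>, p, s)" w]
      dist_fst_le[of "(p, s)" "snd w"] dist_snd_le[of "(p, s)" "snd w"] by auto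
  consider "grad U \<theta> \<noteq> 0" | "p \<noteq> 0" | "s \<noteq> 0" using nz by blast
  then show ?thesis
  proof cases
    case 1
    then obtain \<rho> where \<rho>: "\<rho> > 0"
      "\<And>w t. w \<in> ball \<theta> \<rho> \<Longrightarrow> 0 < t \<Longrightarrow> t * norm (grad U \<theta>) < \<rho> \<Longrightarrow> U (w - t *\<^sub>R grad U \<theta>) < U w"
      using gradient_descent[OF assms(2)] by metis
    define t\<^sub>0 where "t\<^sub>0 = \<rho> / (2 * norm (grad U \<theta>))"
    have t0: "t\<^sub>0 > 0" using 1 \<rho> by (simp add: t\<^sub>0_def)
    have "Ham U L (w + t *\<^sub>R (- grad U \<theta>, 0, 0)) < Ham U L w"
      if "w \<in> ball (\<theta>, p, s) \<rho>" "t \<in> {0<..t\<^sub>0}" for w t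
    proof -
      have "t * norm (grad U \<theta>) \<le> t\<^sub>0 * norm (grad U \<theta>)" using that(2) by (intro mult_right_mono) auto
      then have "t * norm (grad U \<theta>) < \<rho>" using 1 \<rho>(1) by (simp add: t\<^sub>0_def)
      then show ?thesis using \<rho>(2)[OF proj(1)[OF that(1)], of t] that(2)
        by (cases w) (auto simp: Ham_def)
    qed
    then show ?thesis unfolding descent_def using t0 \<rho>(1) by blast
  next
    case 2
    have "Ham U L (w + t *\<^sub>R (0, - p, 0)) < Ham U L w"
      if "w \<in> ball (\<theta>, p, s) (norm p / 2)" "t \<in> {0<..1/2}" for w t
      using quadratic_descent[OF 2 assms(1) proj(2)[OF that(1)] that(2)] by (cases w) (auto simp: Ham_def)
    moreover have "norm p / 2 > 0" using 2 by simp
    ultimately show ?thesis unfolding descent_def by (metis half_gt_zero_iff zero_less_one)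
  next
    case 3
    have "Ham U L (w + t *\<^sub>R (0, 0, - s)) < Ham U L w"
      if "w \<in> ball (\<theta>, p, s) (norm s / 2)" "t \<in> {0<..1/2}" for w t
      using quadratic_descent[OF 3 assms(1) proj(3)[OF that(1)] that(2)] by (cases w) (auto simp: Ham_def)
    moreover have "norm s / 2 > 0" using 3 by simp
    ultimately show ?thesis unfolding descent_def by (metis half_gt_zero_iff zero_less_one)
  qed
qed

text \<open>Wells of \<open>U\<close> and of the Hamiltonian correspond under \<open>\<theta> \<mapsto> (\<theta>, 0, 0)\<close> and under the projection
  to \<open>\<theta>\<close>, because the kinetic terms are nonnegative.\<close>
lemma well_phase_well:
  "(\<lambda>\<theta>. (\<theta>, 0, 0)) ` closure (well U \<sigma> i) \<subseteq> closure (phase_well U L \<sigma> i)"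
  if "U i < U \<sigma>"
proof -
  have cont: "continuous_on S (\<lambda>\<theta>. (\<theta>, 0, 0))" for S by (intro continuous_intros)
  have "(\<lambda>\<theta>. (\<theta>, 0, 0)) ` well U \<sigma> i \<subseteq> phase_well U L \<sigma> i"
    unfolding phase_well_def
  proof (rule connected_component_maximal)
    show "(i, 0, 0) \<in> (\<lambda>\<theta>. (\<theta>, 0, 0)) ` well U \<sigma> i" using that by (auto simp: well_def)
    show "connected ((\<lambda>\<theta>. (\<theta>, 0, 0)) ` well U \<sigma> i)"
      by (intro connected_continuous_image cont) (simp add: well_def)
    show "(\<lambda>\<theta>. (\<theta>, 0, 0)) ` well U \<sigma> i \<subseteq> {z. Ham U L z < U \<sigma>}"
      using connected_component_subset unfolding well_def by fastforce
  qed
  then show ?thesis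
    by (intro image_closure_subset cont closed_closure) (use closure_subset in blast)
qed

lemma fst_phase_well:
  assumes "L > 0" "U i < U \<sigma>"
  shows "fst ` phase_well U L \<sigma> i \<subseteq> well U \<sigma> i"
  unfolding well_def
proof (rule connected_component_maximal)
  show "i \<in> fst ` phase_well U L \<sigma> i" 
    by (rule image_eqI[of _ _ "(i, 0, 0)"]) (simp_all add: phase_well_def assms)
  show "connected (fst ` phase_well U L \<sigma> i)"
    by (intro connected_continuous_image continuous_intros) (simp add: phase_well_def)
  have "U (fst z) \<le> Ham U L z" for z :: "'a phase"
    using assms(1) by (cases z) (simp add: Ham_def)
  moreover have "Ham U L z < U \<sigma>" if "z \<in> phase_well U L \<sigma> i" for z
    using that connected_component_subset[of "{z. Ham U L z < U \<sigma>}"] unfolding phase_well_def by blast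
  ultimately show "fst ` phase_well U L \<sigma> i \<subseteq> {\<theta>. U \<theta> < U \<sigma>}"
    using le_less_trans by blast
qed

text \<open>A critical point of the Hamiltonian has zero momenta and lies over a critical point of \<open>U\<close>; on the
  boundary of the well at the saddle level the landscape leaves only \<open>\<sigma>\<close>.\<close>
lemma phase_well_boundary_descent:
  fixes U :: "real^'d \<Rightarrow> real"
  assumes "L > 0" "smooth U" "U i < U \<sigma>"
    and crit: "Crit U \<inter> frontier (well U \<sigma> i) \<inter> {\<theta>. U \<theta> = U \<sigma>} = {\<sigma>}"
    and z: "z \<in> closure (phase_well U L \<sigma> i)" "Ham U L z = U \<sigma>" "z \<noteq> (\<sigma>, 0, 0)"
  shows "descent (Ham U L) z"
proof -
  obtain \<theta> p s where zeq: "z = (\<theta>, p, s)" by (metis prod_cases3)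
  have "grad U \<theta> \<noteq> 0 \<or> p \<noteq> 0 \<or> s \<noteq> 0"
  proof (rule ccontr)
    assume "\<not> ?thesis"
    then have crit0: "grad U \<theta> = 0" "p = 0" "s = 0" by auto
    then have U\<theta>: "U \<theta> = U \<sigma>" using z(2) zeq by simp
    have "fst ` closure (phase_well U L \<sigma> i) \<subseteq> closure (well U \<sigma> i)"
      using fst_phase_well[OF assms(1,3)] closure_subset
      by (intro image_closure_subset continuous_intros) auto
    then have "\<theta> \<in> closure (well U \<sigma> i)" using z(1) zeq by force
    moreover have "\<theta> \<notin> well U \<sigma> i"
      using U\<theta> connected_component_subset unfolding well_def by fastforce
    ultimately have "\<theta> \<in> frontier (well U \<sigma> i)"
      using interior_subset by (auto simp: frontier_def)
    then have "\<theta> = \<sigma>" using crit crit0 U\<theta> by (auto simp: Crit_def)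
    then show False using z(3) zeq crit0 by simp
  qed
  then show ?thesis unfolding zeq by (rule Ham_descent[OF assms(1,2)])
qed

section \<open>Asymptotics of the scales\<close>

lemma eventually_scales:
  assumes "K > 0" "M > 0"
  shows "\<forall>\<^sub>F \<epsilon> in at_right 0. 0 < \<epsilon> \<and> \<epsilon> < M \<and> 0 < scale_d K \<epsilon> \<and> scale_d K \<epsilon> < M"
proof -
  have "((\<lambda>\<epsilon>::real. sqrt \<epsilon> * sqrt (ln (1 / \<epsilon>))) \<longlongrightarrow> 0) (at_right 0)" by real_asymp
  then have "((\<lambda>\<epsilon>. K * (sqrt \<epsilon> * sqrt (ln (1 / \<epsilon>)))) \<longlongrightarrow> K * 0) (at_right 0)" by (intro tendsto_intros)
  then have "(scale_d K \<longlongrightarrow> 0) (at_right 0)"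
    by (simp add: scale_d_def[abs_def] scale_R_def mult_ac)
  then have "\<forall>\<^sub>F \<epsilon> in at_right 0. scale_d K \<epsilon> < M" using assms(2) by (rule order_tendstoD)
  moreover have "\<forall>\<^sub>F \<epsilon> in at_right 0. \<epsilon> \<in> {0<..<min 1 M}"
    using assms(2) by (intro eventually_at_right_real) auto
  ultimately show ?thesis
  proof eventually_elim
    case (elim \<epsilon>)
    then have "ln (1 / \<epsilon>) > 0" by (intro ln_gt_zero) simp
    then show ?case using elim assms(1) by (simp add: scale_d_def scale_R_def)
  qed
qed

lemma eventually_layer_thin:
  assumes "K > 0"
  shows "\<forall>\<^sub>F \<epsilon> in at_right 0. vth * sqrt \<epsilon> < scale_d K \<epsilon> / 2"
proof -
  have "filterlim (\<lambda>\<epsilon>::real. sqrt (ln (1 / \<epsilon>))) at_top (at_right 0)" by real_asymp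
  then have "\<forall>\<^sub>F \<epsilon> in at_right 0. 2 * vth / K < sqrt (ln (1 / \<epsilon>))"
    by (simp add: filterlim_at_top_dense)
  moreover have "\<forall>\<^sub>F \<epsilon> in at_right (0::real). 0 < \<epsilon>" by (simp add: eventually_at_right_less)
  ultimately show ?thesis
  proof eventually_elim
    case (elim \<epsilon>)
    have "vth < K * sqrt (ln (1 / \<epsilon>)) / 2" using elim(1) assms by (simp add: field_simps)
    then have "sqrt \<epsilon> * vth < sqrt \<epsilon> * (K * sqrt (ln (1 / \<epsilon>)) / 2)"
      using elim(2) by (intro mult_strict_left_mono) auto
    then show ?case by (simp add: scale_d_def scale_R_def mult_ac)
  qed
qed

section \<open>The admissible function\<close>

theorem lemmaC1:
  fixes U :: "real^'d \<Rightarrow> real" and m s \<sigma> :: "real^'d" and L \<gamma> :: real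
    and e :: "'d \<Rightarrow> real^'d" and lam :: "'d \<Rightarrow> real" and k :: 'd
  assumes "L > 0" and "\<gamma> > 0"
    and "landscape U m s \<sigma>" and "confining U"
    and "saddle_frame U L m s \<sigma> e lam k"
  shows
    "\<forall>\<^sub>F c\<^sub>K in at_right 0. \<forall>\<^sub>F K in at_top.
      \<exists>(G :: real \<Rightarrow> 'd phase \<Rightarrow> real) (C :: 'd phase list \<Rightarrow> real).
        (\<forall>\<^sub>F \<epsilon> in at_right 0.
           smooth (G \<epsilon>) \<and> compact (supp (G \<epsilon>)) \<and> range (G \<epsilon>) \<subseteq> {0..1} \<and>
           (\<forall>z. Ham U L z \<le> U \<sigma> + scale_a c\<^sub>K K \<epsilon> / 2 \<longrightarrow> G \<epsilon> z = 1) \<and>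
           (\<forall>z. Ham U L z \<ge> U \<sigma> + 5 * scale_a c\<^sub>K K \<epsilon> / 6 \<longrightarrow> G \<epsilon> z = 0) \<and>
           (\<forall>bs. set bs \<subseteq> Basis \<longrightarrow>
              (\<forall>z. \<bar>mpdv bs (G \<epsilon>) z\<bar> \<le> C bs / scale_rho K \<epsilon> ^ length bs))) \<and>
        (\<forall>vth>0. \<forall>\<^sub>F \<epsilon> in at_right 0.
           (let q1 = qc \<sigma> e k;
                j = profile L \<gamma> \<sigma> e lam k \<epsilon>;
                Kbox = saddle_box L \<sigma> e lam k K \<epsilon>;
                Am = layer_minus L \<sigma> e lam k K vth \<epsilon>;
                Ap = layer_plus L \<sigma> e lam k K vth \<epsilon>;
                x = inner_end (lam k) K \<epsilon>;
                y = outer_end (lam k) K vth \<epsilon>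
            in \<exists>(f :: 'd phase \<Rightarrow> real) (\<chi>m :: real \<Rightarrow> real) (\<chi>p :: real \<Rightarrow> real).
                 flat_cutoff \<chi>m (- x) (- y) \<and> flat_cutoff \<chi>p x y \<and>
                 Ck 2 f \<and> compact (supp f) \<and> range f \<subseteq> {0..1} \<and> admissible m s \<epsilon> f \<and>
                 (\<forall>z\<in>Am. f z = G \<epsilon> z * (j z + \<chi>m (q1 z) * (1 - j z))) \<and>
                 (\<forall>z\<in>Kbox. f z = G \<epsilon> z * j z) \<and>
                 (\<forall>z\<in>Ap. f z = G \<epsilon> z * (1 - \<chi>p (q1 z)) * j z) \<and>
                 (\<forall>z\<in>J_comp U L \<sigma> e lam k c\<^sub>K K \<epsilon> m - Am. f z = G \<epsilon> z) \<and>
                 (\<forall>z\<in>J_comp U L \<sigma> e lam k c\<^sub>K K \<epsilon> s - Ap. f z = 0) \<and>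
                 (\<forall>z\<in>J_rest U L m s \<sigma> e lam k c\<^sub>K K \<epsilon>. f z = 0) \<and>
                 (\<forall>bs. set bs \<subseteq> Basis \<and> length bs \<in> {1, 2} \<longrightarrow>
                    supp (mpdv bs f) \<subseteq>
                      Kbox \<union> Am \<union> Ap \<union> {z. Ham U L z \<ge> U \<sigma> + scale_a c\<^sub>K K \<epsilon> / 2})))"
proof -
  have sm: "smooth U" and "m \<noteq> s" and Ums: "U m < U \<sigma>" "U s < U \<sigma>" and grad0: "grad U \<sigma> = 0"
    using assms(3) by (auto simp: landscape_def morse_def index_one_saddle_def Crit_def)
  have crit: "Crit U \<inter> well U \<sigma> m = {m}" "Crit U \<inter> well U \<sigma> s = {s}"
    and fr: "\<sigma> \<in> frontier (well U \<sigma> m)" "\<sigma> \<in> frontier (well U \<sigma> s)"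
    and fr_crit: "Crit U \<inter> frontier (well U \<sigma> m) \<inter> {\<theta>. U \<theta> = U \<sigma>} = {\<sigma>}"
    using assms(3) unfolding landscape_def by blast+
  have e: "e i \<bullet> e j = (if i = j then 1 else 0)" and lam: "lam i > 0"
    and ek: "hessian U \<sigma> *v e k = - lam k *\<^sub>R e k"
    and ei: "i \<noteq> k \<Longrightarrow> hessian U \<sigma> *v e i = lam i *\<^sub>R e i" for i j
    using assms(5) unfolding saddle_frame_def by blast+
  have "\<forall>\<^sub>F z in nhds (\<sigma>, 0, 0). (z \<in> phase_well U L \<sigma> m \<longrightarrow> qc \<sigma> e k z < 0) \<and>
      (z \<in> phase_well U L \<sigma> s \<longrightarrow> qc \<sigma> e k z > 0)"
    using assms(5) unfolding saddle_frame_def by blast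
  then obtain r2 where r2: "r2 > 0" "\<And>z. dist z (\<sigma>, 0, 0) < r2 \<Longrightarrow>
      (z \<in> phase_well U L \<sigma> m \<longrightarrow> qc \<sigma> e k z < 0) \<and> (z \<in> phase_well U L \<sigma> s \<longrightarrow> qc \<sigma> e k z > 0)"
    unfolding eventually_nhds_metric by blast
  obtain r1 where r1: "r1 > 0"
    "\<forall>\<theta>\<in>ball \<sigma> r1. U \<theta> - U \<sigma> \<ge> - (11 / 20) * lam k * ((\<theta> - \<sigma>) \<bullet> e k)\<^sup>2
        + (9 / 20) * (\<Sum>i\<in>- {k}. lam i * ((\<theta> - \<sigma>) \<bullet> e i)\<^sup>2)"
    "\<forall>x. \<bar>x\<bar> < r1 \<longrightarrow> x \<noteq> 0 \<longrightarrow> U (\<sigma> + x *\<^sub>R e k) < U \<sigma>"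
    "\<forall>\<theta>\<in>ball \<sigma> r1. \<forall>t\<in>{0..1}. \<forall>w. w = \<sigma> + ((\<theta> - \<sigma>) \<bullet> e k) *\<^sub>R e k \<longrightarrow>
       U (w + t *\<^sub>R (\<theta> - w)) \<le> (1 - t) * U w + t * U \<theta>"
    using potential_near_saddle[OF sm grad0 e lam ek ei] by blast
  define z\<^sub>0 :: "'d phase" where "z\<^sub>0 = (\<sigma>, 0, 0)"
  define xm :: "'d phase" where "xm = (m, 0, 0)"
  define xs :: "'d phase" where "xs = (s, 0, 0)"
  have ne: "xm \<noteq> z\<^sub>0" "xs \<noteq> z\<^sub>0" using Ums by (auto simp: xm_def xs_def z\<^sub>0_def)
  \<comment> \<open>the chart is shrunk until it stays away from both minima, so that the box and the layers cannot
    interfere with the values of \<open>f\<close> near them\<close>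
  define r where "r = min (min r1 r2) (min (dist z\<^sub>0 xm / 2) (dist z\<^sub>0 xs / 2))"
  have r: "r > 0" "r \<le> r1" "r \<le> r2" "r < dist z\<^sub>0 xm" "r < dist z\<^sub>0 xs"
  proof -
    have "dist z\<^sub>0 xm > 0" "dist z\<^sub>0 xs > 0" using ne by auto
    then show "r > 0" "r \<le> r1" "r \<le> r2" "r < dist z\<^sub>0 xm" "r < dist z\<^sub>0 xs"
      unfolding r_def using r1(1) r2(1) by linarith+
  qed
  interpret P: saddle_chart "Ham U L" z\<^sub>0 "phase_frame e" "stiffness lam L" "Inl k" r
    unfolding z\<^sub>0_def
    by (rule phase_saddle_chart[OF assms(1) sm e lam r(1)]) (use r1 r(2) in auto)
  have Hz0 [simp]: "Ham U L z\<^sub>0 = U \<sigma>" by (simp add: z\<^sub>0_def)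
  have Hms: "Ham U L xm < Ham U L z\<^sub>0" "Ham U L xs < Ham U L z\<^sub>0" using Ums by (simp_all add: xm_def xs_def)
  have q: "P.q (Inl i) z = qc \<sigma> e i z" "P.q (Inr (Inl i)) z = vc e i z" "P.q (Inr (Inr i)) z = wc e i z" for i z
    unfolding P.q_def by (simp_all add: z\<^sub>0_def qc_def vc_def wc_def inner_prod_def case_prod_beta)
  have basin: "P.basin xm = phase_well U L \<sigma> m" "P.basin xs = phase_well U L \<sigma> s"
    by (simp_all add: P.basin_def phase_well_def xm_def xs_def)
  have orient: "z \<in> P.basin xm \<Longrightarrow> 1 * P.q (Inl k) z < 0" "z \<in> P.basin xs \<Longrightarrow> - 1 * P.q (Inl k) z < 0"
    if "z \<in> ball z\<^sub>0 r" for z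
  proof -
    have "dist z (\<sigma>, 0, 0) < r2" using that r(3) by (simp add: z\<^sub>0_def dist_commute)
    from r2(2)[OF this] show "z \<in> P.basin xm \<Longrightarrow> 1 * P.q (Inl k) z < 0"
      "z \<in> P.basin xs \<Longrightarrow> - 1 * P.q (Inl k) z < 0"
      unfolding basin q by simp_all
  qed
  have "z\<^sub>0 \<in> closure (phase_well U L \<sigma> i)" if "U i < U \<sigma>" "\<sigma> \<in> frontier (well U \<sigma> i)" for i
    using well_phase_well[OF that(1)] that(2) unfolding z\<^sub>0_def frontier_def by blast
  then have cl: "z\<^sub>0 \<in> closure (P.basin xm)" "z\<^sub>0 \<in> closure (P.basin xs)"
    using Ums fr by (simp_all add: basin)
  have comp: "compact {z. Ham U L z \<le> c}" for c
    using assms(4) unfolding confining_def by (intro compact_Ham_sublevel assms(1) sm) blast+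
  have "xs \<notin> P.basin xm"
  proof
    assume "xs \<in> P.basin xm"
    then have "fst xs \<in> well U \<sigma> m" using fst_phase_well[OF assms(1) Ums(1)] unfolding basin by blast
    then have "s \<in> well U \<sigma> m" by (simp add: xs_def)
    moreover have "s \<in> Crit U \<inter> well U \<sigma> s" unfolding crit(2) by simp
    ultimately have "s \<in> Crit U \<inter> well U \<sigma> m" by simp
    then show False unfolding crit(1) using \<open>m \<noteq> s\<close> by simp
  qed
  moreover have "descent (Ham U L) z"
    if "z \<in> closure (P.basin xm)" "Ham U L z = Ham U L z\<^sub>0" "z \<noteq> z\<^sub>0" for z
  proof (rule phase_well_boundary_descent[OF assms(1) sm Ums(1) fr_crit])
    show "z \<in> closure (phase_well U L \<sigma> m)" using that(1) unfolding basin .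
    show "Ham U L z = U \<sigma>" "z \<noteq> (\<sigma>, 0, 0)" using that by (simp_all add: z\<^sub>0_def)
  qed
  ultimately have "\<exists>a\<^sub>0>0. \<forall>a \<delta>. a \<le> a\<^sub>0 \<longrightarrow> 0 < \<delta> \<longrightarrow> a \<le> \<delta>\<^sup>2 / 2 \<longrightarrow>
      xs \<notin> connected_component_set ({z. Ham U L z < Ham U L z\<^sub>0 + a} - P.box \<delta>) xm"
    by (intro P.basins_separated[of 1, OF _ cl(1) orient(1) Hms _ _ comp]) auto
  then obtain a\<^sub>0 where a0: "a\<^sub>0 > 0" "\<And>a \<delta>. a \<le> a\<^sub>0 \<Longrightarrow> 0 < \<delta> \<Longrightarrow> a \<le> \<delta>\<^sup>2 / 2 \<Longrightarrow>
      xs \<notin> connected_component_set ({z. Ham U L z < Ham U L z\<^sub>0 + a} - P.box \<delta>) xm"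
    by blast
  have "\<exists>\<rho>>0. ball x \<rho> \<subseteq> {z. Ham U L z < U \<sigma>} - ball z\<^sub>0 r" if "Ham U L x < Ham U L z\<^sub>0" "r < dist z\<^sub>0 x" for x
  proof -
    have "open ({z. Ham U L z < U \<sigma>} - cball z\<^sub>0 r)" by (intro open_Diff P.open_sublevel closed_cball)
    moreover have "x \<in> {z. Ham U L z < U \<sigma>} - cball z\<^sub>0 r" using that by simp
    ultimately obtain \<rho> where "\<rho> > 0" "ball x \<rho> \<subseteq> {z. Ham U L z < U \<sigma>} - cball z\<^sub>0 r"
      using open_contains_ball by blast
    then show ?thesis using ball_subset_cball[of z\<^sub>0 r] by blast
  qed
  then obtain \<rho>m \<rho>s where \<rho>ms: "\<rho>m > 0" "ball xm \<rho>m \<subseteq> {z. Ham U L z < U \<sigma>} - ball z\<^sub>0 r"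
      "\<rho>s > 0" "ball xs \<rho>s \<subseteq> {z. Ham U L z < U \<sigma>} - ball z\<^sub>0 r"
    using Hms r by metis
  define \<Sigma> where "\<Sigma> = (\<Sum>j\<in>UNIV. 1 / stiffness lam L j)"
  have \<Sigma>: "\<Sigma> \<ge> 0" unfolding \<Sigma>_def using P.\<kappa>_pos by (intro sum_nonneg) (simp add: less_imp_le)

  have "\<exists>(G :: real \<Rightarrow> 'd phase \<Rightarrow> real) (C :: 'd phase list \<Rightarrow> real).
        (\<forall>\<^sub>F \<epsilon> in at_right 0.
           smooth (G \<epsilon>) \<and> compact (supp (G \<epsilon>)) \<and> range (G \<epsilon>) \<subseteq> {0..1} \<and>
           (\<forall>z. Ham U L z \<le> U \<sigma> + scale_a c\<^sub>K K \<epsilon> / 2 \<longrightarrow> G \<epsilon> z = 1) \<and>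
           (\<forall>z. Ham U L z \<ge> U \<sigma> + 5 * scale_a c\<^sub>K K \<epsilon> / 6 \<longrightarrow> G \<epsilon> z = 0) \<and>
           (\<forall>bs. set bs \<subseteq> Basis \<longrightarrow>
              (\<forall>z. \<bar>mpdv bs (G \<epsilon>) z\<bar> \<le> C bs / scale_rho K \<epsilon> ^ length bs))) \<and>
        (\<forall>vth>0. \<forall>\<^sub>F \<epsilon> in at_right 0.
           (let q1 = qc \<sigma> e k;
                j = profile L \<gamma> \<sigma> e lam k \<epsilon>;
                Kbox = saddle_box L \<sigma> e lam k K \<epsilon>;
                Am = layer_minus L \<sigma> e lam k K vth \<epsilon>;
                Ap = layer_plus L \<sigma> e lam k K vth \<epsilon>;
                x = inner_end (lam k) K \<epsilon>;
                y = outer_end (lam k) K vth \<epsilon>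
            in \<exists>(f :: 'd phase \<Rightarrow> real) (\<chi>m :: real \<Rightarrow> real) (\<chi>p :: real \<Rightarrow> real).
                 flat_cutoff \<chi>m (- x) (- y) \<and> flat_cutoff \<chi>p x y \<and>
                 Ck 2 f \<and> compact (supp f) \<and> range f \<subseteq> {0..1} \<and> admissible m s \<epsilon> f \<and>
                 (\<forall>z\<in>Am. f z = G \<epsilon> z * (j z + \<chi>m (q1 z) * (1 - j z))) \<and>
                 (\<forall>z\<in>Kbox. f z = G \<epsilon> z * j z) \<and>
                 (\<forall>z\<in>Ap. f z = G \<epsilon> z * (1 - \<chi>p (q1 z)) * j z) \<and>
                 (\<forall>z\<in>J_comp U L \<sigma> e lam k c\<^sub>K K \<epsilon> m - Am. f z = G \<epsilon> z) \<and>
                 (\<forall>z\<in>J_comp U L \<sigma> e lam k c\<^sub>K K \<epsilon> s - Ap. f z = 0) \<and>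
                 (\<forall>z\<in>J_rest U L m s \<sigma> e lam k c\<^sub>K K \<epsilon>. f z = 0) \<and>
                 (\<forall>bs. set bs \<subseteq> Basis \<and> length bs \<in> {1, 2} \<longrightarrow>
                    supp (mpdv bs f) \<subseteq>
                      Kbox \<union> Am \<union> Ap \<union> {z. Ham U L z \<ge> U \<sigma> + scale_a c\<^sub>K K \<epsilon> / 2})))" if c: "0 < c\<^sub>K" "c\<^sub>K < 1 / 2" and K: "0 < K" for c\<^sub>K K
  proof -
    \<comment> \<open>all smallness requirements on \<open>\<epsilon>\<close> and \<open>\<delta>\<close>: \<open>\<delta> < c\<^sub>K\<close> gives \<open>\<rho> \<le> a\<close>, the bound with \<open>\<Sigma>\<close> puts the
      tube into the ball of the saddle chart, \<open>a\<^sub>0\<close> separates the wells, \<open>\<rho>m\<close> and \<open>\<rho>s\<close> give admissibility\<close>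
    define M where "M = min (min 1 c\<^sub>K) (min (min a\<^sub>0 (r\<^sup>2 / (4 * \<Sigma> + 1))) (min \<rho>m \<rho>s))"
    have M: "M > 0" "M \<le> 1" "M \<le> c\<^sub>K" "M \<le> a\<^sub>0" "M \<le> \<rho>m" "M \<le> \<rho>s" "M \<le> r\<^sup>2 / (4 * \<Sigma> + 1)"
      using c a0 \<rho>ms r(1) \<Sigma> by (auto simp: M_def intro!: divide_pos_pos add_nonneg_pos)
    define good where "good \<epsilon> \<longleftrightarrow> 0 < \<epsilon> \<and> \<epsilon> < M \<and> 0 < scale_d K \<epsilon> \<and> scale_d K \<epsilon> < M" for \<epsilon>
    have good: "\<forall>\<^sub>F \<epsilon> in at_right 0. good \<epsilon>"
      unfolding good_def by (rule eventually_scales[OF K M(1)])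
    have a_eq: "scale_a c\<^sub>K K \<epsilon> = c\<^sub>K * (scale_d K \<epsilon>)\<^sup>2" if "good \<epsilon>" for \<epsilon>
      using that by (simp add: good_def scale_a_def scale_d_def power_mult_distrib)
    have a: "0 < scale_a c\<^sub>K K \<epsilon>" "scale_a c\<^sub>K K \<epsilon> \<le> (scale_d K \<epsilon>)\<^sup>2 / 2" "scale_a c\<^sub>K K \<epsilon> \<le> 1"
      "scale_a c\<^sub>K K \<epsilon> \<le> a\<^sub>0" "scale_rho K \<epsilon> \<le> scale_a c\<^sub>K K \<epsilon>" "0 < scale_rho K \<epsilon>"
      "4 * (scale_d K \<epsilon>)\<^sup>2 * \<Sigma> < r\<^sup>2" if g: "good \<epsilon>" for \<epsilon>
    proof -
      have d: "0 < scale_d K \<epsilon>" "scale_d K \<epsilon> < M" using g by (auto simp: good_def)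
      have d2: "(scale_d K \<epsilon>)\<^sup>2 \<le> scale_d K \<epsilon>" "0 < (scale_d K \<epsilon>)\<^sup>2"
        using d M(2) by (auto simp: power2_eq_square mult_left_le)
      show "0 < scale_a c\<^sub>K K \<epsilon>" "scale_a c\<^sub>K K \<epsilon> \<le> (scale_d K \<epsilon>)\<^sup>2 / 2"
        unfolding a_eq[OF g] using c d2 by auto
      then have "scale_a c\<^sub>K K \<epsilon> \<le> M" using d d2 by linarith
      then show "scale_a c\<^sub>K K \<epsilon> \<le> 1" "scale_a c\<^sub>K K \<epsilon> \<le> a\<^sub>0" using M by linarith+
      show "0 < scale_rho K \<epsilon>" using d by (simp add: scale_rho_def)
      have "scale_d K \<epsilon> * (scale_d K \<epsilon>)\<^sup>2 \<le> c\<^sub>K * (scale_d K \<epsilon>)\<^sup>2"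
        using d M by (intro mult_right_mono) auto
      then show "scale_rho K \<epsilon> \<le> scale_a c\<^sub>K K \<epsilon>"
        unfolding a_eq[OF g] scale_rho_def by (simp add: power3_eq_cube power2_eq_square mult.assoc)
      have "4 * (scale_d K \<epsilon>)\<^sup>2 * \<Sigma> \<le> M * (4 * \<Sigma>)" using d d2 \<Sigma> by (simp add: mult_right_mono)
      also have "\<dots> < M * (4 * \<Sigma> + 1)" using M(1) by simp
      also have "\<dots> \<le> r\<^sup>2" using M(7) \<Sigma> by (simp add: field_simps)
      finally show "4 * (scale_d K \<epsilon>)\<^sup>2 * \<Sigma> < r\<^sup>2" .
    qed
    \<comment> \<open>\<open>\<psi>\<close> is \<open>1\<close> up to \<open>1 / 2\<close> and \<open>0\<close> from \<open>5 / 6\<close> on\<close>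
    define \<psi> where "\<psi> t = smooth_step (1 - t)" for t
    have \<psi>: "smooth \<psi>"
    proof -
      have "Ck n (\<lambda>t. smooth_step (- 1 * t + 1))" for n
        using smooth_smooth_step unfolding smooth_def by (intro Ck_compose[OF _ Ck_affine_real]) blast
      then show ?thesis by (simp add: smooth_def \<psi>_def[abs_def])
    qed
    define G where "G \<epsilon> z = \<psi> (1 / scale_a c\<^sub>K K \<epsilon> * (Ham U L z - U \<sigma>))" for \<epsilon> z
    have smG: "smooth (G \<epsilon>)" for \<epsilon>
      unfolding smooth_def
    proof
      fix n
      have "Ck n \<psi>" "Ck n (Ham U L)" using \<psi> smooth_Ham[OF sm, of L] by (auto simp: smooth_def)
      then show "Ck n (G \<epsilon>)"
        unfolding G_def[abs_def]
        by (intro Ck_compose[OF \<open>Ck n \<psi>\<close>] Ck_mult Ck_diff Ck_const)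
    qed
    have G_range: "0 \<le> G \<epsilon> z" "G \<epsilon> z \<le> 1" for \<epsilon> z
      by (simp_all add: G_def \<psi>_def smooth_step_nonneg smooth_step_le_1)
    have G1: "G \<epsilon> z = 1" if "good \<epsilon>" "Ham U L z \<le> U \<sigma> + scale_a c\<^sub>K K \<epsilon> / 2" for \<epsilon> z
      unfolding G_def \<psi>_def using that a(1)[OF that(1)] by (intro smooth_step_high) (simp add: field_simps)
    have G0: "G \<epsilon> z = 0" if "good \<epsilon>" "Ham U L z \<ge> U \<sigma> + 5 * scale_a c\<^sub>K K \<epsilon> / 6" for \<epsilon> z
      unfolding G_def \<psi>_def using that a(1)[OF that(1)] by (intro smooth_step_low) (simp add: field_simps)
    have "\<exists>C. set bs \<subseteq> Basis \<longrightarrow> (\<forall>t\<ge>1. \<forall>z. \<bar>mpdv bs (\<lambda>z. \<psi> (t * (Ham U L z - U \<sigma>))) z\<bar> \<le> C * t ^ length bs)"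
      for bs :: "'d phase list"
    proof (cases "set bs \<subseteq> Basis")
      case True
      have "\<exists>C. \<forall>t\<ge>1. \<forall>z. \<bar>mpdv bs (\<lambda>z. \<psi> (t * (Ham U L z - U \<sigma>))) z\<bar> \<le> C * t ^ length bs"
        by (rule scaled_composition_bound[OF \<psi> smooth_Ham[OF sm] True, of "1/2" 1 1])
          (auto simp: \<psi>_def smooth_step_high smooth_step_low comp)
      then show ?thesis by blast
    qed blast
    then obtain C where C: "\<And>bs t z. set bs \<subseteq> Basis \<Longrightarrow> t \<ge> 1 \<Longrightarrow>
        \<bar>mpdv bs (\<lambda>z. \<psi> (t * (Ham U L z - U \<sigma>))) z\<bar> \<le> C bs * t ^ length bs" by metis
    have G_deriv: "\<bar>mpdv bs (G \<epsilon>) z\<bar> \<le> \<bar>C bs\<bar> / scale_rho K \<epsilon> ^ length bs" if g: "good \<epsilon>" and bs: "set bs \<subseteq> Basis" for \<epsilon> bs z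
    proof -
      define t where "t = 1 / scale_a c\<^sub>K K \<epsilon>"
      have t: "1 \<le> t" "t \<le> 1 / scale_rho K \<epsilon>"
        using a[OF g] by (auto simp: t_def intro!: divide_left_mono)
      have "\<bar>mpdv bs (G \<epsilon>) z\<bar> \<le> C bs * t ^ length bs"
        using C[OF bs t(1)] by (simp add: G_def[abs_def] t_def)
      also have "\<dots> \<le> \<bar>C bs\<bar> * (1 / scale_rho K \<epsilon>) ^ length bs"
        using t by (intro mult_mono power_mono) auto
      finally show ?thesis by (simp add: power_one_over)
    qed
    have partG: "\<forall>\<^sub>F \<epsilon> in at_right 0.
           smooth (G \<epsilon>) \<and> compact (supp (G \<epsilon>)) \<and> range (G \<epsilon>) \<subseteq> {0..1} \<and>
           (\<forall>z. Ham U L z \<le> U \<sigma> + scale_a c\<^sub>K K \<epsilon> / 2 \<longrightarrow> G \<epsilon> z = 1) \<and>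
           (\<forall>z. Ham U L z \<ge> U \<sigma> + 5 * scale_a c\<^sub>K K \<epsilon> / 6 \<longrightarrow> G \<epsilon> z = 0) \<and>
           (\<forall>bs. set bs \<subseteq> Basis \<longrightarrow>
              (\<forall>z. \<bar>mpdv bs (G \<epsilon>) z\<bar> \<le> \<bar>C bs\<bar> / scale_rho K \<epsilon> ^ length bs))"
      using good
    proof eventually_elim
      case (elim \<epsilon>)
      have "supp (G \<epsilon>) \<subseteq> {z. Ham U L z \<le> U \<sigma> + 5 * scale_a c\<^sub>K K \<epsilon> / 6}"
        by (rule supp_subsetI) (auto intro: compact_imp_closed[OF comp] G0[OF elim])
      then have "compact (supp (G \<epsilon>))"
        using comp compact_Int_closed[of _ "supp (G \<epsilon>)"] by (metis closed_closure inf.absorb_iff2 supp_def)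
      then show ?case using smG G_range G1[OF elim] G0[OF elim] G_deriv[OF elim] by auto
    qed
    have partF: "\<forall>\<^sub>F \<epsilon> in at_right 0. (let q1 = qc \<sigma> e k;
                j = profile L \<gamma> \<sigma> e lam k \<epsilon>;
                Kbox = saddle_box L \<sigma> e lam k K \<epsilon>;
                Am = layer_minus L \<sigma> e lam k K vth \<epsilon>;
                Ap = layer_plus L \<sigma> e lam k K vth \<epsilon>;
                x = inner_end (lam k) K \<epsilon>;
                y = outer_end (lam k) K vth \<epsilon>
            in \<exists>(f :: 'd phase \<Rightarrow> real) (\<chi>m :: real \<Rightarrow> real) (\<chi>p :: real \<Rightarrow> real).
                 flat_cutoff \<chi>m (- x) (- y) \<and> flat_cutoff \<chi>p x y \<and>
                 Ck 2 f \<and> compact (supp f) \<and> range f \<subseteq> {0..1} \<and> admissible m s \<epsilon> f \<and>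
                 (\<forall>z\<in>Am. f z = G \<epsilon> z * (j z + \<chi>m (q1 z) * (1 - j z))) \<and>
                 (\<forall>z\<in>Kbox. f z = G \<epsilon> z * j z) \<and>
                 (\<forall>z\<in>Ap. f z = G \<epsilon> z * (1 - \<chi>p (q1 z)) * j z) \<and>
                 (\<forall>z\<in>J_comp U L \<sigma> e lam k c\<^sub>K K \<epsilon> m - Am. f z = G \<epsilon> z) \<and>
                 (\<forall>z\<in>J_comp U L \<sigma> e lam k c\<^sub>K K \<epsilon> s - Ap. f z = 0) \<and>
                 (\<forall>z\<in>J_rest U L m s \<sigma> e lam k c\<^sub>K K \<epsilon>. f z = 0) \<and>
                 (\<forall>bs. set bs \<subseteq> Basis \<and> length bs \<in> {1, 2} \<longrightarrow>
                    supp (mpdv bs f) \<subseteq>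
                      Kbox \<union> Am \<union> Ap \<union> {z. Ham U L z \<ge> U \<sigma> + scale_a c\<^sub>K K \<epsilon> / 2}))" if "vth > 0" for vth
      using good eventually_layer_thin[OF K, of vth]
    proof eventually_elim
      case (elim \<epsilon>)
      note g = elim(1)
      define \<delta> where "\<delta> = scale_d K \<epsilon>"
      define a where "a = scale_a c\<^sub>K K \<epsilon>"
      define x where "x = inner_end (lam k) K \<epsilon>"
      define y where "y = outer_end (lam k) K vth \<epsilon>"
      have \<delta>: "\<delta> > 0" "\<delta> < M" "\<epsilon> > 0" "\<epsilon> < M" using g by (auto simp: good_def \<delta>_def)
      have x: "x = \<delta> / sqrt (stiffness lam L (Inl k))" by (simp add: x_def inner_end_def \<delta>_def)
      have sl: "sqrt (lam k) > 0" using lam by simp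
      have xy: "x < y" "y < 3 / 2 * x"
        using sl \<delta> \<open>vth > 0\<close> elim(2) by (auto simp: x_def y_def inner_end_def outer_end_def \<delta>_def divide_simps)
      have x0: "x > 0" using \<delta> sl by (simp add: x)
      have slab: "P.slab \<delta> = tube L \<sigma> e lam k K \<epsilon>"
        unfolding P.slab_def tube_def \<delta>_def by (subst all_triple) (auto simp: q)
      have box: "saddle_box L \<sigma> e lam k K \<epsilon> = P.box \<delta>"
        unfolding P.box_slab saddle_box_def slab by (auto simp: q inner_end_def \<delta>_def)
      have Am: "layer_minus L \<sigma> e lam k K vth \<epsilon> =
          P.slab \<delta> \<inter> {z. - y \<le> P.q (Inl k) z \<and> P.q (Inl k) z \<le> - x}"
        unfolding layer_minus_def slab by (auto simp: q x_def y_def)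
      have Ap: "layer_plus L \<sigma> e lam k K vth \<epsilon> =
          P.slab \<delta> \<inter> {z. x \<le> P.q (Inl k) z \<and> P.q (Inl k) z \<le> y}"
        unfolding layer_plus_def slab by (auto simp: q x_def y_def)
      define S where "S = {z. Ham U L z < Ham U L z\<^sub>0 + a} - P.box \<delta>"
      define Jm where "Jm = connected_component_set S xm"
      define Js where "Js = connected_component_set S xs"
      have J: "J_comp U L \<sigma> e lam k c\<^sub>K K \<epsilon> m = Jm" "J_comp U L \<sigma> e lam k c\<^sub>K K \<epsilon> s = Js"
        "J_rest U L m s \<sigma> e lam k c\<^sub>K K \<epsilon> = \<Union> (components S - {Jm, Js})"
        by (simp_all add: J_rest_def J_comp_def Jm_def Js_def S_def J_set_def box a_def xm_def xs_def)
      have small: "w \<in> ball z\<^sub>0 r" if "\<And>j. \<bar>P.q j w\<bar> \<le> 2 * \<delta> / sqrt (stiffness lam L j)" for w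
        using P.box_subset_ball[OF r(1) _ _ that] a(7)[OF g] \<delta>(1) unfolding \<Sigma>_def \<delta>_def by simp
      have box_ball: "P.box \<delta> \<subseteq> ball z\<^sub>0 r"
      proof
        fix w assume w: "w \<in> P.box \<delta>"
        show "w \<in> ball z\<^sub>0 r"
        proof (rule small)
          fix j
          have "\<delta> / sqrt (stiffness lam L (Inl k)) \<le> 2 * \<delta> / sqrt (stiffness lam L (Inl k))"
            using \<delta>(1) less_imp_le[OF lam] by (intro divide_right_mono) auto
          then show "\<bar>P.q j w\<bar> \<le> 2 * \<delta> / sqrt (stiffness lam L j)"
            using w by (cases "j = Inl k") (auto simp: P.box_def)
        qed
      qed
      have out: "xm \<notin> P.box \<delta>" "xs \<notin> P.box \<delta>" using box_ball r by auto
      have a': "0 < a" "a \<le> \<delta>\<^sup>2 / 2" "a \<le> 1" "a \<le> a\<^sub>0" using a[OF g] by (simp_all add: a_def \<delta>_def)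
      have "xs \<notin> Jm" using a0(2)[OF a'(4) \<delta>(1) a'(2)] by (simp add: Jm_def S_def)
      have disj: "Jm \<inter> Js = {}"
      proof -
        have "xs \<in> S" using Hms a' out by (simp add: S_def)
        then show ?thesis using \<open>xs \<notin> Jm\<close> unfolding Jm_def Js_def
          using connected_component_nonoverlap[of S xm xs] by fastforce
      qed
      have side_m: "w \<in> Jm" if "Ham U L w < Ham U L z\<^sub>0 + a" "w \<in> P.slab \<delta>"
          "P.q (Inl k) w < - x" "- (3 / 2 * x) \<le> P.q (Inl k) w" for w
        unfolding Jm_def S_def
        by (rule P.side_component[of 1, OF _ cl(1) orient(1) Hms(1) out(1) \<delta>(1) a'(1,2) small that(1)])
          (use that in \<open>auto simp: P.slab_def x\<close>)
      have side_s: "w \<in> Js" if "Ham U L w < Ham U L z\<^sub>0 + a" "w \<in> P.slab \<delta>"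
          "x < P.q (Inl k) w" "P.q (Inl k) w \<le> 3 / 2 * x" for w
        unfolding Js_def S_def
        by (rule P.side_component[of "- 1", OF _ cl(2) orient(2) Hms(2) out(2) \<delta>(1) a'(1,2) small that(1)])
          (use that in \<open>auto simp: P.slab_def x\<close>)
      have Ckj: "Ck 2 (profile L \<gamma> \<sigma> e lam k \<epsilon>)"
      proof -
        have "Ck 2 (\<lambda>z. inverse (sqrt \<epsilon>) * (alpha_s L \<gamma> (lam k) * (z \<bullet> (e k, 0, 0) - \<sigma> \<bullet> e k) + z \<bullet> (0, e k, 0)
            + zeta_s L \<gamma> (lam k) * (z \<bullet> (0, 0, e k))))"
          by (intro Ck_mult Ck_add Ck_diff Ck_const Ck_bounded_linear bounded_linear_inner_left)
        moreover have "Lambda_s L \<gamma> \<sigma> e lam k z / sqrt \<epsilon> = inverse (sqrt \<epsilon>) * (alpha_s L \<gamma> (lam k) * (z \<bullet> (e k, 0, 0) - \<sigma> \<bullet> e k) + z \<bullet> (0, e k, 0)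
            + zeta_s L \<gamma> (lam k) * (z \<bullet> (0, 0, e k)))" for z
          by (cases z) (simp add: Lambda_s_def qc_def vc_def wc_def inner_diff_left divide_inverse mult.commute)
        ultimately show ?thesis unfolding profile_def[abs_def] using Ck_compose[OF Ck_Phi_s] by simp
      qed
      have ramp_values: "ramp (- x) (- y) t = 0" if "- x \<le> t" for t
        unfolding ramp_def using that xy x0
        by (intro smooth_step_low order_trans[OF divide_nonneg_neg]) auto
      have ramp_values': "ramp (- x) (- y) t = 1" if "t \<le> - y" for t
      proof -
        have "1 \<le> (t - - x) / (- y - - x)" using that xy by (subst neg_le_divide_eq) auto
        then show ?thesis unfolding ramp_def by (intro smooth_step_high) linarith
      qed
      have ramp_values'': "ramp x y t = 0" if "t \<le> x" for t
        unfolding ramp_def using that xy x0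
        by (intro smooth_step_low order_trans[OF divide_nonpos_pos]) auto
      have ramp_values''': "ramp x y t = 1" if "y \<le> t" for t
      proof -
        have "1 \<le> (t - x) / (y - x)" using that xy by (subst pos_le_divide_eq) auto
        then show ?thesis unfolding ramp_def by (intro smooth_step_high) linarith
      qed
      have CkG: "Ck 2 (G \<epsilon>)" using smG by (simp add: smooth_def)
      have G1': "G \<epsilon> z = 1" if "Ham U L z \<le> Ham U L z\<^sub>0 + a / 2" for z
        using G1[OF g] that by (simp add: a_def)
      have G0': "G \<epsilon> z = 0" if "Ham U L z \<ge> Ham U L z\<^sub>0 + 5 * a / 6" for z
        using G0[OF g] that by (simp add: a_def)
      have j_range: "0 \<le> profile L \<gamma> \<sigma> e lam k \<epsilon> z" "profile L \<gamma> \<sigma> e lam k \<epsilon> z \<le> 1" for z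
        by (simp_all add: profile_def Phi_s_range)
      obtain f where f: "Ck 2 f" "compact (supp f)" "range f \<subseteq> {0..1}"
        "\<forall>z\<in>layer_minus L \<sigma> e lam k K vth \<epsilon>. f z = G \<epsilon> z * (profile L \<gamma> \<sigma> e lam k \<epsilon> z +
            ramp (- x) (- y) (P.q (Inl k) z) * (1 - profile L \<gamma> \<sigma> e lam k \<epsilon> z))"
        "\<forall>z\<in>P.box \<delta>. f z = G \<epsilon> z * profile L \<gamma> \<sigma> e lam k \<epsilon> z"
        "\<forall>z\<in>layer_plus L \<sigma> e lam k K vth \<epsilon>. f z = G \<epsilon> z * (1 - ramp x y (P.q (Inl k) z)) * profile L \<gamma> \<sigma> e lam k \<epsilon> z"
        "\<forall>z\<in>Jm - layer_minus L \<sigma> e lam k K vth \<epsilon>. f z = G \<epsilon> z"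
        "\<forall>z\<in>Js - layer_plus L \<sigma> e lam k K vth \<epsilon>. f z = 0"
        "\<forall>z\<in>\<Union> (components S - {Jm, Js}). f z = 0"
        "\<And>bs. bs \<noteq> [] \<Longrightarrow> supp (mpdv bs f) \<subseteq> P.box \<delta> \<union> layer_minus L \<sigma> e lam k K vth \<epsilon> \<union>
            layer_plus L \<sigma> e lam k K vth \<epsilon> \<union> {z. Ham U L z \<ge> Ham U L z\<^sub>0 + a / 2}"
        "\<And>z. z \<notin> ball z\<^sub>0 r \<Longrightarrow> f z = (if z \<in> Jm then G \<epsilon> z else 0)"
        by (rule P.glued_function[OF x xy \<delta>(1) a'(1-3) small comp S_def Jm_def Js_def disj side_m side_s CkG
          G_range G1' G0' Ckj j_range Ck_ramp ramp_range ramp_values ramp_values' Ck_ramp ramp_range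
          ramp_values'' ramp_values''' Am Ap]; (assumption | (rule that; assumption)))
      have "admissible m s \<epsilon> f"
      proof -
        have near: "closure (ball w \<epsilon>) \<subseteq> ball w \<rho>" if "M \<le> \<rho>" for w :: "'d phase" and \<rho>
        proof -
          have "closure (ball w \<epsilon>) \<subseteq> cball w \<epsilon>" by (intro closure_minimal) auto
          then show ?thesis using that \<delta>(4) by fastforce
        qed
        have inS: "ball w \<rho> \<subseteq> connected_component_set S w"
          if "\<rho> > 0" "ball w \<rho> \<subseteq> {z. Ham U L z < U \<sigma>} - ball z\<^sub>0 r" for w \<rho>
        proof (rule connected_component_maximal)
          show "ball w \<rho> \<subseteq> S" using that(2) box_ball a'(1) by (force simp: S_def)
        qed (use that in auto)
        have f_m: "f z = 1" if z: "z \<in> ball xm \<rho>m" for z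
        proof -
          have "z \<in> Jm" using inS[OF \<rho>ms(1,2)] z unfolding Jm_def by blast
          moreover have "Ham U L z < U \<sigma>" "z \<notin> ball z\<^sub>0 r" using \<rho>ms(2) z by auto
          ultimately show ?thesis using f(11)[of z] G1'[of z] a'(1) by simp
        qed
        have f_s: "f z = 0" if z: "z \<in> ball xs \<rho>s" for z
        proof -
          have "z \<notin> Jm" using inS[OF \<rho>ms(3,4)] z disj unfolding Js_def by blast
          moreover have "z \<notin> ball z\<^sub>0 r" using \<rho>ms(4) z by auto
          ultimately show ?thesis using f(11)[of z] by simp
        qed
        have "const_near f 1 (closure (ball xm \<epsilon>))"
          unfolding const_near_def using near[OF M(5)] f_m by (intro exI[of _ "ball xm \<rho>m"]) auto
        moreover have "const_near f 0 (closure (ball xs \<epsilon>))"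
          unfolding const_near_def using near[OF M(6)] f_s by (intro exI[of _ "ball xs \<rho>s"]) auto
        ultimately show ?thesis by (simp add: admissible_def xm_def xs_def)
      qed
      have cutoffs: "flat_cutoff (ramp (- x) (- y)) (- x) (- y)" "flat_cutoff (ramp x y) x y"
        using xy by (auto intro!: flat_cutoff_ramp)
      have deriv_supp: "\<forall>bs. set bs \<subseteq> Basis \<and> length bs \<in> {1, 2} \<longrightarrow>
          supp (mpdv bs f) \<subseteq> P.box \<delta> \<union> layer_minus L \<sigma> e lam k K vth \<epsilon> \<union>
            layer_plus L \<sigma> e lam k K vth \<epsilon> \<union> {z. Ham U L z \<ge> U \<sigma> + scale_a c\<^sub>K K \<epsilon> / 2}"
      proof (intro allI impI)
        fix bs :: "'d phase list" assume "set bs \<subseteq> Basis \<and> length bs \<in> {1, 2}"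
        then have "bs \<noteq> []" by auto
        from f(10)[OF this] show "supp (mpdv bs f) \<subseteq> P.box \<delta> \<union> layer_minus L \<sigma> e lam k K vth \<epsilon> \<union>
            layer_plus L \<sigma> e lam k K vth \<epsilon> \<union> {z. Ham U L z \<ge> U \<sigma> + scale_a c\<^sub>K K \<epsilon> / 2}"
          unfolding Hz0 a_def .
      qed
      note f' = f(1-9)[unfolded q]
      show ?case
        unfolding Let_def J box x_def[symmetric] y_def[symmetric]
        by (intro exI[of _ f] exI[of _ "ramp (- x) (- y)"] exI[of _ "ramp x y"] conjI; fact)
    qed
    show ?thesis using partG partF by (intro exI[of _ G] exI[of _ "\<lambda>bs. \<bar>C bs\<bar>"]) blast
  qed
  note main = this
  show ?thesis
    by (rule eventually_mono[OF eventually_at_right_real[of 0 "1 / 2"]], simp)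
      (rule eventually_mono[OF eventually_gt_at_top[of 0]], rule main, auto)
qed

end
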